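(* Let $\kappa$ be a positive definite kernel on $X$, $\mathbf A=(A_i)_{i\in I}$ an $(I^+,I^-)$-condenser, and $\mathbf f$, $\mathbf a$, $\mathbf g$ as in the context. For all $\lambda\in\mathcal G_{\mathbf f}(\mathbf A,\mathbf a,\mathbf g)$ and all $i\in I$, $$a_i\,W_\lambda^i(x)\ge\bigl\langle W_\lambda^i,\lambda^i\bigr\rangle\,g_i(x)\quad\text{n.e. in }A_i.$$
   Context: Let $X$ be a locally compact Hausdorff space and $\mathfrak M$ the space of real-valued (signed) Radon measures on $X$. For a locally compact space $Y$, $\Phi(Y)$ is the set of lower semicontinuous $\psi:Y\to(-\infty,\infty]$, with $\psi\ge0$ required unless $Y$ is compact. Write $\langle u,\nu\rangle:=\int u\,d\nu$. A kernel is an element $\kappa\in\Phi(X\times X)$; $\kappa(\nu,\nu_1):=\int\kappa\,d(\nu\otimes\nu_1)$ and $\kappa(x,\nu):=\int\kappa(x,y)\,d\nu(y)$ whenever well defined. $\kappa$ is positive definite if it is symmetric and $\kappa(\nu,\nu)\ge0$ for every $\nu\in\mathfrak M$ for which it is defined. Then $\mathcal E:=\{\nu\in\mathfrak M:-\infty<\kappa(\nu,\nu)<\infty\}$ is a pre-Hilbert space with scalar product $\kappa(\nu,\nu_1)$ and seminorm $\|\nu\|:=\sqrt{\kappa(\nu,\nu)}$. $\mathfrak M^+(E)$ is the set of nonnegative measures supported by the closed set $E$; $\mathcal E^+:=\mathfrak M^+(X)\cap\mathcal E$. The interior capacity of $E\subset X$ is $C(E):=[\inf\|\nu\|^2]^{-1}$,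 the infimum over $\nu\in\mathcal E^+$ with $\nu(X)=1$ and compact support contained in $E$ ($\inf\varnothing=\infty$, $1/\infty=0$, $1/0=\infty$). A property holds nearly everywhere (n.e.) in $E$ if the set of $x\in E$ where it fails has interior capacity zero. $I^+$, $I^-$ are disjoint countable (finite or infinite) sets of indices in $\mathbb N$, $I^-$ possibly empty, $I=I^+\cup I^-$; $\alpha_i=+1$ for $i\in I^+$ and $\alpha_i=-1$ for $i\in I^-$. An $(I^+,I^-)$-condenser is a family $\mathbf A=(A_i)_{i\in I}$ of nonempty closed sets in $X$ such that every compact set meets at most finitely many $A_i$ and $A_i\cap A_j=\varnothing$ for $i\in I^+$, $j\in I^-$. $\mathfrak M(\mathbf A):=\prod_{i\in I}\mathfrak M^+(A_i)$ consists of vector measures $\mu=(\mu^i)_{i\in I}$. Put $\kappa(\mu,\mu_1):=\sum_{i,j\in I}\alpha_i\alpha_j\kappa(\mu^i,\mu_1^j)$ and $\kappa_\mu=(\kappa^i_\mu)_{i\in I}$ with $\kappa_\mu^i(x):=\sum_{j\in I}\alpha_i\alpha_j\kappa(x,\mu^j)$. $\mathcal E(\mathbf A)$ is the set of $\mu\in\mathfrak M(\mathbf A)$ with $\kappa(\mu,\mu)$ finite (absolute convergence). External field: $\mathbf f=(f_i)_{i\in I}$, where for each $i$ there are $f_{i1},f_{i2}\in\Phi(X)$ with $f_{i2}\ne\infty$ n.e. in $X$ and $f_i=f_{i1}-f_{i2}$ (defined exactly where the right side is). $\mathbf g=(g_i)_{i\in I}$ with $g_i:A_i\to(0,\infty)$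 continuous; $\mathbf a=(a_i)_{i\in I}$ with $a_i>0$. $\langle\mathbf f,\mu\rangle:=\sum_{i\in I}\langle f_i,\mu^i\rangle$ (finite iff the series converges absolutely). $\mathbf W_\mu=(W^i_\mu)_{i\in I}:=\kappa_\mu+\mathbf f$ (for $\mu\in\mathcal E(\mathbf A)$ it is defined and $\ne-\infty$ n.e. in $X$) and $G_{\mathbf f}(\mu):=\kappa(\mu,\mu)+2\langle\mathbf f,\mu\rangle$. $\mathcal E_{\mathbf f}(\mathbf A,\mathbf a,\mathbf g)$ is the set of $\mu\in\mathcal E(\mathbf A)$ with $\langle g_i,\mu^i\rangle=a_i$ for all $i\in I$ and $\langle\mathbf f,\mu\rangle$ finite. $G_{\mathbf f}(\mathbf A,\mathbf a,\mathbf g):=\inf_{\mu\in\mathcal E_{\mathbf f}(\mathbf A,\mathbf a,\mathbf g)}G_{\mathbf f}(\mu)$ ($\inf\varnothing=+\infty$). $\mathcal G_{\mathbf f}(\mathbf A,\mathbf a,\mathbf g)$ is the set of $\lambda\in\mathcal E_{\mathbf f}(\mathbf A,\mathbf a,\mathbf g)$ with $G_{\mathbf f}(\lambda)=G_{\mathbf f}(\mathbf A,\mathbf a,\mathbf g)$ (equilibrium measures). *)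

theory Defs
  imports "HOL-Analysis.Analysis"
begin

text \<open>
  Expressions that need not be well defined have values in \<^typ>\<open>ereal option\<close>, with
  \<^term>\<open>None\<close> for ``undefined''; functions that need not be defined everywhere have type
  \<^typ>\<open>'a \<rightharpoonup> ereal\<close>. This avoids the conventional values of
  \<^term>\<open>\<infinity> - \<infinity> :: ereal\<close>.
\<close>

fun padd :: "ereal option \<Rightarrow> ereal option \<Rightarrow> ereal option" where
  "padd (Some x) (Some y) =
     (if x = \<infinity> \<and> y = -\<infinity> \<or> x = -\<infinity> \<and> y = \<infinity> then None else Some (x + y))"
| "padd None _ = None"
| "padd _ None = None"

definition pdiff :: "ereal \<Rightarrow> ereal \<Rightarrow> ereal option" where
  "pdiff x y = padd (Some x) (Some (- y))"

definition pfinite :: "ereal option \<Rightarrow> bool" where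
  "pfinite z \<longleftrightarrow> (\<exists>r. z = Some (ereal r))"

text \<open>
  The integral of a partial function with respect to a nonnegative measure. It is defined if the
  function is defined almost everywhere, is measurable, and the integrals of its positive and
  negative parts are not both infinite. (\<^const>\<open>e2ennreal\<close> maps negative numbers to 0.)
\<close>

definition pint :: "'a measure \<Rightarrow> ('a \<rightharpoonup> ereal) \<Rightarrow> ereal option" where
  "pint M u =
     (let v = (\<lambda>x. case u x of None \<Rightarrow> 0 | Some r \<Rightarrow> r) in
      if (AE x in M. u x \<noteq> None) \<and> v \<in> borel_measurable M
      then pdiff (enn2ereal (\<integral>\<^sup>+x. e2ennreal (v x) \<partial>M)) (enn2ereal (\<integral>\<^sup>+x. e2ennreal (- v x) \<partial>M))
      else None)"

text \<open>
  Unordered sums. The value is finite iff all terms are defined and finite and the series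
  converges absolutely.
\<close>

definition psum :: "'i set \<Rightarrow> ('i \<rightharpoonup> ereal) \<Rightarrow> ereal option" where
  "psum J u = pint (count_space J) u"

text \<open>
  The integral of a function of class \<open>\<Phi>\<close> with respect to a nonnegative Radon measure is
  always defined and \<open>> -\<infinity>\<close>: either the function is nonnegative, or it is bounded below on a
  compact space, where Radon measures are finite.
\<close>

definition Phi :: "('b::topological_space \<Rightarrow> ereal) set" where
  "Phi = {\<psi>. (\<forall>t. open {y. t < \<psi> y}) \<and> (\<forall>y. \<psi> y \<noteq> -\<infinity>) \<and>
              (compact (UNIV :: 'b set) \<or> (\<forall>y. 0 \<le> \<psi> y))}"

definition eint :: "'a measure \<Rightarrow> ('a \<Rightarrow> ereal) \<Rightarrow> ereal" where
  "eint M u = enn2ereal (\<integral>\<^sup>+x. e2ennreal (u x) \<partial>M) - enn2ereal (\<integral>\<^sup>+x. e2ennreal (- u x) \<partial>M)"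


text \<open>
  Nonnegative Radon measures, as Borel measures (they correspond bijectively to the positive
  linear functionals on continuous functions with compact support). They need not be finite.
\<close>

definition radon :: "'a::topological_space measure \<Rightarrow> bool" where
  "radon M \<longleftrightarrow>
     sets M = sets borel \<and>
     (\<forall>K. compact K \<longrightarrow> emeasure M K < \<infinity>) \<and>
     (\<forall>B\<in>sets borel. emeasure M B = (INF U\<in>{U. open U \<and> B \<subseteq> U}. emeasure M U)) \<and>
     (\<forall>U. open U \<longrightarrow> emeasure M U = (SUP K\<in>{K. compact K \<and> K \<subseteq> U}. emeasure M K))"

definition msupport :: "'a::topological_space measure \<Rightarrow> 'a set" where
  "msupport M = {x. \<forall>U. open U \<and> x \<in> U \<longrightarrow> emeasure M U \<noteq> 0}"

definition radon_on :: "'a::topological_space set \<Rightarrow> 'a measure set" where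
  "radon_on E = {M. radon M \<and> msupport M \<subseteq> E}"

text \<open>
  The Radon product \<open>\<mu> \<otimes> \<nu>\<close>, a Borel measure on the product space. The product
  \<^term>\<open>\<mu> \<Otimes>\<^sub>M \<nu>\<close> cannot be used: \<open>X\<close> is not assumed second countable, so
  its \<open>\<sigma>\<close>-algebra may be too small for lower semicontinuous kernels, and the factors need not
  be \<open>\<sigma>\<close>-finite.
\<close>

definition radon_prod ::
  "'a::topological_space measure \<Rightarrow> 'b::topological_space measure \<Rightarrow> ('a \<times> 'b) measure" where
  "radon_prod \<mu> \<nu> = (THE \<pi>. radon \<pi> \<and>
     (\<forall>K L. compact K \<longrightarrow> compact L \<longrightarrow> emeasure \<pi> (K \<times> L) = emeasure \<mu> K * emeasure \<nu> L))"

text \<open>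
  A signed Radon measure \<open>\<nu> = \<nu>\<^sup>+ - \<nu>\<^sup>-\<close> is represented by its Jordan
  decomposition \<open>(\<nu>\<^sup>+, \<nu>\<^sup>-)\<close>. Both parts may be infinite, so
  the difference need not be a set function on all Borel sets; the parts are mutually singular
  on every compact set.
\<close>

definition signed_radon :: "'a::topological_space measure \<times> 'a measure \<Rightarrow> bool" where
  "signed_radon \<nu> \<longleftrightarrow> radon (fst \<nu>) \<and> radon (snd \<nu>) \<and>
     (\<forall>K. compact K \<longrightarrow>
        (\<exists>B\<in>sets borel. emeasure (fst \<nu>) (K \<inter> B) = 0 \<and> emeasure (snd \<nu>) (K - B) = 0))"


text \<open>\<open>\<kappa>(\<mu>, \<nu>)\<close> for nonnegative and for signed \<open>\<mu>, \<nu>\<close>.\<close>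

definition mutual_energy ::
  "('a::topological_space \<times> 'a \<Rightarrow> ereal) \<Rightarrow> 'a measure \<Rightarrow> 'a measure \<Rightarrow> ereal" where
  "mutual_energy \<kappa> \<mu> \<nu> = eint (radon_prod \<mu> \<nu>) \<kappa>"

definition signed_mutual_energy ::
  "('a::topological_space \<times> 'a \<Rightarrow> ereal) \<Rightarrow> 'a measure \<times> 'a measure
     \<Rightarrow> 'a measure \<times> 'a measure \<Rightarrow> ereal option" where
  "signed_mutual_energy \<kappa> \<mu> \<nu> =
     pdiff (mutual_energy \<kappa> (fst \<mu>) (fst \<nu>) + mutual_energy \<kappa> (snd \<mu>) (snd \<nu>))
           (mutual_energy \<kappa> (fst \<mu>) (snd \<nu>) + mutual_energy \<kappa> (snd \<mu>) (fst \<nu>))"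

definition potential ::
  "('a::topological_space \<times> 'a \<Rightarrow> ereal) \<Rightarrow> 'a measure \<Rightarrow> 'a \<Rightarrow> ereal" where
  "potential \<kappa> \<nu> x = eint \<nu> (\<lambda>y. \<kappa> (x, y))"

definition positive_definite :: "('a::topological_space \<times> 'a \<Rightarrow> ereal) \<Rightarrow> bool" where
  "positive_definite \<kappa> \<longleftrightarrow>
     (\<forall>x y. \<kappa> (x, y) = \<kappa> (y, x)) \<and>
     (\<forall>\<nu> r. signed_radon \<nu> \<longrightarrow> signed_mutual_energy \<kappa> \<nu> \<nu> = Some r \<longrightarrow> 0 \<le> r)"

definition energy_pos :: "('a::topological_space \<times> 'a \<Rightarrow> ereal) \<Rightarrow> 'a measure set" where
  "energy_pos \<kappa> = {\<nu>. radon \<nu> \<and> -\<infinity> < mutual_energy \<kappa> \<nu> \<nu> \<and> mutual_energy \<kappa> \<nu> \<nu> < \<infinity>}"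

text \<open>In \<^typ>\<open>ereal\<close>, \<open>Inf {} = \<infinity>\<close>, \<open>1 / \<infinity> = 0\<close> and \<open>1 / 0 = \<infinity>\<close>.\<close>

definition interior_capacity ::
  "('a::topological_space \<times> 'a \<Rightarrow> ereal) \<Rightarrow> 'a set \<Rightarrow> ereal" where
  "interior_capacity \<kappa> E =
     1 / (INF \<nu>\<in>{\<nu> \<in> energy_pos \<kappa>. emeasure \<nu> UNIV = 1 \<and>
                       compact (msupport \<nu>) \<and> msupport \<nu> \<subseteq> E}. mutual_energy \<kappa> \<nu> \<nu>)"

definition nearly_everywhere ::
  "('a::topological_space \<times> 'a \<Rightarrow> ereal) \<Rightarrow> 'a set \<Rightarrow> ('a \<Rightarrow> bool) \<Rightarrow> bool" where
  "nearly_everywhere \<kappa> E P \<longleftrightarrow> interior_capacity \<kappa> {x \<in> E. \<not> P x} = 0"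


definition condenser :: "nat set \<Rightarrow> nat set \<Rightarrow> (nat \<Rightarrow> 'a::topological_space set) \<Rightarrow> bool" where
  "condenser Ipos Ineg A \<longleftrightarrow>
     Ipos \<inter> Ineg = {} \<and>
     (\<forall>i\<in>Ipos \<union> Ineg. closed (A i) \<and> A i \<noteq> {}) \<and>
     (\<forall>K. compact K \<longrightarrow> finite {i \<in> Ipos \<union> Ineg. K \<inter> A i \<noteq> {}}) \<and>
     (\<forall>i\<in>Ipos. \<forall>j\<in>Ineg. A i \<inter> A j = {})"

definition sign :: "nat set \<Rightarrow> nat \<Rightarrow> ereal" where
  "sign Ipos i = (if i \<in> Ipos then 1 else - 1)"

text \<open>
  Vector measures are families \<open>\<mu> :: nat \<Rightarrow> 'a measure\<close> of which only the components with
  index in \<open>Ipos \<union> Ineg\<close> matter.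
\<close>

definition vector_measures ::
  "nat set \<Rightarrow> nat set \<Rightarrow> (nat \<Rightarrow> 'a::topological_space set) \<Rightarrow> (nat \<Rightarrow> 'a measure) set" where
  "vector_measures Ipos Ineg A = {\<mu>. \<forall>i\<in>Ipos \<union> Ineg. \<mu> i \<in> radon_on (A i)}"

definition vector_mutual_energy ::
  "('a::topological_space \<times> 'a \<Rightarrow> ereal) \<Rightarrow> nat set \<Rightarrow> nat set
     \<Rightarrow> (nat \<Rightarrow> 'a measure) \<Rightarrow> (nat \<Rightarrow> 'a measure) \<Rightarrow> ereal option" where
  "vector_mutual_energy \<kappa> Ipos Ineg \<mu> \<nu> =
     psum ((Ipos \<union> Ineg) \<times> (Ipos \<union> Ineg))
       (\<lambda>(i, j). Some (sign Ipos i * sign Ipos j * mutual_energy \<kappa> (\<mu> i) (\<nu> j)))"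

definition vector_potential ::
  "('a::topological_space \<times> 'a \<Rightarrow> ereal) \<Rightarrow> nat set \<Rightarrow> nat set
     \<Rightarrow> (nat \<Rightarrow> 'a measure) \<Rightarrow> nat \<Rightarrow> 'a \<rightharpoonup> ereal" where
  "vector_potential \<kappa> Ipos Ineg \<mu> i x =
     psum (Ipos \<union> Ineg) (\<lambda>j. Some (sign Ipos i * sign Ipos j * potential \<kappa> (\<mu> j) x))"

definition energy_vectors ::
  "('a::topological_space \<times> 'a \<Rightarrow> ereal) \<Rightarrow> nat set \<Rightarrow> nat set
     \<Rightarrow> (nat \<Rightarrow> 'a set) \<Rightarrow> (nat \<Rightarrow> 'a measure) set" where
  "energy_vectors \<kappa> Ipos Ineg A =
     {\<mu> \<in> vector_measures Ipos Ineg A. pfinite (vector_mutual_energy \<kappa> Ipos Ineg \<mu> \<mu>)}"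

definition external_field ::
  "('a::topological_space \<times> 'a \<Rightarrow> ereal) \<Rightarrow> nat set \<Rightarrow> nat set
     \<Rightarrow> (nat \<Rightarrow> 'a \<rightharpoonup> ereal) \<Rightarrow> bool" where
  "external_field \<kappa> Ipos Ineg f \<longleftrightarrow>
     (\<forall>i\<in>Ipos \<union> Ineg. \<exists>f1\<in>Phi. \<exists>f2\<in>Phi.
        nearly_everywhere \<kappa> UNIV (\<lambda>x. f2 x \<noteq> \<infinity>) \<and> (\<forall>x. f i x = pdiff (f1 x) (f2 x)))"

definition field_integral ::
  "nat set \<Rightarrow> nat set \<Rightarrow> (nat \<Rightarrow> 'a \<rightharpoonup> ereal) \<Rightarrow> (nat \<Rightarrow> 'a measure) \<Rightarrow> ereal option" where
  "field_integral Ipos Ineg f \<mu> = psum (Ipos \<union> Ineg) (\<lambda>i. pint (\<mu> i) (f i))"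

definition weighted_potential ::
  "('a::topological_space \<times> 'a \<Rightarrow> ereal) \<Rightarrow> nat set \<Rightarrow> nat set
     \<Rightarrow> (nat \<Rightarrow> 'a \<rightharpoonup> ereal) \<Rightarrow> (nat \<Rightarrow> 'a measure) \<Rightarrow> nat \<Rightarrow> 'a \<rightharpoonup> ereal" where
  "weighted_potential \<kappa> Ipos Ineg f \<mu> i x = padd (vector_potential \<kappa> Ipos Ineg \<mu> i x) (f i x)"

text \<open>\<open>G\<^sub>f(\<mu>)\<close>; used only for \<open>\<mu>\<close> for which both summands are defined and finite.\<close>

definition weighted_energy ::
  "('a::topological_space \<times> 'a \<Rightarrow> ereal) \<Rightarrow> nat set \<Rightarrow> nat set
     \<Rightarrow> (nat \<Rightarrow> 'a \<rightharpoonup> ereal) \<Rightarrow> (nat \<Rightarrow> 'a measure) \<Rightarrow> ereal" where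
  "weighted_energy \<kappa> Ipos Ineg f \<mu> =
     the (vector_mutual_energy \<kappa> Ipos Ineg \<mu> \<mu>) + 2 * the (field_integral Ipos Ineg f \<mu>)"

text \<open>The function \<open>g\<^sub>i\<close> is given on \<open>A\<^sub>i\<close> only, hence the restriction.\<close>

definition admissible ::
  "('a::topological_space \<times> 'a \<Rightarrow> ereal) \<Rightarrow> nat set \<Rightarrow> nat set \<Rightarrow> (nat \<Rightarrow> 'a \<rightharpoonup> ereal)
     \<Rightarrow> (nat \<Rightarrow> 'a set) \<Rightarrow> (nat \<Rightarrow> real) \<Rightarrow> (nat \<Rightarrow> 'a \<Rightarrow> real) \<Rightarrow> (nat \<Rightarrow> 'a measure) set" where
  "admissible \<kappa> Ipos Ineg f A a g =
     {\<mu> \<in> energy_vectors \<kappa> Ipos Ineg A.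
        (\<forall>i\<in>Ipos \<union> Ineg. pint (\<mu> i) ((\<lambda>x. Some (ereal (g i x))) |` A i) = Some (ereal (a i))) \<and>
        pfinite (field_integral Ipos Ineg f \<mu>)}"

definition equilibrium ::
  "('a::topological_space \<times> 'a \<Rightarrow> ereal) \<Rightarrow> nat set \<Rightarrow> nat set \<Rightarrow> (nat \<Rightarrow> 'a \<rightharpoonup> ereal)
     \<Rightarrow> (nat \<Rightarrow> 'a set) \<Rightarrow> (nat \<Rightarrow> real) \<Rightarrow> (nat \<Rightarrow> 'a \<Rightarrow> real) \<Rightarrow> (nat \<Rightarrow> 'a measure) set" where
  "equilibrium \<kappa> Ipos Ineg f A a g =
     {l \<in> admissible \<kappa> Ipos Ineg f A a g.
        weighted_energy \<kappa> Ipos Ineg f l =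
          (INF \<mu>\<in>admissible \<kappa> Ipos Ineg f A a g. weighted_energy \<kappa> Ipos Ineg f \<mu>)}"

end

theory Submission
  imports Defs
begin

text \<open>
  Let \<open>w\<close> be the number \<open>\<langle>W\<^sup>i, \<lambda>\<^sup>i\<rangle>\<close>, where \<open>W\<^sup>i\<close> is the \<open>i\<close>-th weighted potential of the equilibrium measure
  \<open>\<lambda>\<close>. If the inequality \<open>a\<^sub>i W\<^sup>i \<ge> w g\<^sub>i\<close> fails on a set of positive capacity, there is a probability measure \<open>\<nu>\<close> of finite
  energy with compact support in the exceptional set. A multiple \<open>\<tau>\<close> of a restriction of \<open>\<nu>\<close> satisfies
  \<open>\<langle>g\<^sub>i, \<tau>\<rangle> = a\<^sub>i\<close>, and integrating \<open>a\<^sub>i W\<^sup>i < w g\<^sub>i\<close> with respect to \<open>\<tau>\<close> gives \<open>\<langle>W\<^sup>i, \<tau>\<rangle> < w\<close>. But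
  \<open>2 (\<langle>W\<^sup>i, \<tau>\<rangle> - w)\<close> is the derivative at \<open>t = 0\<close> of the weighted energy when \<open>\<lambda>\<^sup>i\<close> is replaced by
  \<open>(1 - t) \<lambda>\<^sup>i + t \<tau>\<close>, and minimality of \<open>\<lambda>\<close> forces it to be nonnegative (\<open>first_variation\<close>).

  The competitor \<open>\<tau>\<close> has to keep all energies and field integrals finite. This is achieved by restricting \<open>\<nu>\<close> to a
  compact set of positive measure on which the potentials and the two parts of the field are bounded. Such a set exists
  because the potential of the total mass \<open>\<Sigma>\<^sub>j \<lambda>\<^sup>j\<close> is finite \<open>\<nu>\<close>-almost everywhere (\<open>infinite_potential_null\<close>). The
  reason is positive definiteness: since the potential is integrable with respect to each \<open>\<lambda>\<^sup>j\<close>, the set where it is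
  infinite is null for each \<open>\<lambda>\<^sup>j\<close>; so the restriction of \<open>\<nu>\<close> to a compact part of it is singular to \<open>\<Sigma>\<^sub>j \<lambda>\<^sup>j\<close>, and the
  energy of their difference could not be nonnegative if the mutual energy were infinite.

  Energies are integrals over Radon products. That the Radon product exists and is unique, that integrals of
  lower semicontinuous functions over it are iterated integrals in either order, and that these are bilinear in the
  factors, is established first. The product is constructed from its values \<open>\<integral> \<nu>(W\<^sub>x) d\<mu>(x)\<close> on open sets
  (\<open>radon_product_exists\<close>); the tools are a Caratheodory extension from open sets (\<open>radon_extension\<close>), monotone
  convergence for directed families of lower semicontinuous functions (\<open>nn_integral_SUP_directed\<close>), and the fact that
  compact rectangles determine a Radon measure (\<open>radon_eqI\<close>).
\<close>

section \<open>Topology of locally compact Hausdorff spaces\<close>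

abbreviation locally_compact_type :: "'a::topological_space itself \<Rightarrow> bool" where
  "locally_compact_type _ \<equiv> locally_compact_space (euclidean :: 'a topology)"

lemma locally_compact_type_prod:
  assumes "locally_compact_type TYPE('a::topological_space)"
    and "locally_compact_type TYPE('b::topological_space)"
  shows "locally_compact_type TYPE('a \<times> 'b)"
  using locally_compact_space_prod_topology[of "euclidean :: 'a topology" "euclidean :: 'b topology"]
    assms by simp

lemma relatively_compact_nbhd_of_compact:
  fixes K W :: "'a::t2_space set"
  assumes lc: "locally_compact_type TYPE('a)" and "compact K" "open W" "K \<subseteq> W"
  obtains V where "open V" "K \<subseteq> V" "compact (closure V)" "closure V \<subseteq> W"
proof -
  have hd: "Hausdorff_space (euclidean :: 'a topology)"
    unfolding Hausdorff_space_def disjnt_def by (simp, metis hausdorff)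
  have nb: "neighbourhood_base_of (\<lambda>C. compactin euclidean C \<and> closedin euclidean C) (euclidean :: 'a topology)"
    using lc locally_compact_Hausdorff_imp_regular_space[OF lc hd]
      locally_compact_regular_space_neighbourhood_base by blast
  have "\<exists>U. open U \<and> x \<in> U \<and> compact (closure U) \<and> closure U \<subseteq> W" if "x \<in> K" for x
  proof -
    have "x \<in> W" using that assms(4) by blast
    then obtain U C where "open U" "x \<in> U" "U \<subseteq> C" "C \<subseteq> W" "compact C" "closed C"
      using nb \<open>open W\<close> unfolding neighbourhood_base_of by (simp, metis)
    moreover have "closure U \<subseteq> C"
      using \<open>U \<subseteq> C\<close> \<open>closed C\<close> by (rule closure_minimal)
    moreover have "compact (closure U)"
      using compact_Int_closed[OF \<open>compact C\<close> closed_closure, of U] \<open>closure U \<subseteq> C\<close>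
      by (simp add: inf_absorb2)
    ultimately show ?thesis by blast
  qed
  then obtain U where U: "open (U x)" "x \<in> U x" "compact (closure (U x))" "closure (U x) \<subseteq> W"
    if "x \<in> K" for x
    by metis
  obtain D where D: "D \<subseteq> K" "finite D" "K \<subseteq> (\<Union>x\<in>D. U x)"
    using compactE_image[OF \<open>compact K\<close>, of K U] U by blast
  show ?thesis
  proof
    have cl: "closure (\<Union>x\<in>D. U x) = (\<Union>x\<in>D. closure (U x))"
      using \<open>finite D\<close> by (induction D rule: finite_induct) auto
    show "compact (closure (\<Union>x\<in>D. U x))"
      unfolding cl using D(1,2) U(3) by (intro compact_UN) auto
    show "closure (\<Union>x\<in>D. U x) \<subseteq> W"
      unfolding cl using D(1) U(4) by blast
    show "open (\<Union>x\<in>D. U x)" "K \<subseteq> (\<Union>x\<in>D. U x)"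
      using D U by auto
  qed
qed

lemma relatively_compact_nbhd:
  fixes W :: "'a::t2_space set"
  assumes "locally_compact_type TYPE('a)" "open W" "x \<in> W"
  obtains V where "open V" "x \<in> V" "compact (closure V)" "closure V \<subseteq> W"
  using relatively_compact_nbhd_of_compact[OF assms(1), of "{x}" W] assms by auto

section \<open>Lower semicontinuous functions\<close>

definition lower_semicontinuous :: "('a::topological_space \<Rightarrow> 'b::linorder) \<Rightarrow> bool" where
  "lower_semicontinuous h \<longleftrightarrow> (\<forall>t. open {x. t < h x})"

lemma lower_semicontinuous_borel:
  fixes h :: "'a::topological_space \<Rightarrow> 'b::{linorder_topology, second_countable_topology}"
  assumes "lower_semicontinuous h"
  shows "h \<in> borel_measurable borel"
  using assms by (intro borel_measurableI_greater) (auto simp: lower_semicontinuous_def)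

text \<open>
  Every \<open>t\<close> in \<open>[0, \<infinity>]\<close> is the increasing limit of step functions that are nonnegative
  combinations of indicators of the \<^emph>\<open>open\<close> rays \<open>{q<..}\<close>. Composed with a lower
  semicontinuous function, the rays become open sets, so that assertions about integrals of lower
  semicontinuous functions reduce to assertions about measures of open sets. The value of the
  \<open>n\<close>-th step function is the largest among the first \<open>n\<close> elements of a fixed countable dense set
  that lies strictly below \<open>t\<close>; enlarging the finite set enlarges the value.
\<close>

definition levels :: "nat \<Rightarrow> ennreal set" where
  "levels n = (\<lambda>k. ennreal (real_of_rat (from_nat k))) ` {..<n}"

lemma staircase_coefficients:
  fixes F :: "ennreal set"
  assumes "finite F" "\<And>q. q \<in> F \<Longrightarrow> q < \<infinity>"
  shows "\<exists>c. \<forall>t. Sup {q \<in> F. q < t} = (\<Sum>q\<in>F. c q * indicator {q<..} t :: ennreal)"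
  using assms
proof (induction F rule: finite_linorder_max_induct)
  case empty
  then show ?case by (simp add: bot_ennreal)
next
  case (insert b F)
  then obtain c where c: "Sup {q \<in> F. q < t} = (\<Sum>q\<in>F. c q * indicator {q<..} t)" for t
    by auto
  have b: "b \<notin> F" "b < \<infinity>" using insert by auto
  define m where "m = Sup F"
  have "m \<le> b" using insert unfolding m_def by (intro Sup_least less_imp_le) auto
  have "Sup {q \<in> insert b F. q < t} = (\<Sum>q\<in>insert b F. (c(b := b - m)) q * indicator {q<..} t)" for t
  proof -
    have *: "(\<Sum>q\<in>insert b F. (c(b := b - m)) q * indicator {q<..} t)
        = (b - m) * indicator {b<..} t + Sup {q \<in> F. q < t}"
      unfolding c sum.insert[OF insert(1) b(1)]
      using b(1) by (intro arg_cong2[where f = "(+)"] sum.cong) auto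
    show ?thesis
    proof (cases "b < t")
      case True
      then have "{q \<in> F. q < t} = F" "{q \<in> insert b F. q < t} = insert b F"
        using insert by (auto dest: order.strict_trans)
      then have "Sup {q \<in> insert b F. q < t} = b" "Sup {q \<in> F. q < t} = m"
        using \<open>m \<le> b\<close> by (auto simp: m_def sup_absorb1)
      then show ?thesis using True \<open>m \<le> b\<close> unfolding *
        by (simp add: diff_add_cancel_ennreal)
    next
      case False
      then have "{q \<in> insert b F. q < t} = {q \<in> F. q < t}" by auto
      with False show ?thesis unfolding * by simp
    qed
  qed
  then show ?case by blast
qed

text \<open>The increments between consecutive levels, as \<open>staircase_coefficients\<close> produces them.\<close>

definition weight :: "nat \<Rightarrow> ennreal \<Rightarrow> ennreal" where
  "weight n = (SOME c. \<forall>t. Sup {q \<in> levels n. q < t} = (\<Sum>q\<in>levels n. c q * indicator {q<..} t))"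

lemma finite_levels: "finite (levels n)"
  by (simp add: levels_def)

lemma staircase_eq: "Sup {q \<in> levels n. q < t} = (\<Sum>q\<in>levels n. weight n q * indicator {q<..} t)"
proof -
  have "\<exists>c. \<forall>t. Sup {q \<in> levels n. q < t} = (\<Sum>q\<in>levels n. c q * indicator {q<..} t :: ennreal)"
    by (rule staircase_coefficients) (auto simp: levels_def)
  from someI_ex[OF this] show ?thesis unfolding weight_def by blast
qed

lemma incseq_staircase: "incseq (\<lambda>n. Sup {q \<in> levels n. q < t})"
  by (intro incseq_SucI Sup_subset_mono) (auto simp: levels_def)

lemma SUP_staircase: "(SUP n. Sup {q \<in> levels n. q < t}) = t"
proof (rule antisym)
  show "(SUP n. Sup {q \<in> levels n. q < t}) \<le> t"
    by (intro SUP_least Sup_least less_imp_le) auto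
  show "t \<le> (SUP n. Sup {q \<in> levels n. q < t})"
  proof (rule dense_le)
    fix u assume "u < t"
    then obtain r where r: "u < ennreal r" "ennreal r < t" "0 \<le> r"
      by (metis dense ennreal_cases linorder_not_less order_less_le top_greatest)
    obtain r' where r': "r < r'" "ennreal r' < t"
    proof (cases t)
      case (real s)
      with r have "r < s" by (simp add: ennreal_less_iff)
      then obtain r' where "r < r'" "r' < s" using dense by blast
      with real r show ?thesis by (intro that[of r']) (auto simp: ennreal_less_iff)
    qed (intro that[of "r + 1"], auto)
    obtain p :: rat where p: "r < real_of_rat p" "real_of_rat p < r'"
      using of_rat_dense[OF r'(1)] by blast
    have "u \<le> ennreal (real_of_rat p)"
      using p r by (meson ennreal_leI less_imp_le order_less_le_trans)
    also have "ennreal (real_of_rat p) < t"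
      using p r' r by (meson ennreal_leI less_imp_le order_le_less_trans)
    then have "ennreal (real_of_rat p) \<le> Sup {q \<in> levels (Suc (to_nat p)). q < t}"
      by (intro Sup_upper) (auto simp: levels_def intro!: image_eqI[of _ _ "to_nat p"])
    also have "\<dots> \<le> (SUP n. Sup {q \<in> levels n. q < t})" by (rule SUP_upper) simp
    finally show "u \<le> (SUP n. Sup {q \<in> levels n. q < t})" .
  qed
qed

definition layer_sum :: "nat \<Rightarrow> 'a measure \<Rightarrow> ('a \<Rightarrow> ennreal) \<Rightarrow> ennreal" where
  "layer_sum n M u = (\<Sum>q\<in>levels n. weight n q * emeasure M {x. q < u x})"

lemma
  fixes u :: "'a::topological_space \<Rightarrow> ennreal"
  assumes M: "sets M = sets borel" and u: "lower_semicontinuous u"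
  shows incseq_layer_sum: "incseq (\<lambda>n. layer_sum n M u)"
    and nn_integral_layers: "(\<integral>\<^sup>+x. u x \<partial>M) = (SUP n. layer_sum n M u)"
proof -
  have [measurable]: "{x. q < u x} \<in> sets M" for q
    using u M by (auto simp: lower_semicontinuous_def)
  have eq: "Sup {q \<in> levels n. q < u x} = (\<Sum>q\<in>levels n. weight n q * indicator {x. q < u x} x)" for n x
    unfolding staircase_eq by (intro sum.cong) (auto split: split_indicator)
  have step: "layer_sum n M u = (\<integral>\<^sup>+x. Sup {q \<in> levels n. q < u x} \<partial>M)" for n
    unfolding eq layer_sum_def by (simp add: nn_integral_sum nn_integral_cmult)
  have inc: "incseq (\<lambda>n x. Sup {q \<in> levels n. q < u x})"
    using incseq_staircase by (auto simp: incseq_def le_fun_def)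
  then show "incseq (\<lambda>n. layer_sum n M u)"
    unfolding step by (auto simp: incseq_def le_fun_def intro!: nn_integral_mono)
  have "(\<lambda>x. Sup {q \<in> levels n. q < u x}) \<in> borel_measurable M" for n
    unfolding eq by measurable
  then have "(\<integral>\<^sup>+x. (SUP n. Sup {q \<in> levels n. q < u x}) \<partial>M) = (SUP n. layer_sum n M u)"
    unfolding step by (intro nn_integral_monotone_convergence_SUP inc)
  then show "(\<integral>\<^sup>+x. u x \<partial>M) = (SUP n. layer_sum n M u)" by (simp add: SUP_staircase)
qed

lemma SUP_sum_directed_ennreal:
  fixes f :: "'a \<Rightarrow> 'b \<Rightarrow> ennreal"
  assumes "I \<noteq> {}" "finite A"
    and dir: "\<And>i j. i \<in> I \<Longrightarrow> j \<in> I \<Longrightarrow> \<exists>k\<in>I. \<forall>n\<in>A. f n i \<le> f n k \<and> f n j \<le> f n k"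
  shows "(SUP i\<in>I. \<Sum>n\<in>A. f n i) = (\<Sum>n\<in>A. SUP i\<in>I. f n i)"
  using assms(2,3)
proof (induction A rule: finite_induct)
  case empty
  then show ?case using \<open>I \<noteq> {}\<close> by simp
next
  case (insert a A)
  have "(SUP i\<in>I. f a i + (\<Sum>n\<in>A. f n i)) = (SUP i\<in>I. f a i) + (SUP i\<in>I. \<Sum>n\<in>A. f n i)"
  proof (rule SUP_add_directed_ennreal)
    fix i j assume "i \<in> I" "j \<in> I"
    from insert.prems[OF this]
    show "\<exists>k\<in>I. f a i + (\<Sum>n\<in>A. f n j) \<le> f a k + (\<Sum>n\<in>A. f n k)"
      by (auto intro!: add_mono sum_mono)
  qed
  moreover have "(SUP i\<in>I. \<Sum>n\<in>A. f n i) = (\<Sum>n\<in>A. SUP i\<in>I. f n i)"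
    using insert.prems by (intro insert.IH) blast
  ultimately show ?case using insert(1,2) by simp
qed

section \<open>Radon measures\<close>

lemma radonD:
  assumes "radon M"
  shows "sets M = sets borel" "space M = UNIV"
    and "\<And>K. compact K \<Longrightarrow> emeasure M K < \<infinity>"
    and "\<And>B. B \<in> sets borel \<Longrightarrow> emeasure M B = (INF U\<in>{U. open U \<and> B \<subseteq> U}. emeasure M U)"
    and "\<And>U. open U \<Longrightarrow> emeasure M U = (SUP K\<in>{K. compact K \<and> K \<subseteq> U}. emeasure M K)"
  using assms sets_eq_imp_space_eq[of M borel] by (auto simp: radon_def)

lemma radon_outer_sequence:
  assumes "radon M" "B \<in> sets borel"
  obtains U where "\<And>n::nat. open (U n)" "\<And>n. B \<subseteq> U n" "(\<lambda>n. emeasure M (U n)) \<longlonglongrightarrow> emeasure M B"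
proof -
  have "(\<lambda>U. emeasure M U) ` {U. open U \<and> B \<subseteq> U} \<noteq> {}" by auto
  from ennreal_Inf_countable_INF[OF this] obtain r :: "nat \<Rightarrow> ennreal" where
    r: "decseq r" "range r \<subseteq> emeasure M ` {U. open U \<and> B \<subseteq> U}"
      "Inf (emeasure M ` {U. open U \<and> B \<subseteq> U}) = (INF n. r n)"
    by auto
  have "\<exists>U. open U \<and> B \<subseteq> U \<and> emeasure M U = r n" for n
    using subsetD[OF r(2) rangeI[of r n]] by (elim imageE) auto
  then obtain U where U: "open (U n)" "B \<subseteq> U n" "emeasure M (U n) = r n" for n by metis
  show ?thesis
    using LIMSEQ_INF[OF r(1)] by (intro that[of U]) (simp_all add: U radonD(4)[OF assms] r(3))
qed

lemma radon_inner_sequence: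
  assumes "radon M" "open U"
  obtains K where "\<And>n::nat. compact (K n)" "\<And>n. K n \<subseteq> U" "(\<lambda>n. emeasure M (K n)) \<longlonglongrightarrow> emeasure M U"
proof -
  have "(\<lambda>K. emeasure M K) ` {K. compact K \<and> K \<subseteq> U} \<noteq> {}" by auto
  from ennreal_Sup_countable_SUP[OF this] obtain r :: "nat \<Rightarrow> ennreal" where
    r: "incseq r" "range r \<subseteq> emeasure M ` {K. compact K \<and> K \<subseteq> U}"
      "Sup (emeasure M ` {K. compact K \<and> K \<subseteq> U}) = (SUP n. r n)"
    by auto
  have "\<exists>K. compact K \<and> K \<subseteq> U \<and> emeasure M K = r n" for n
    using subsetD[OF r(2) rangeI[of r n]] by (elim imageE) auto
  then obtain K where K: "compact (K n)" "K n \<subseteq> U" "emeasure M (K n) = r n" for n by metis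
  show ?thesis
    using LIMSEQ_SUP[OF r(1)] by (intro that[of K]) (simp_all add: K radonD(5)[OF assms] r(3))
qed

abbreviation outer_approx :: "'a::topological_space measure \<Rightarrow> 'a set \<Rightarrow> bool" where
  "outer_approx M B \<equiv> \<exists>U r. (\<forall>n::nat. open (U n) \<and> B \<subseteq> U n \<and> emeasure M (U n) \<le> r n) \<and>
     r \<longlonglongrightarrow> emeasure M B"

abbreviation inner_approx :: "'a::topological_space measure \<Rightarrow> 'a set \<Rightarrow> bool" where
  "inner_approx M U \<equiv> \<exists>K r. (\<forall>n::nat. compact (K n) \<and> K n \<subseteq> U \<and> r n \<le> emeasure M (K n)) \<and>
     r \<longlonglongrightarrow> emeasure M U"

text \<open>
  For sums and multiples of measures, approximating sequences provide the limit laws that infima and suprema over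
  families of sets lack.
\<close>

lemma radonI:
  fixes M :: "'a::t2_space measure"
  assumes sets: "sets M = sets borel"
    and fin: "\<And>K. compact K \<Longrightarrow> emeasure M K < \<infinity>"
    and outer: "\<And>B. B \<in> sets borel \<Longrightarrow> outer_approx M B"
    and inner: "\<And>U. open U \<Longrightarrow> inner_approx M U"
  shows "radon M"
  unfolding radon_def
proof (intro conjI allI impI ballI sets fin antisym)
  fix B :: "'a set" assume B: "B \<in> sets borel"
  show "emeasure M B \<le> (INF U\<in>{U. open U \<and> B \<subseteq> U}. emeasure M U)"
    using sets by (auto intro!: INF_greatest emeasure_mono)
  obtain U r where U: "\<And>n::nat. open (U n) \<and> B \<subseteq> U n \<and> emeasure M (U n) \<le> r n" "r \<longlonglongrightarrow> emeasure M B"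
    using outer[OF B] by blast
  show "(INF U\<in>{U. open U \<and> B \<subseteq> U}. emeasure M U) \<le> emeasure M B"
    using U by (intro LIMSEQ_le_const[OF U(2)] exI[of _ 0]) (auto intro: INF_lower2)
next
  fix U :: "'a set" assume U: "open U"
  show "(SUP K\<in>{K. compact K \<and> K \<subseteq> U}. emeasure M K) \<le> emeasure M U"
    using sets U by (auto intro!: SUP_least emeasure_mono)
  obtain K r where K: "\<And>n::nat. compact (K n) \<and> K n \<subseteq> U \<and> r n \<le> emeasure M (K n)" "r \<longlonglongrightarrow> emeasure M U"
    using inner[OF U] by blast
  show "emeasure M U \<le> (SUP K\<in>{K. compact K \<and> K \<subseteq> U}. emeasure M K)"
    using K by (intro LIMSEQ_le_const2[OF K(2)] exI[of _ 0]) (auto intro: SUP_upper2)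
qed

text \<open>A compact subset of the union of a directed family of open sets lies in a single member.\<close>

lemma radon_Un_directed:
  assumes M: "radon M" and "\<D> \<noteq> {}" and op: "\<And>U. U \<in> \<D> \<Longrightarrow> open U"
    and dir: "\<And>U V. U \<in> \<D> \<Longrightarrow> V \<in> \<D> \<Longrightarrow> \<exists>W\<in>\<D>. U \<subseteq> W \<and> V \<subseteq> W"
  shows "emeasure M (\<Union>\<D>) = (SUP U\<in>\<D>. emeasure M U)"
proof (rule antisym)
  show "(SUP U\<in>\<D>. emeasure M U) \<le> emeasure M (\<Union>\<D>)"
    using radonD(1)[OF M] op by (auto intro!: SUP_least emeasure_mono borel_open)
  have "emeasure M K \<le> (SUP U\<in>\<D>. emeasure M U)" if K: "compact K" "K \<subseteq> \<Union>\<D>" for K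
  proof -
    obtain \<F> where \<F>: "\<F> \<subseteq> \<D>" "finite \<F>" "K \<subseteq> \<Union>\<F>"
      using compactE[OF K] op by metis
    have "\<exists>W\<in>\<D>. \<Union>\<F> \<subseteq> W"
      using \<F>(2,1)
    proof (induction \<F> rule: finite_induct)
      case empty
      then show ?case using \<open>\<D> \<noteq> {}\<close> by auto
    next
      case (insert U \<F>)
      then obtain W where "W \<in> \<D>" "\<Union>\<F> \<subseteq> W" by auto
      moreover obtain W' where "W' \<in> \<D>" "U \<subseteq> W'" "W \<subseteq> W'"
        using dir[of U W] insert.prems \<open>W \<in> \<D>\<close> by auto
      ultimately show ?case by (intro bexI[of _ W']) auto
    qed
    then obtain W where "W \<in> \<D>" "\<Union>\<F> \<subseteq> W" by (elim bexE)
    then have W: "W \<in> \<D>" "K \<subseteq> W" using \<F>(3) by simp_all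
    then show ?thesis
      using radonD(1)[OF M] op[of W] by (intro SUP_upper2[of W] emeasure_mono) simp_all
  qed
  then show "emeasure M (\<Union>\<D>) \<le> (SUP U\<in>\<D>. emeasure M U)"
    using op by (subst radonD(5)[OF M]) (auto intro!: SUP_least)
qed

text \<open>
  Monotone convergence for directed families of lower semicontinuous functions: the family may be
  uncountable, and inner regularity on open sets replaces countability.
\<close>

lemma nn_integral_SUP_directed:
  fixes h :: "'i \<Rightarrow> 'a::t2_space \<Rightarrow> ennreal"
  assumes M: "radon M" and "D \<noteq> {}" and lsc: "\<And>d. d \<in> D \<Longrightarrow> lower_semicontinuous (h d)"
    and dir: "\<And>i j. i \<in> D \<Longrightarrow> j \<in> D \<Longrightarrow> \<exists>k\<in>D. \<forall>x. h i x \<le> h k x \<and> h j x \<le> h k x"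
  shows "(\<integral>\<^sup>+x. (SUP d\<in>D. h d x) \<partial>M) = (SUP d\<in>D. \<integral>\<^sup>+x. h d x \<partial>M)"
proof -
  define H where "H x = (SUP d\<in>D. h d x)" for x
  note sM = radonD(1)[OF M]
  have eqH: "{x. q < H x} = (\<Union>d\<in>D. {x. q < h d x})" for q
    by (auto simp: H_def less_SUP_iff)
  have op: "open {x. q < h d x}" if "d \<in> D" for q d using lsc[OF that] by (simp add: lower_semicontinuous_def)
  have "lower_semicontinuous H"
    using op by (auto simp: lower_semicontinuous_def eqH)
  have "layer_sum n M H \<le> (SUP d\<in>D. \<integral>\<^sup>+x. h d x \<partial>M)" for n
  proof -
    have "emeasure M {x. q < H x} = (SUP U\<in>(\<lambda>d. {x. q < h d x}) ` D. emeasure M U)" for q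
      unfolding eqH
    proof (intro radon_Un_directed[OF M])
      fix U V assume "U \<in> (\<lambda>d. {x. q < h d x}) ` D" "V \<in> (\<lambda>d. {x. q < h d x}) ` D"
      then obtain i j where ij: "i \<in> D" "j \<in> D" "U = {x. q < h i x}" "V = {x. q < h j x}" by auto
      from dir[OF ij(1,2)] obtain k where "k \<in> D" "\<forall>x. h i x \<le> h k x \<and> h j x \<le> h k x" by blast
      then show "\<exists>W\<in>(\<lambda>d. {x. q < h d x}) ` D. U \<subseteq> W \<and> V \<subseteq> W"
        unfolding ij by (intro bexI[of _ "{x. q < h k x}"]) (auto intro: order_less_le_trans)
    qed (use \<open>D \<noteq> {}\<close> op in auto)
    then have "layer_sum n M H = (\<Sum>q\<in>levels n. SUP d\<in>D. weight n q * emeasure M {x. q < h d x})"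
      by (simp add: layer_sum_def SUP_mult_left_ennreal image_image)
    also have "\<dots> = (SUP d\<in>D. layer_sum n M (h d))"
      unfolding layer_sum_def
    proof (rule SUP_sum_directed_ennreal[symmetric])
      fix i j assume ij: "i \<in> D" "j \<in> D"
      from dir[OF ij] obtain k where k: "k \<in> D" "\<forall>x. h i x \<le> h k x \<and> h j x \<le> h k x" by blast
      have "weight n q * emeasure M {x. q < h d x} \<le> weight n q * emeasure M {x. q < h k x}"
        if "d \<in> {i, j}" for q d
        using that k op[OF k(1)] sM
        by (intro mult_left_mono emeasure_mono) (auto intro: order_less_le_trans)
      with k show "\<exists>k\<in>D. \<forall>q\<in>levels n.
            weight n q * emeasure M {x. q < h i x} \<le> weight n q * emeasure M {x. q < h k x} \<and>
            weight n q * emeasure M {x. q < h j x} \<le> weight n q * emeasure M {x. q < h k x}"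
        by blast
    qed (use \<open>D \<noteq> {}\<close> finite_levels in auto)
    also have "\<dots> \<le> (SUP d\<in>D. \<integral>\<^sup>+x. h d x \<partial>M)"
      using nn_integral_layers[OF sM lsc] by (intro SUP_subset_mono) (auto intro: SUP_upper)
    finally show ?thesis .
  qed
  then have "(\<integral>\<^sup>+x. H x \<partial>M) \<le> (SUP d\<in>D. \<integral>\<^sup>+x. h d x \<partial>M)"
    unfolding nn_integral_layers[OF sM \<open>lower_semicontinuous H\<close>] by (intro SUP_least)
  moreover have "(SUP d\<in>D. \<integral>\<^sup>+x. h d x \<partial>M) \<le> (\<integral>\<^sup>+x. H x \<partial>M)"
    by (auto intro!: SUP_least nn_integral_mono SUP_upper simp: H_def)
  ultimately show ?thesis unfolding H_def by (rule antisym)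
qed

lemma lower_semicontinuous_section:
  assumes "lower_semicontinuous k"
  shows "lower_semicontinuous (\<lambda>y. k (x, y))"
  unfolding lower_semicontinuous_def
proof
  fix t
  have "open (Pair x -` {z. t < k z})"
    using assms by (intro open_vimage) (auto simp: lower_semicontinuous_def intro!: continuous_intros)
  then show "open {y. t < k (x, y)}" by (simp add: vimage_def)
qed

section \<open>Radon measures from set functions on open sets\<close>

abbreviation rel_compact_in :: "'a::topological_space set \<Rightarrow> 'a set set" where
  "rel_compact_in U \<equiv> {V. open V \<and> compact (closure V) \<and> closure V \<subseteq> U}"

text \<open>
  The extension is the outer measure \<open>B \<mapsto> inf {m U | B \<subseteq> U open}\<close>. An open set \<open>U\<close> splits
  every open \<open>W\<close> additively: if \<open>V\<close> is relatively compact with closure in \<open>W \<inter> U\<close>, then \<open>V\<close> and \<open>W - closure V\<close> are disjoint open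
  subsets of \<open>W\<close>, the latter containing \<open>W - U\<close>, and \<open>m V\<close> can be made as close to
  \<open>m (W \<inter> U)\<close> as desired.
\<close>

lemma radon_extension:
  fixes m :: "'a::t2_space set \<Rightarrow> ennreal"
  assumes lc: "locally_compact_type TYPE('a)"
    and empty: "m {} = 0"
    and mono: "\<And>U V. open U \<Longrightarrow> open V \<Longrightarrow> U \<subseteq> V \<Longrightarrow> m U \<le> m V"
    and subadd: "\<And>U :: nat \<Rightarrow> 'a set. (\<And>n. open (U n)) \<Longrightarrow> m (\<Union>n. U n) \<le> (\<Sum>n. m (U n))"
    and add: "\<And>U V. open U \<Longrightarrow> open V \<Longrightarrow> U \<inter> V = {} \<Longrightarrow> m U + m V \<le> m (U \<union> V)"
    and inner: "\<And>U. open U \<Longrightarrow>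
      m U \<le> (SUP V\<in>rel_compact_in U. m V)"
    and fin: "\<And>V. open V \<Longrightarrow> compact (closure V) \<Longrightarrow> m V < \<infinity>"
  obtains M where "radon M" "\<And>U. open U \<Longrightarrow> emeasure M U = m U"
proof -
  define ou where "ou B = (INF U\<in>{U. open U \<and> B \<subseteq> U}. m U)" for B
  have ou_open: "ou U = m U" if "open U" for U
    unfolding ou_def using that mono by (intro antisym INF_lower INF_greatest) auto
  have ou_mono: "ou B \<le> ou C" if "B \<subseteq> C" for B C
    unfolding ou_def using that by (intro INF_superset_mono) auto
  have ou_le: "ou B \<le> m U" if "open U" "B \<subseteq> U" for B U
    unfolding ou_def using that by (intro INF_lower) auto
  have ou_approx: "\<exists>U. open U \<and> B \<subseteq> U \<and> m U \<le> ou B + e" if "e > 0" for B e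
  proof (cases "ou B = \<infinity>")
    case False
    then have "ou B < ou B + e" using that using ennreal_add_left_cancel_less[of "ou B" 0 e] False by (simp add: less_top)
    then obtain U where "open U" "B \<subseteq> U" "m U < ou B + e"
      unfolding ou_def INF_less_iff by auto
    then show ?thesis by (meson less_imp_le)
  qed auto
  have oms: "outer_measure_space (Pow UNIV) ou"
    unfolding outer_measure_space_def
  proof (intro conjI)
    show "positive (Pow UNIV) ou"
      by (auto simp: positive_def ou_open empty)
    show "increasing (Pow UNIV) ou"
      by (auto simp: increasing_def ou_mono)
    show "countably_subadditive (Pow UNIV) ou"
      unfolding countably_subadditive_def
    proof (intro allI impI)
      fix B :: "nat \<Rightarrow> 'a set"
      show "ou (\<Union>n. B n) \<le> (\<Sum>n. ou (B n))"
      proof (rule ennreal_le_epsilon)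
        fix e :: real assume "e > 0"
        define d where "d n = ennreal (e * (1/2) ^ Suc n)" for n
        have "d n > 0" for n using \<open>e > 0\<close> by (simp add: d_def)
        then have "\<exists>U. open U \<and> B n \<subseteq> U \<and> m U \<le> ou (B n) + d n" for n
          by (rule ou_approx)
        then obtain U where U: "\<And>n. open (U n)" "\<And>n. B n \<subseteq> U n" "\<And>n. m (U n) \<le> ou (B n) + d n"
          by metis
        have "ou (\<Union>n. B n) \<le> m (\<Union>n. U n)" using U by (intro ou_le) auto
        also have "\<dots> \<le> (\<Sum>n. m (U n))" by (rule subadd[OF U(1)])
        also have "\<dots> \<le> (\<Sum>n. ou (B n) + d n)" by (intro suminf_le U(3)) auto
        also have "\<dots> = (\<Sum>n. ou (B n)) + (\<Sum>n. d n)" by (simp add: suminf_add)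
        also have "(\<Sum>n. d n) = ennreal e"
        proof -
          have "(\<lambda>n. e * (1/2) ^ Suc n) sums e"
            using sums_mult[OF power_half_series, of e] by simp
          then show ?thesis
            unfolding d_def using \<open>e > 0\<close> by (intro suminf_ennreal_eq) auto
        qed
        finally show "ou (\<Union>n. B n) \<le> (\<Sum>n. ou (B n)) + ennreal e" .
      qed
    qed
  qed
  interpret PU: sigma_algebra UNIV "Pow (UNIV :: 'a set)" by (rule sigma_algebra_Pow)
  define L where "L = lambda_system UNIV (Pow UNIV) ou"
  have ms: "measure_space UNIV L ou"
    unfolding L_def by (rule PU.caratheodory_lemma[OF oms])
  have open_L: "U \<in> L" if U: "open U" for U
    unfolding L_def PU.lambda_system_eq
  proof (intro CollectI conjI ballI)
    fix E :: "'a set"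
    have "ou E = ou ((E \<inter> U) \<union> (E - U))" by (simp add: Int_Diff_Un)
    also have "\<dots> \<le> ou (E \<inter> U) + ou (E - U)"
    proof -
      have "countably_subadditive (Pow UNIV) ou" "positive (Pow UNIV) ou"
        using oms by (auto simp: outer_measure_space_def)
      then have "subadditive (Pow UNIV) ou"
        by (rule PU.countably_subadditive_subadditive[rotated])
      moreover have "(E \<inter> U) \<inter> (E - U) = {}" by blast
      ultimately show ?thesis unfolding subadditive_def by blast
    qed
    finally have 1: "ou E \<le> ou (E \<inter> U) + ou (E - U)" .
    have 2: "ou (E \<inter> U) + ou (E - U) \<le> ou E"
      unfolding ou_def[of E]
    proof (rule INF_greatest, clarsimp)
      fix W assume W: "open W" "E \<subseteq> W"
      have "m V + ou (E - U) \<le> m W" if V: "open V" "compact (closure V)" "closure V \<subseteq> W \<inter> U" for V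
      proof -
        have op: "open (W - closure V)" using W by (auto intro: open_Diff)
        have "m V + ou (E - U) \<le> m V + m (W - closure V)"
          using W V by (intro add_mono ou_le op) auto
        also have "\<dots> \<le> m (V \<union> (W - closure V))"
          using closure_subset[of V] V by (intro add op) auto
        also have "\<dots> \<le> m W"
          using op V W closure_subset[of V] by (intro mono) auto
        finally show ?thesis .
      qed
      then have "(SUP V\<in>rel_compact_in (W \<inter> U). m V + ou (E - U)) \<le> m W"
        by (intro SUP_least) auto
      moreover have "rel_compact_in (W \<inter> U) \<noteq> {}"
        by (auto intro!: exI[of _ "{}"])
      ultimately have *: "(SUP V\<in>rel_compact_in (W \<inter> U). m V) + ou (E - U) \<le> m W"
        by (simp add: ennreal_SUP_add_left)
      have "ou (E \<inter> U) \<le> m (W \<inter> U)" using W U by (intro ou_le) auto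
      also have "\<dots> \<le> (SUP V\<in>rel_compact_in (W \<inter> U). m V)"
        using W U by (intro inner) auto
      finally show "ou (E \<inter> U) + ou (E - U) \<le> m W"
        using * by (meson add_right_mono order_trans)
    qed
    from 1 2 show "ou (E \<inter> U) + ou (E - U) = ou E" by (rule antisym[rotated])
  qed auto
  have "sigma_algebra UNIV L" using ms by (simp add: measure_space_def)
  then have borel_L: "sets borel \<subseteq> L"
    unfolding sets_borel using open_L by (intro sigma_algebra.sigma_sets_subset) auto
  have ms_b: "measure_space UNIV (sets borel) ou"
    using measure_down[OF ms _ borel_L] sets.sigma_algebra_axioms[of borel] by simp
  define M where "M = measure_of UNIV (sets borel) ou"
  have sM: "sets M = sets borel"
    unfolding M_def using sets.sigma_sets_eq[of borel] by (subst sets_measure_of) auto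
  have eM: "emeasure M B = ou B" if "B \<in> sets borel" for B
    using that ms_b unfolding M_def measure_space_def
    by (intro emeasure_measure_of_sigma) auto
  have mM: "emeasure M U = m U" if "open U" for U using that by (simp add: eM ou_open)
  have "radon M"
    unfolding radon_def
  proof (intro conjI allI impI ballI)
    show "sets M = sets borel" by (rule sM)
  next
    fix K :: "'a set" assume "compact K"
    obtain V where V: "open V" "K \<subseteq> V" "compact (closure V)"
      by (rule relatively_compact_nbhd_of_compact[OF lc \<open>compact K\<close> open_UNIV subset_UNIV])
    have "emeasure M K = ou K" using \<open>compact K\<close> by (intro eM) (simp add: compact_imp_closed)
    also have "\<dots> \<le> m V" using V by (intro ou_le)
    also have "\<dots> < \<infinity>" using V by (intro fin)
    finally show "emeasure M K < \<infinity>" .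
  next
    fix B :: "'a set" assume "B \<in> sets borel"
    then show "emeasure M B = (INF U\<in>{U. open U \<and> B \<subseteq> U}. emeasure M U)"
      by (subst eM) (auto simp: ou_def mM intro!: INF_cong)
  next
    fix U :: "'a set" assume U: "open U"
    show "emeasure M U = (SUP K\<in>{K. compact K \<and> K \<subseteq> U}. emeasure M K)"
    proof (rule antisym)
      show "(SUP K\<in>{K. compact K \<and> K \<subseteq> U}. emeasure M K) \<le> emeasure M U"
        using U sM by (auto intro!: SUP_least emeasure_mono)
      have "m U \<le> (SUP V\<in>rel_compact_in U. m V)"
        using U by (rule inner)
      also have "\<dots> \<le> (SUP K\<in>{K. compact K \<and> K \<subseteq> U}. emeasure M K)"
      proof (rule SUP_mono)
        fix V assume V: "V \<in> rel_compact_in U"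
        then have "m V \<le> emeasure M (closure V)"
          using closure_subset[of V] sM by (subst mM[symmetric]) (auto intro!: emeasure_mono)
        with V show "\<exists>K\<in>{K. compact K \<and> K \<subseteq> U}. m V \<le> emeasure M K" by blast
      qed
      finally show "emeasure M U \<le> (SUP K\<in>{K. compact K \<and> K \<subseteq> U}. emeasure M K)"
        using U by (simp add: mM)
    qed
  qed
  then show thesis using mM by (rule that)
qed

section \<open>Uniqueness of Radon measures\<close>

text \<open>
  Modularity \<open>M (R \<union> S) + M (R \<inter> S) = M R + M S\<close> propagates agreement to finite unions, because the
  intersection of \<open>R\<close> with a union of \<open>n\<close> members is again a union of \<open>n\<close> members.
\<close>

lemma emeasure_eq_finite_Union:
  assumes sets: "sets M = sets N" and "\<R> \<subseteq> sets M"
    and Int: "\<And>R S. R \<in> \<R> \<Longrightarrow> S \<in> \<R> \<Longrightarrow> R \<inter> S \<in> \<R>"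
    and eq: "\<And>R. R \<in> \<R> \<Longrightarrow> emeasure M R = emeasure N R"
    and fin: "\<And>R. R \<in> \<R> \<Longrightarrow> emeasure M R < \<infinity>"
    and "set Rs \<subseteq> \<R>"
  shows "emeasure M (\<Union>(set Rs)) = emeasure N (\<Union>(set Rs))"
  using \<open>set Rs \<subseteq> \<R>\<close>
proof (induction "length Rs" arbitrary: Rs)
  case 0
  then show ?case by simp
next
  case (Suc n)
  then obtain R Qs where Rs: "Rs = R # Qs" "n = length Qs" by (cases Rs) auto
  define U where "U = \<Union>(set Qs)"
  define V where "V = \<Union>(set (map ((\<inter>) R) Qs))"
  have V: "R \<inter> U = V" by (auto simp: U_def V_def)
  have "emeasure M U = emeasure N U"
    unfolding U_def using Suc(3) Rs by (intro Suc(1)) auto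
  moreover have "emeasure M V = emeasure N V"
    unfolding V_def using Suc(3) Rs Int by (intro Suc(1)) auto
  moreover have meas: "R \<in> sets M" "U \<in> sets M"
    using Suc(3) Rs assms(2) by (auto simp: U_def intro!: sets.finite_Union)
  have "emeasure M (R \<union> U) + emeasure M V = emeasure M R + emeasure M U"
    using meas V by (metis emeasure_Un_Int)
  moreover have "emeasure N (R \<union> U) + emeasure N V = emeasure N R + emeasure N U"
    using meas V sets by (metis emeasure_Un_Int)
  moreover have "emeasure M R = emeasure N R" "emeasure M R < \<infinity>"
    using Suc(3) Rs eq fin by auto
  moreover have "emeasure M V \<le> emeasure M R"
    using meas V by (intro emeasure_mono) auto
  ultimately have "emeasure N V + emeasure M (R \<union> U) = emeasure N V + emeasure N (R \<union> U)"
      "emeasure N V < \<infinity>"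
    by (auto simp: add.commute)
  then show ?case
    unfolding Rs(1) using U_def by (auto simp: ennreal_add_left_cancel)
qed

text \<open>
  Between a compact set and an open neighbourhood of it there is a finite union of members of a family of
  compact neighbourhoods; hence that family determines a Radon measure on open sets by inner
  regularity and then on all Borel sets by outer regularity.
\<close>

lemma radon_eqI:
  fixes M N :: "'a::t2_space measure"
  assumes M: "radon M" and N: "radon N"
    and comp: "\<And>R. R \<in> \<R> \<Longrightarrow> compact R"
    and Int: "\<And>R S. R \<in> \<R> \<Longrightarrow> S \<in> \<R> \<Longrightarrow> R \<inter> S \<in> \<R>"
    and nbhd: "\<And>W x. open W \<Longrightarrow> x \<in> W \<Longrightarrow> \<exists>U R. open U \<and> R \<in> \<R> \<and> x \<in> U \<and> U \<subseteq> R \<and> R \<subseteq> W"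
    and eq: "\<And>R. R \<in> \<R> \<Longrightarrow> emeasure M R = emeasure N R"
  shows "M = N"
proof -
  note sM = radonD(1)[OF M] and sN = radonD(1)[OF N]
  have between: "\<exists>Rs. set Rs \<subseteq> \<R> \<and> K \<subseteq> \<Union>(set Rs) \<and> \<Union>(set Rs) \<subseteq> W" if K: "compact K" "K \<subseteq> W" "open W" for K W
  proof -
    have "\<forall>x\<in>K. \<exists>U R. open U \<and> R \<in> \<R> \<and> x \<in> U \<and> U \<subseteq> R \<and> R \<subseteq> W" using nbhd K by blast
    then obtain U R where UR: "\<And>x. x \<in> K \<Longrightarrow> open (U x) \<and> R x \<in> \<R> \<and> x \<in> U x \<and> U x \<subseteq> R x \<and> R x \<subseteq> W"
      by metis
    obtain D where D: "D \<subseteq> K" "finite D" "K \<subseteq> (\<Union>x\<in>D. U x)"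
      using compactE_image[OF \<open>compact K\<close>, of K U] UR by blast
    from finite_list[OF \<open>finite D\<close>] obtain ds where ds: "set ds = D" by blast
    have UR': "R x \<in> \<R>" "U x \<subseteq> R x" "R x \<subseteq> W" if "x \<in> D" for x
      using UR[of x] that D(1) by auto
    have "(\<Union>x\<in>D. U x) \<subseteq> (\<Union>x\<in>D. R x)" using UR'(2) by (rule UN_mono[OF subset_refl])
    with D(3) have "K \<subseteq> \<Union>(set (map R ds))" by (simp add: ds)
    moreover have "\<Union>(set (map R ds)) \<subseteq> W" "set (map R ds) \<subseteq> \<R>"
      using UR'(1,3) by (simp_all add: ds UN_least image_subset_iff)
    ultimately show ?thesis by (intro exI[of _ "map R ds"] conjI)
  qed
  have open_eq: "emeasure M W = emeasure N W" if "open W" for W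
  proof -
    have *: "set Rs \<subseteq> \<R> \<Longrightarrow> emeasure M (\<Union>(set Rs)) = emeasure N (\<Union>(set Rs))" for Rs
      using comp radonD(3)[OF M] sM sN
      by (intro emeasure_eq_finite_Union[of M N \<R>] Int eq) (auto simp: compact_imp_closed)
    have le: "emeasure M1 W \<le> emeasure M2 W"
      if R1: "radon M1" and R2: "radon M2"
        and e: "\<And>Rs. set Rs \<subseteq> \<R> \<Longrightarrow> emeasure M1 (\<Union>(set Rs)) = emeasure M2 (\<Union>(set Rs))" for M1 M2
      unfolding radonD(5)[OF R1 \<open>open W\<close>]
    proof (rule SUP_least, clarsimp)
      fix K assume K: "compact K" "K \<subseteq> W"
      obtain Rs where Rs: "set Rs \<subseteq> \<R>" "K \<subseteq> \<Union>(set Rs)" "\<Union>(set Rs) \<subseteq> W"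
        using between[OF K \<open>open W\<close>] by (elim exE conjE)
      have meas: "\<Union>(set Rs) \<in> sets borel"
        using Rs(1) comp by (intro sets.finite_Union) (auto simp: compact_imp_closed)
      have "emeasure M1 K \<le> emeasure M1 (\<Union>(set Rs))"
        using Rs meas radonD(1)[OF R1] by (intro emeasure_mono) auto
      also have "\<dots> = emeasure M2 (\<Union>(set Rs))" by (rule e[OF Rs(1)])
      also have "\<dots> \<le> emeasure M2 W"
        using Rs(3) \<open>open W\<close> radonD(1)[OF R2] by (intro emeasure_mono) auto
      finally show "emeasure M1 K \<le> emeasure M2 W" .
    qed
    show ?thesis using le[OF M N *] le[OF N M *[symmetric]] by (rule antisym)
  qed
  show ?thesis
  proof (rule measure_eqI)
    show "sets M = sets N" using sM sN by simp
    fix B assume "B \<in> sets M"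
    then have "B \<in> sets borel" using sM by simp
    then show "emeasure M B = emeasure N B"
      unfolding radonD(4)[OF M \<open>B \<in> sets borel\<close>] radonD(4)[OF N \<open>B \<in> sets borel\<close>]
      using open_eq by (intro INF_cong) auto
  qed
qed

section \<open>The Radon product\<close>

text \<open>
  By inner regularity, a section of measure \<open>> t\<close> contains a compact set of measure \<open>> t\<close>, which by the
  tube lemma stays inside all nearby sections.
\<close>

lemma lower_semicontinuous_section_measure:
  fixes W :: "('a::topological_space \<times> 'b::t2_space) set"
  assumes \<nu>: "radon \<nu>" and W: "open W"
  shows "lower_semicontinuous (\<lambda>x. emeasure \<nu> (Pair x -` W))"
  unfolding lower_semicontinuous_def
proof (intro allI)
  fix t
  have op: "open (Pair x -` W)" for x
    using W by (intro continuous_open_vimage) (auto intro!: continuous_intros)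
  have "\<exists>U. open U \<and> x \<in> U \<and> U \<subseteq> {x. t < emeasure \<nu> (Pair x -` W)}"
    if t: "t < emeasure \<nu> (Pair x -` W)" for x
  proof -
    obtain L where L: "compact L" "L \<subseteq> Pair x -` W" "t < emeasure \<nu> L"
      using t radonD(5)[OF \<nu> op[of x]] by (auto simp: less_SUP_iff)
    have "{x} \<times> L \<subseteq> W" using L(2) by auto
    then obtain U where U: "x \<in> U" "open U" "U \<times> L \<subseteq> W"
      using Elementary_Topology.tube_lemma[OF L(1) W, of x] by metis
    have "t < emeasure \<nu> (Pair y -` W)" if "y \<in> U" for y
    proof -
      have "L \<subseteq> Pair y -` W" using U(3) that by auto
      then have "emeasure \<nu> L \<le> emeasure \<nu> (Pair y -` W)"
        using op[of y] radonD(1)[OF \<nu>] by (intro emeasure_mono) auto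
      with L(3) show ?thesis by (rule order_less_le_trans)
    qed
    with U show ?thesis by (intro exI[of _ U]) auto
  qed
  then show "open {x. t < emeasure \<nu> (Pair x -` W)}"
    by (subst open_subopen) blast
qed

text \<open>
  The measure of an open \<open>W\<close> must be the integral of the measures of its sections. Inner
  regularity of this set function on the product combines \<open>\<tau>\<close>-additivity of \<open>\<nu>\<close> on the sections with directed
  monotone convergence for \<open>\<mu>\<close>.
\<close>

lemma radon_product_exists:
  fixes \<mu> :: "'a::t2_space measure" and \<nu> :: "'b::t2_space measure"
  assumes lca: "locally_compact_type TYPE('a)" and lcb: "locally_compact_type TYPE('b)"
    and \<mu>: "radon \<mu>" and \<nu>: "radon \<nu>"
  obtains \<pi> where "radon \<pi>"
    and "\<And>W. open W \<Longrightarrow> emeasure \<pi> W = (\<integral>\<^sup>+x. emeasure \<nu> (Pair x -` W) \<partial>\<mu>)"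
    and "\<And>K L. compact K \<Longrightarrow> compact L \<Longrightarrow> emeasure \<pi> (K \<times> L) = emeasure \<mu> K * emeasure \<nu> L"
proof -
  note lc = locally_compact_type_prod[OF lca lcb]
  define m where "m W = (\<integral>\<^sup>+x. emeasure \<nu> (Pair x -` W) \<partial>\<mu>)" for W
  note s\<mu> = radonD(1)[OF \<mu>] and s\<nu> = radonD(1)[OF \<nu>]
  have op: "open (Pair x -` W)" if "open W" for W :: "('a \<times> 'b) set" and x
    using that by (intro continuous_open_vimage) (auto intro!: continuous_intros)
  have meas: "(\<lambda>x. emeasure \<nu> (Pair x -` W)) \<in> borel_measurable \<mu>" if "open W" for W
    using lower_semicontinuous_borel[OF lower_semicontinuous_section_measure[OF \<nu> that]]
    by (simp cong: measurable_cong_sets add: s\<mu>)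
  have box: "m V \<le> emeasure \<mu> K * emeasure \<nu> L" if "V \<subseteq> K \<times> L" "compact K" "compact L" for V K L
  proof -
    have "m V \<le> (\<integral>\<^sup>+x. emeasure \<nu> L * indicator K x \<partial>\<mu>)"
      unfolding m_def
    proof (intro nn_integral_mono)
      fix x
      show "emeasure \<nu> (Pair x -` V) \<le> emeasure \<nu> L * indicator K x"
      proof (cases "x \<in> K")
        case True
        have "Pair x -` V \<subseteq> L" using that by auto
        with True that(3) s\<nu> show ?thesis
          by (auto intro!: emeasure_mono simp: compact_imp_closed)
      next
        case False
        then have "Pair x -` V = {}" using that by auto
        with False show ?thesis by simp
      qed
    qed
    also have "\<dots> = emeasure \<mu> K * emeasure \<nu> L"
      using that s\<mu> by (subst nn_integral_cmult_indicator) (auto simp: mult.commute compact_imp_closed)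
    finally show ?thesis .
  qed
  obtain \<pi> where \<pi>: "radon \<pi>" "\<And>W. open W \<Longrightarrow> emeasure \<pi> W = m W"
  proof (rule radon_extension[OF lc, of m])
    show "m {} = 0" by (simp add: m_def)
    show "m U \<le> m V" if "open U" "open V" "U \<subseteq> V" for U V
      unfolding m_def using that op[OF that(2)] s\<nu>
      by (intro nn_integral_mono emeasure_mono) auto
    show "m (\<Union>n. U n) \<le> (\<Sum>n. m (U n))" if U: "\<And>n. open (U n)" for U :: "nat \<Rightarrow> _"
    proof -
      have "m (\<Union>n. U n) \<le> (\<integral>\<^sup>+x. (\<Sum>n. emeasure \<nu> (Pair x -` U n)) \<partial>\<mu>)"
        unfolding m_def vimage_UN using op[OF U] s\<nu>
        by (intro nn_integral_mono emeasure_subadditive_countably) auto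
      also have "\<dots> = (\<Sum>n. m (U n))"
        unfolding m_def using meas[OF U] by (intro nn_integral_suminf) auto
      finally show ?thesis .
    qed
    show "m U + m V \<le> m (U \<union> V)" if "open U" "open V" "U \<inter> V = {}" for U V
    proof -
      have "m U + m V = (\<integral>\<^sup>+x. emeasure \<nu> (Pair x -` U) + emeasure \<nu> (Pair x -` V) \<partial>\<mu>)"
        unfolding m_def using meas that by (intro nn_integral_add[symmetric]) auto
      also have "\<dots> = m (U \<union> V)"
        unfolding m_def vimage_Un using that op s\<nu>
        by (intro nn_integral_cong plus_emeasure) auto
      finally show ?thesis by simp
    qed
    show "m V < \<infinity>" if "open V" "compact (closure V)" for V
    proof -
      have "compact (fst ` closure V)" "compact (snd ` closure V)"
        using that by (auto intro!: compact_continuous_image continuous_intros)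
      moreover have "V \<subseteq> fst ` closure V \<times> snd ` closure V"
        using closure_subset[of V] by force
      ultimately have "m V \<le> emeasure \<mu> (fst ` closure V) * emeasure \<nu> (snd ` closure V)"
        by (intro box)
      also have "\<dots> < \<infinity>"
        using radonD(3)[OF \<mu> \<open>compact (fst ` _)\<close>] radonD(3)[OF \<nu> \<open>compact (snd ` _)\<close>]
        by (simp add: ennreal_mult_less_top)
      finally show ?thesis .
    qed
    fix W :: "('a \<times> 'b) set" assume W: "open W"
    define D where "D = rel_compact_in W"
    have dir: "V1 \<union> V2 \<in> D" if "V1 \<in> D" "V2 \<in> D" for V1 V2
      using that by (auto simp: D_def intro: compact_Un)
    have "{} \<in> D" by (auto simp: D_def)
    have eq: "emeasure \<nu> (Pair x -` W) = (SUP V\<in>D. emeasure \<nu> (Pair x -` V))" for x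
    proof -
      have "Pair x -` W = \<Union>((\<lambda>V. Pair x -` V) ` D)"
      proof (intro equalityI subsetI)
        fix y assume "y \<in> Pair x -` W"
        then have "(x, y) \<in> W" by simp
        then obtain V where "open V" "(x, y) \<in> V" "compact (closure V)" "closure V \<subseteq> W"
          by (rule relatively_compact_nbhd[OF lc W])
        then show "y \<in> \<Union>((\<lambda>V. Pair x -` V) ` D)" by (auto simp: D_def)
      next
        fix y assume "y \<in> \<Union>((\<lambda>V. Pair x -` V) ` D)"
        then show "y \<in> Pair x -` W" using closure_subset by (fastforce simp: D_def)
      qed
      also have "emeasure \<nu> \<dots> = (SUP U\<in>(\<lambda>V. Pair x -` V) ` D. emeasure \<nu> U)"
      proof (intro radon_Un_directed[OF \<nu>])
        fix U V assume "U \<in> (\<lambda>V. Pair x -` V) ` D" "V \<in> (\<lambda>V. Pair x -` V) ` D"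
        then obtain U' V' where UV: "U' \<in> D" "V' \<in> D" "U = Pair x -` U'" "V = Pair x -` V'"
          by (elim imageE)
        show "\<exists>W\<in>(\<lambda>V. Pair x -` V) ` D. U \<subseteq> W \<and> V \<subseteq> W"
          unfolding UV(3,4)
          by (intro bexI[of _ "Pair x -` (U' \<union> V')"] imageI dir[OF UV(1,2)] conjI vimage_mono) auto
      qed (use \<open>{} \<in> D\<close> in blast, use op in \<open>auto simp: D_def\<close>)
      finally show ?thesis by (simp add: image_image)
    qed
    have "m W = (SUP V\<in>D. m V)"
      unfolding m_def eq
    proof (rule nn_integral_SUP_directed[OF \<mu>])
      fix V1 V2 assume V: "V1 \<in> D" "V2 \<in> D"
      have "open (V1 \<union> V2)" using V by (auto simp: D_def)
      from op[OF this] show "\<exists>V\<in>D. \<forall>x. emeasure \<nu> (Pair x -` V1) \<le> emeasure \<nu> (Pair x -` V) \<and>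
          emeasure \<nu> (Pair x -` V2) \<le> emeasure \<nu> (Pair x -` V)"
        using dir[OF V] s\<nu> by (intro bexI[of _ "V1 \<union> V2"] allI conjI emeasure_mono) auto
    qed (use \<open>{} \<in> D\<close> in blast, use lower_semicontinuous_section_measure[OF \<nu>] in \<open>auto simp: D_def\<close>)
    then show "m W \<le> (SUP V\<in>rel_compact_in W. m V)"
      unfolding D_def by simp
  qed blast
  show thesis
  proof (rule that[OF \<pi>(1)])
    show "emeasure \<pi> W = (\<integral>\<^sup>+x. emeasure \<nu> (Pair x -` W) \<partial>\<mu>)" if "open W" for W
      using \<pi>(2)[OF that] by (simp add: m_def)
    fix K :: "'a set" and L :: "'b set" assume KL: "compact K" "compact L"
    have bor: "K \<in> sets borel" "L \<in> sets borel" "K \<times> L \<in> sets borel"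
      using KL by (auto simp: compact_imp_closed closed_Times)
    obtain U where U: "\<And>n::nat. open (U n)" "\<And>n. K \<subseteq> U n" "(\<lambda>n. emeasure \<mu> (U n)) \<longlonglongrightarrow> emeasure \<mu> K"
      using radon_outer_sequence[OF \<mu> bor(1)] by metis
    obtain V where V: "\<And>n::nat. open (V n)" "\<And>n. L \<subseteq> V n" "(\<lambda>n. emeasure \<nu> (V n)) \<longlonglongrightarrow> emeasure \<nu> L"
      using radon_outer_sequence[OF \<nu> bor(2)] by metis
    have le: "emeasure \<pi> (K \<times> L) \<le> emeasure \<mu> (U i) * emeasure \<nu> (V j)" for i j
    proof -
      have "emeasure \<pi> (K \<times> L) \<le> emeasure \<pi> (U i \<times> V j)"
        using U(1,2)[of i] V(1,2)[of j] radonD(1)[OF \<pi>(1)]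
        by (intro emeasure_mono Sigma_mono) (simp_all add: borel_open open_Times)
      also have "\<dots> = m (U i \<times> V j)"
        using U(1) V(1) by (intro \<pi>(2) open_Times)
      also have "\<dots> = (\<integral>\<^sup>+x. emeasure \<nu> (V j) * indicator (U i) x \<partial>\<mu>)"
        unfolding m_def by (intro nn_integral_cong) (auto split: split_indicator intro!: arg_cong[where f="emeasure \<nu>"])
      also have "\<dots> = emeasure \<mu> (U i) * emeasure \<nu> (V j)"
        using U(1) s\<mu> by (subst nn_integral_cmult_indicator) (auto simp: mult.commute)
      finally show ?thesis .
    qed
    have "eventually (\<lambda>i. emeasure \<mu> (U i) < \<infinity>) sequentially"
      using order_tendstoD(2)[OF U(3)] radonD(3)[OF \<mu> KL(1)] by simp
    then have "eventually (\<lambda>i. emeasure \<pi> (K \<times> L) \<le> emeasure \<nu> L * emeasure \<mu> (U i)) sequentially"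
    proof eventually_elim
      case (elim i)
      have "(\<lambda>j. emeasure \<mu> (U i) * emeasure \<nu> (V j)) \<longlonglongrightarrow> emeasure \<mu> (U i) * emeasure \<nu> L"
        using elim V(3) by (intro ennreal_tendsto_cmult) auto
      then have "emeasure \<pi> (K \<times> L) \<le> emeasure \<mu> (U i) * emeasure \<nu> L"
        using le by (intro LIMSEQ_le_const) auto
      then show ?case by (simp add: mult.commute)
    qed
    moreover have "(\<lambda>i. emeasure \<nu> L * emeasure \<mu> (U i)) \<longlonglongrightarrow> emeasure \<nu> L * emeasure \<mu> K"
      using radonD(3)[OF \<nu> KL(2)] U(3) by (intro ennreal_tendsto_cmult) auto
    ultimately have "emeasure \<pi> (K \<times> L) \<le> emeasure \<nu> L * emeasure \<mu> K"
      by (intro tendsto_lowerbound) auto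
    moreover have "emeasure \<mu> K * emeasure \<nu> L \<le> emeasure \<pi> (K \<times> L)"
      unfolding radonD(4)[OF \<pi>(1) bor(3)]
    proof (rule INF_greatest, clarify)
      fix W assume W: "open W" "K \<times> L \<subseteq> W"
      have "emeasure \<mu> K * emeasure \<nu> L = (\<integral>\<^sup>+x. emeasure \<nu> L * indicator K x \<partial>\<mu>)"
        using bor s\<mu> by (subst nn_integral_cmult_indicator) (auto simp: mult.commute)
      also have "\<dots> \<le> m W"
        unfolding m_def
      proof (intro nn_integral_mono)
        fix x
        show "emeasure \<nu> L * indicator K x \<le> emeasure \<nu> (Pair x -` W)"
          using W op[OF W(1)] s\<nu> by (auto split: split_indicator intro!: emeasure_mono)
      qed
      finally show "emeasure \<mu> K * emeasure \<nu> L \<le> emeasure \<pi> W" using W \<pi>(2) by simp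
    qed
    ultimately show "emeasure \<pi> (K \<times> L) = emeasure \<mu> K * emeasure \<nu> L"
      by (simp add: mult.commute)
  qed
qed

lemma radon_eqI_rectangles:
  fixes \<pi> \<rho> :: "('a::t2_space \<times> 'b::t2_space) measure"
  assumes lca: "locally_compact_type TYPE('a)" and lcb: "locally_compact_type TYPE('b)"
    and "radon \<pi>" "radon \<rho>"
    and "\<And>K L. compact K \<Longrightarrow> compact L \<Longrightarrow> emeasure \<pi> (K \<times> L) = emeasure \<rho> (K \<times> L)"
  shows "\<pi> = \<rho>"
proof (rule radon_eqI[where \<R> = "{K \<times> L | K L. compact K \<and> compact L}", OF assms(3,4)])
  fix W :: "('a \<times> 'b) set" and z assume "open W" "z \<in> W"
  then obtain A B where AB: "open A" "open B" "z \<in> A \<times> B" "A \<times> B \<subseteq> W"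
    by (rule open_prod_elim)
  obtain U where U: "open U" "fst z \<in> U" "compact (closure U)" "closure U \<subseteq> A"
    by (rule relatively_compact_nbhd[OF lca AB(1), of "fst z"]) (use AB(3) in auto)
  obtain V where V: "open V" "snd z \<in> V" "compact (closure V)" "closure V \<subseteq> B"
    by (rule relatively_compact_nbhd[OF lcb AB(2), of "snd z"]) (use AB(3) in auto)
  have "U \<times> V \<subseteq> closure U \<times> closure V"
    using closure_subset[of U] closure_subset[of V] by auto
  moreover have "closure U \<times> closure V \<subseteq> A \<times> B" using U(4) V(4) by auto
  then have "closure U \<times> closure V \<subseteq> W" using AB(4) by (rule order_trans)
  moreover have "open (U \<times> V)" "z \<in> U \<times> V" using U V by (auto intro: open_Times simp: mem_Times_iff)
  moreover have "closure U \<times> closure V \<in> {K \<times> L | K L. compact K \<and> compact L}" using U V by blast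
  ultimately show "\<exists>U R. open U \<and> R \<in> {K \<times> L | K L. compact K \<and> compact L} \<and> z \<in> U \<and> U \<subseteq> R \<and> R \<subseteq> W"
    by (intro exI[of _ "U \<times> V"] exI[of _ "closure U \<times> closure V"] conjI)
next
  fix R S :: "('a \<times> 'b) set"
  assume "R \<in> {K \<times> L | K L. compact K \<and> compact L}" "S \<in> {K \<times> L | K L. compact K \<and> compact L}"
  then obtain K L K' L' where "R = K \<times> L" "S = K' \<times> L'" "compact K" "compact L" "compact K'" "compact L'"
    by auto
  then show "R \<inter> S \<in> {K \<times> L | K L. compact K \<and> compact L}"
    by (auto simp: Times_Int_Times intro!: compact_Int)
qed (use assms(5) in \<open>auto intro: compact_Times\<close>)

lemma
  fixes \<mu> :: "'a::t2_space measure" and \<nu> :: "'b::t2_space measure"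
  assumes lca: "locally_compact_type TYPE('a)" and lcb: "locally_compact_type TYPE('b)"
    and \<mu>: "radon \<mu>" and \<nu>: "radon \<nu>"
  shows radon_radon_prod: "radon (radon_prod \<mu> \<nu>)"
    and emeasure_radon_prod_rectangle: "\<And>K L. compact K \<Longrightarrow> compact L \<Longrightarrow>
      emeasure (radon_prod \<mu> \<nu>) (K \<times> L) = emeasure \<mu> K * emeasure \<nu> L"
    and emeasure_radon_prod_open: "\<And>W. open W \<Longrightarrow>
      emeasure (radon_prod \<mu> \<nu>) W = (\<integral>\<^sup>+x. emeasure \<nu> (Pair x -` W) \<partial>\<mu>)"
proof -
  obtain \<pi> where \<pi>: "radon \<pi>"
    "\<And>W. open W \<Longrightarrow> emeasure \<pi> W = (\<integral>\<^sup>+x. emeasure \<nu> (Pair x -` W) \<partial>\<mu>)"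
    "\<And>K L. compact K \<Longrightarrow> compact L \<Longrightarrow> emeasure \<pi> (K \<times> L) = emeasure \<mu> K * emeasure \<nu> L"
    using radon_product_exists[OF assms] by metis
  have "radon_prod \<mu> \<nu> = \<pi>"
    unfolding radon_prod_def
  proof (rule the_equality)
    fix \<rho> assume "radon \<rho> \<and> (\<forall>K L. compact K \<longrightarrow> compact L \<longrightarrow> emeasure \<rho> (K \<times> L) = emeasure \<mu> K * emeasure \<nu> L)"
    then show "\<rho> = \<pi>" using \<pi> by (intro radon_eqI_rectangles[OF lca lcb]) auto
  qed (use \<pi> in auto)
  with \<pi> show "radon (radon_prod \<mu> \<nu>)"
    "\<And>K L. compact K \<Longrightarrow> compact L \<Longrightarrow> emeasure (radon_prod \<mu> \<nu>) (K \<times> L) = emeasure \<mu> K * emeasure \<nu> L"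
    "\<And>W. open W \<Longrightarrow> emeasure (radon_prod \<mu> \<nu>) W = (\<integral>\<^sup>+x. emeasure \<nu> (Pair x -` W) \<partial>\<mu>)"
    by simp_all
qed

lemma
  fixes \<mu> :: "'a::t2_space measure" and \<nu> :: "'b::t2_space measure" and k :: "'a \<times> 'b \<Rightarrow> ennreal"
  assumes lca: "locally_compact_type TYPE('a)" and lcb: "locally_compact_type TYPE('b)"
    and \<mu>: "radon \<mu>" and \<nu>: "radon \<nu>" and k: "lower_semicontinuous k"
  shows nn_integral_radon_prod: "(\<integral>\<^sup>+z. k z \<partial>radon_prod \<mu> \<nu>) = (\<integral>\<^sup>+x. (\<integral>\<^sup>+y. k (x, y) \<partial>\<nu>) \<partial>\<mu>)"
    and borel_measurable_section_integral: "(\<lambda>x. \<integral>\<^sup>+y. k (x, y) \<partial>\<nu>) \<in> borel_measurable borel"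
proof -
  let ?\<pi> = "radon_prod \<mu> \<nu>"
  note s\<mu> = radonD(1)[OF \<mu>] and s\<nu> = radonD(1)[OF \<nu>] and s\<pi> = radonD(1)[OF radon_radon_prod[OF lca lcb \<mu> \<nu>]]
  define m where "m q x = emeasure \<nu> {y. q < k (x, y)}" for q x
  have W: "open {z. q < k z}" for q using k by (simp add: lower_semicontinuous_def)
  have [measurable]: "m q \<in> borel_measurable borel" for q
    using lower_semicontinuous_borel[OF lower_semicontinuous_section_measure[OF \<nu> W]] by (simp add: m_def[abs_def] vimage_def)
  have layers: "layer_sum n \<nu> (\<lambda>y. k (x, y)) = (\<Sum>q\<in>levels n. weight n q * m q x)" for n x
    by (simp add: layer_sum_def m_def)
  have sec: "(\<integral>\<^sup>+y. k (x, y) \<partial>\<nu>) = (SUP n. \<Sum>q\<in>levels n. weight n q * m q x)" for x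
    unfolding layers[symmetric] by (rule nn_integral_layers[OF s\<nu> lower_semicontinuous_section[OF k]])
  show "(\<lambda>x. \<integral>\<^sup>+y. k (x, y) \<partial>\<nu>) \<in> borel_measurable borel"
    unfolding sec by measurable
  have mm: "m q \<in> borel_measurable \<mu>" for q
    using \<open>m q \<in> borel_measurable borel\<close> s\<mu> by (simp cong: measurable_cong_sets)
  have "layer_sum n ?\<pi> k = (\<integral>\<^sup>+x. (\<Sum>q\<in>levels n. weight n q * m q x) \<partial>\<mu>)" for n
    using mm by (simp add: layer_sum_def emeasure_radon_prod_open[OF lca lcb \<mu> \<nu> W] m_def[abs_def]
      vimage_def
      nn_integral_sum nn_integral_cmult)
  then have "(\<integral>\<^sup>+z. k z \<partial>?\<pi>) = (SUP n. \<integral>\<^sup>+x. (\<Sum>q\<in>levels n. weight n q * m q x) \<partial>\<mu>)"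
    by (simp add: nn_integral_layers[OF s\<pi> k])
  also have "\<dots> = (\<integral>\<^sup>+x. (SUP n. \<Sum>q\<in>levels n. weight n q * m q x) \<partial>\<mu>)"
  proof (rule nn_integral_monotone_convergence_SUP[symmetric])
    show "incseq (\<lambda>n x. \<Sum>q\<in>levels n. weight n q * m q x)"
      using incseq_layer_sum[OF s\<nu> lower_semicontinuous_section[OF k]]
      unfolding layers by (auto simp: incseq_def le_fun_def)
  qed (use mm in simp)
  finally show "(\<integral>\<^sup>+z. k z \<partial>?\<pi>) = (\<integral>\<^sup>+x. (\<integral>\<^sup>+y. k (x, y) \<partial>\<nu>) \<partial>\<mu>)"
    by (simp add: sec)
qed

lemma radon_distr_homeomorphism:
  fixes M :: "'a::t2_space measure" and h :: "'a \<Rightarrow> 'b::t2_space"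
  assumes M: "radon M" and h: "homeomorphism UNIV UNIV h h'"
  shows "radon (distr M borel h)"
proof -
  have hh: "continuous_on UNIV h" "continuous_on UNIV h'" "\<And>x. h' (h x) = x" "\<And>y. h (h' y) = y"
    using h by (auto simp: homeomorphism_def)
  have meas: "h \<in> measurable M borel"
    using borel_measurable_continuous_onI[OF hh(1)] by (simp cong: measurable_cong_sets add: radonD(1)[OF M])
  have em: "emeasure (distr M borel h) B = emeasure M (h -` B)" if "B \<in> sets borel" for B
    using meas that by (simp add: emeasure_distr radonD(2)[OF M])
  have vim: "h -` B = h' ` B" for B using hh(3,4) by (auto simp: image_iff intro: exI[of _ "h _"]) (metis hh(3))
  have vim': "h' -` B = h ` B" for B using hh(3,4) by (auto simp: image_iff) (metis hh(4))
  have cpt: "compact (h -` K)" if "compact K" for K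
    unfolding vim by (intro compact_continuous_image that continuous_on_subset[OF hh(2)]) auto
  show ?thesis
  proof (rule radonI)
    fix K :: "'b set" assume "compact K"
    then show "emeasure (distr M borel h) K < \<infinity>"
      using radonD(3)[OF M cpt] by (subst em) (auto simp: compact_imp_closed)
  next
    fix B :: "'b set" assume B: "B \<in> sets borel"
    have "h -` B \<in> sets borel" using measurable_sets[OF meas B] by (simp add: radonD(1,2)[OF M])
    from radon_outer_sequence[OF M this] obtain U where
      U: "\<And>n::nat. open (U n)" "\<And>n. h -` B \<subseteq> U n" "(\<lambda>n. emeasure M (U n)) \<longlonglongrightarrow> emeasure M (h -` B)"
      by metis
    have "open (h' -` U n)" for n using U(1) hh(2) by (rule open_vimage)
    moreover have "B \<subseteq> h' -` U n" for n using U(2)[of n] hh(4) by (auto simp: subset_iff)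
    moreover have "h -` (h' -` U n) = U n" for n using hh(3) by auto
    ultimately show "outer_approx (distr M borel h) B"
      using U(3) B by (intro exI[of _ "\<lambda>n. h' -` U n"] exI[of _ "\<lambda>n. emeasure M (U n)"]) (simp add: em)
  next
    fix U :: "'b set" assume U: "open U"
    have "open (h -` U)" using U hh(1) by (rule open_vimage)
    from radon_inner_sequence[OF M this] obtain K where
      K: "\<And>n::nat. compact (K n)" "\<And>n. K n \<subseteq> h -` U" "(\<lambda>n. emeasure M (K n)) \<longlonglongrightarrow> emeasure M (h -` U)"
      by metis
    have "compact (h' -` K n)" for n
      unfolding vim' by (intro compact_continuous_image K(1) continuous_on_subset[OF hh(1)]) auto
    moreover have "h' -` K n \<subseteq> U" for n using K(2)[of n] hh(4) unfolding subset_iff vimage_eq by metis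
    moreover have "h -` (h' -` K n) = K n" for n using hh(3) by auto
    ultimately show "inner_approx (distr M borel h) U"
      using K(3) U by (intro exI[of _ "\<lambda>n. h' -` K n"] exI[of _ "\<lambda>n. emeasure M (K n)"])
        (simp add: em compact_imp_closed)
  qed simp
qed

text \<open>
  The factors may fail to be \<open>\<sigma>\<close>-finite and \<open>k\<close> to be measurable for the product \<open>\<sigma>\<close>-algebra, so Tonelli's
  theorem does not apply. Instead, both orders of integration give the integral over the product: the image
  of \<open>\<mu> \<otimes> \<nu>\<close> under the exchange of coordinates is a Radon measure with the values of \<open>\<nu> \<otimes> \<mu>\<close> on compact
  rectangles.
\<close>

lemma nn_integral_radon_swap:
  fixes \<mu> :: "'a::t2_space measure" and \<nu> :: "'b::t2_space measure" and k :: "'a \<times> 'b \<Rightarrow> ennreal"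
  assumes lca: "locally_compact_type TYPE('a)" and lcb: "locally_compact_type TYPE('b)"
    and \<mu>: "radon \<mu>" and \<nu>: "radon \<nu>" and k: "lower_semicontinuous k"
  shows "(\<integral>\<^sup>+x. (\<integral>\<^sup>+y. k (x, y) \<partial>\<nu>) \<partial>\<mu>) = (\<integral>\<^sup>+y. (\<integral>\<^sup>+x. k (x, y) \<partial>\<mu>) \<partial>\<nu>)"
proof -
  let ?\<pi> = "radon_prod \<mu> \<nu>"
  note r\<pi> = radon_radon_prod[OF lca lcb \<mu> \<nu>]
  have hom: "homeomorphism UNIV UNIV (prod.swap :: 'a \<times> 'b \<Rightarrow> _) prod.swap"
    by (auto simp: homeomorphism_def continuous_on_swap)
  have meas: "(prod.swap :: 'a \<times> 'b \<Rightarrow> _) \<in> measurable ?\<pi> borel"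
    using borel_measurable_continuous_onI[OF continuous_on_swap] by (simp cong: measurable_cong_sets add: radonD(1)[OF r\<pi>])
  have rd: "radon (distr ?\<pi> borel prod.swap)" by (rule radon_distr_homeomorphism[OF r\<pi> hom])
  have "radon_prod \<nu> \<mu> = distr ?\<pi> borel prod.swap"
  proof (rule radon_eqI_rectangles[OF lcb lca radon_radon_prod[OF lcb lca \<nu> \<mu>] rd])
    fix K :: "'b set" and L :: "'a set" assume KL: "compact K" "compact L"
    have "K \<times> L \<in> sets borel" using KL by (simp add: borel_closed closed_Times compact_imp_closed)
    then have "emeasure (distr ?\<pi> borel prod.swap) (K \<times> L) = emeasure ?\<pi> (prod.swap -` (K \<times> L))"
      using meas by (simp add: emeasure_distr radonD(2)[OF r\<pi>])
    also have "prod.swap -` (K \<times> L) = L \<times> K" by auto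
    finally show "emeasure (radon_prod \<nu> \<mu>) (K \<times> L) = emeasure (distr ?\<pi> borel prod.swap) (K \<times> L)"
      using KL by (simp add: emeasure_radon_prod_rectangle lca lcb \<mu> \<nu> mult.commute)
  qed
  have k': "lower_semicontinuous (\<lambda>z. k (prod.swap z))"
    unfolding lower_semicontinuous_def
  proof
    fix t
    have "open (prod.swap -` {z. t < k z})"
      using k continuous_on_swap by (intro open_vimage) (auto simp: lower_semicontinuous_def)
    then show "open {z. t < k (prod.swap z)}" by (simp add: vimage_def)
  qed
  have [measurable]: "k \<in> borel_measurable borel" "(\<lambda>z. k (prod.swap z)) \<in> borel_measurable borel"
    using lower_semicontinuous_borel k k' by blast+
  have "(\<integral>\<^sup>+y. (\<integral>\<^sup>+x. k (x, y) \<partial>\<mu>) \<partial>\<nu>) = (\<integral>\<^sup>+z. k (prod.swap z) \<partial>radon_prod \<nu> \<mu>)"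
    by (simp add: nn_integral_radon_prod[OF lcb lca \<nu> \<mu> k'])
  also have "\<dots> = (\<integral>\<^sup>+z. k z \<partial>?\<pi>)"
    unfolding \<open>radon_prod \<nu> \<mu> = _\<close> using meas by (subst nn_integral_distr) auto
  finally show ?thesis by (simp add: nn_integral_radon_prod[OF lca lcb \<mu> \<nu> k])
qed

section \<open>Supports, restrictions and combinations of Radon measures\<close>

lemma closed_msupport: "closed (msupport M)"
proof -
  have "- msupport M = \<Union>{U. open U \<and> emeasure M U = 0}"
    by (auto simp: msupport_def)
  then have "open (- msupport M)" by (simp add: open_Union)
  then show ?thesis by (simp add: closed_def)
qed

lemma radon_null_outside_support:
  assumes M: "radon M"
  shows "emeasure M (- msupport M) = 0"
proof -
  let ?N = "{U. open U \<and> emeasure M U = 0}"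
  have eq: "- msupport M = \<Union>?N" by (auto simp: msupport_def)
  have "emeasure M (\<Union>?N) = (SUP U\<in>?N. emeasure M U)"
  proof (rule radon_Un_directed[OF M])
    show "?N \<noteq> {}" by (auto intro!: exI[of _ "{}"])
    fix U V assume UV: "U \<in> ?N" "V \<in> ?N"
    then have "emeasure M (U \<union> V) \<le> emeasure M U + emeasure M V"
      by (intro emeasure_subadditive) (auto simp: radonD(1)[OF M])
    with UV have "U \<union> V \<in> ?N" by auto
    then show "\<exists>W\<in>?N. U \<subseteq> W \<and> V \<subseteq> W" by (rule bexI[rotated]) simp
  qed auto
  also have "\<dots> \<le> 0" by (intro SUP_least) auto
  finally show ?thesis by (simp add: eq)
qed

lemma radon_on_closed_iff:
  assumes "closed A"
  shows "M \<in> radon_on A \<longleftrightarrow> radon M \<and> emeasure M (- A) = 0"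
proof safe
  assume "M \<in> radon_on A"
  then have M: "radon M" "msupport M \<subseteq> A" by (auto simp: radon_on_def)
  then show "radon M" by simp
  have "emeasure M (- A) \<le> emeasure M (- msupport M)"
    using M radonD(1)[OF M(1)] closed_msupport[of M] by (intro emeasure_mono) auto
  then show "emeasure M (- A) = 0" using radon_null_outside_support[OF M(1)] by simp
next
  assume M: "radon M" "emeasure M (- A) = 0"
  have "msupport M \<subseteq> A"
  proof
    fix x assume x: "x \<in> msupport M"
    show "x \<in> A"
    proof (rule ccontr)
      assume "x \<notin> A"
      moreover have "open (- A)" using assms by auto
      ultimately show False using x M(2) by (auto simp: msupport_def)
    qed
  qed
  with M(1) show "M \<in> radon_on A" by (simp add: radon_on_def)
qed

text \<open>
  The definition provides inner regularity on open sets only. Inside a compact set \<open>K\<close>, where the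
  measure is finite, complements in \<open>K\<close> of open sets that approximate \<open>K - B\<close> from outside approximate \<open>B\<close>
  from inside.
\<close>

lemma radon_inner_in_compact:
  fixes M :: "'a::t2_space measure"
  assumes M: "radon M" and K: "compact K" and B: "B \<in> sets borel" "B \<subseteq> K"
  obtains C r where "\<And>n::nat. compact (C n)" "\<And>n. C n \<subseteq> B" "\<And>n. r n \<le> emeasure M (C n)"
    "r \<longlonglongrightarrow> emeasure M B"
proof -
  note sM = radonD(1)[OF M]
  have Kb: "K \<in> sets borel" using K by (simp add: compact_imp_closed)
  then have "K - B \<in> sets borel" using B by auto
  from radon_outer_sequence[OF M this] obtain U where
    U: "\<And>n::nat. open (U n)" "\<And>n. K - B \<subseteq> U n" "(\<lambda>n. emeasure M (U n)) \<longlonglongrightarrow> emeasure M (K - B)"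
    by metis
  have fin: "emeasure M K < \<infinity>" using radonD(3)[OF M K] .
  have le: "emeasure M (K - B) \<le> emeasure M K" using Kb sM by (intro emeasure_mono) auto
  have eq: "emeasure M K = emeasure M B + emeasure M (K - B)"
    using Kb B sM by (subst plus_emeasure) (auto simp: Un_absorb1)
  show thesis
  proof (rule that)
    show "compact (K - U n)" for n using K U(1) by (rule compact_diff)
    show "K - U n \<subseteq> B" for n using U(2)[of n] by auto
    show "emeasure M K - emeasure M (U n) \<le> emeasure M (K - U n)" for n
    proof (rule ennreal_minus_le_iff[THEN iffD2], intro disjI2 conjI impI)
      have "emeasure M K \<le> emeasure M (U n \<union> (K - U n))"
        using Kb U(1) sM by (intro emeasure_mono) auto
      also have "\<dots> \<le> emeasure M (U n) + emeasure M (K - U n)"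
        using Kb U(1) sM by (intro emeasure_subadditive) auto
      finally show "emeasure M K \<le> emeasure M (U n) + emeasure M (K - U n)" .
    qed (use fin in auto)
    have "(\<lambda>n. emeasure M K - emeasure M (U n)) \<longlonglongrightarrow> emeasure M K - emeasure M (K - B)"
      using fin le U(3) by (intro tendsto_diff_ennreal tendsto_const) auto
    also have "emeasure M K - emeasure M (K - B) = emeasure M B"
      unfolding eq using fin le by (simp add: ennreal_add_diff_cancel_right top_unique less_top)
    finally show "(\<lambda>n. emeasure M K - emeasure M (U n)) \<longlonglongrightarrow> emeasure M B" .
  qed
qed

lemma radon_positive_compact_subset:
  fixes M :: "'a::t2_space measure"
  assumes "radon M" "compact K" "B \<in> sets borel" "B \<subseteq> K" "emeasure M B > 0"
  obtains C where "compact C" "C \<subseteq> B" "emeasure M C > 0"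
proof -
  obtain C r where C: "\<And>n::nat. compact (C n)" "\<And>n. C n \<subseteq> B" "\<And>n. r n \<le> emeasure M (C n)"
    "r \<longlonglongrightarrow> emeasure M B"
    using radon_inner_in_compact[OF assms(1-4)] by metis
  have "eventually (\<lambda>n. 0 < r n) sequentially"
    using order_tendstoD(1)[OF C(4) assms(5)] .
  then obtain n where "0 < r n" by (auto simp: eventually_sequentially)
  from this C(3)[of n] have "emeasure M (C n) > 0" by (rule order_less_le_trans)
  with C show thesis by (intro that)
qed

definition multiple_on :: "real \<Rightarrow> 'a set \<Rightarrow> 'a measure \<Rightarrow> 'a measure" where
  "multiple_on r C M = density M (\<lambda>x. ennreal r * indicator C x)"

lemma
  assumes "C \<in> sets M"
  shows sets_multiple_on: "sets (multiple_on r C M) = sets M"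
    and emeasure_multiple_on:
      "\<And>B. B \<in> sets M \<Longrightarrow> emeasure (multiple_on r C M) B = ennreal r * emeasure M (B \<inter> C)"
    and nn_integral_multiple_on: "\<And>h. h \<in> borel_measurable M \<Longrightarrow>
      (\<integral>\<^sup>+x. h x \<partial>multiple_on r C M) = ennreal r * (\<integral>\<^sup>+x. h x * indicator C x \<partial>M)"
proof -
  have [measurable]: "C \<in> sets M" by fact
  show "sets (multiple_on r C M) = sets M" by (simp add: multiple_on_def)
  show "(\<integral>\<^sup>+x. h x \<partial>multiple_on r C M) = ennreal r * (\<integral>\<^sup>+x. h x * indicator C x \<partial>M)"
    if [measurable]: "h \<in> borel_measurable M" for h
    unfolding multiple_on_def
    by (subst nn_integral_density, simp_all add: nn_integral_cmult[symmetric] mult.assoc mult.commute)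
      (simp add: mult.left_commute)
  show "emeasure (multiple_on r C M) B = ennreal r * emeasure M (B \<inter> C)"
    if [measurable]: "B \<in> sets M" for B
  proof -
    have "emeasure (multiple_on r C M) B = (\<integral>\<^sup>+x. ennreal r * indicator (B \<inter> C) x \<partial>M)"
      unfolding multiple_on_def
      by (subst emeasure_density) (auto intro!: nn_integral_cong split: split_indicator)
    then show ?thesis by (simp add: nn_integral_cmult)
  qed
qed

lemma
  fixes h :: "'a \<Rightarrow> real"
  assumes C: "C \<in> sets M" and r: "0 \<le> r" and h: "h \<in> borel_measurable M"
  shows integrable_multiple_on:
      "integrable M (\<lambda>x. indicator C x * h x) \<Longrightarrow> integrable (multiple_on r C M) h"
    and integral_multiple_on:
      "integral\<^sup>L (multiple_on r C M) h = r * (\<integral>x. indicator C x * h x \<partial>M)"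
proof -
  have d: "multiple_on r C M = density M (\<lambda>x. ennreal (r * indicator C x))"
    unfolding multiple_on_def by (auto simp: indicator_def intro!: arg_cong[where f = "density M"])
  have m: "(\<lambda>x. r * indicator C x) \<in> borel_measurable M" using C by measurable
  show "integrable (multiple_on r C M) h" if "integrable M (\<lambda>x. indicator C x * h x)"
    unfolding d using r that by (subst integrable_density[OF h m]) (simp_all add: mult.assoc)
  show "integral\<^sup>L (multiple_on r C M) h = r * (\<integral>x. indicator C x * h x \<partial>M)"
    unfolding d using r by (subst integral_density[OF h m]) (simp_all add: mult.assoc)
qed

lemma radon_multiple_on:
  fixes M :: "'a::t2_space measure"
  assumes M: "radon M" and C: "compact C"
  shows "radon (multiple_on r C M)"
proof -
  note sM = radonD(1)[OF M]
  have Cb: "C \<in> sets borel" "C \<in> sets M" "closed C" using C sM by (auto simp: compact_imp_closed)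
  have em: "emeasure (multiple_on r C M) B = ennreal r * emeasure M (B \<inter> C)" if "B \<in> sets borel" for B
    using that emeasure_multiple_on[OF Cb(2)] sM by simp
  have fin: "emeasure M C < \<infinity>" by (rule radonD(3)[OF M C])
  show ?thesis
  proof (rule radonI)
    show "sets (multiple_on r C M) = sets borel"
      using sets_multiple_on[OF Cb(2)] sM by simp
    fix K :: "'a set" assume "compact K"
    have "emeasure M (K \<inter> C) \<le> emeasure M C" using Cb by (intro emeasure_mono) auto
    then show "emeasure (multiple_on r C M) K < \<infinity>"
      using \<open>compact K\<close> fin by (subst em) (auto simp: compact_imp_closed ennreal_mult_less_top intro: order_le_less_trans)
  next
    fix B :: "'a set" assume B: "B \<in> sets borel"
    then have "B \<inter> C \<in> sets borel" using Cb by auto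
    from radon_outer_sequence[OF M this] obtain U where
      U: "\<And>n::nat. open (U n)" "\<And>n. B \<inter> C \<subseteq> U n" "(\<lambda>n. emeasure M (U n)) \<longlonglongrightarrow> emeasure M (B \<inter> C)"
      by metis
    have op: "open (U n \<union> - C)" for n using U(1) Cb(3) by (intro open_Un) auto
    have sub: "B \<subseteq> U n \<union> - C" for n using U(2)[of n] by auto
    have "emeasure (multiple_on r C M) (U n \<union> - C) \<le> ennreal r * emeasure M (U n)" for n
      unfolding em[OF borel_open[OF op]] using borel_open[OF U(1)[of n]]
      by (intro mult_left_mono emeasure_mono) (auto simp: sM)
    moreover have "(\<lambda>n. ennreal r * emeasure M (U n)) \<longlonglongrightarrow> emeasure (multiple_on r C M) B"
      unfolding em[OF B] by (intro ennreal_tendsto_cmult U(3)) simp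
    ultimately show "outer_approx (multiple_on r C M) B"
      using op sub by (intro exI[of _ "\<lambda>n. U n \<union> - C"] exI[of _ "\<lambda>n. ennreal r * emeasure M (U n)"] conjI allI) simp_all
  next
    fix U :: "'a set" assume U: "open U"
    have "U \<inter> C \<in> sets borel" "U \<inter> C \<subseteq> C" using U Cb by auto
    from radon_inner_in_compact[OF M C this] obtain K q where
      K: "\<And>n::nat. compact (K n)" "\<And>n. K n \<subseteq> U \<inter> C" "\<And>n. q n \<le> emeasure M (K n)" "q \<longlonglongrightarrow> emeasure M (U \<inter> C)"
      by metis
    have sub: "K n \<subseteq> U" for n using K(2)[of n] by auto
    have "K n \<inter> C = K n" for n using K(2)[of n] by auto
    then have "ennreal r * q n \<le> emeasure (multiple_on r C M) (K n)" for n
      using K(1,3)[of n] by (subst em) (auto intro!: mult_left_mono simp: compact_imp_closed)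
    moreover have "(\<lambda>n. ennreal r * q n) \<longlonglongrightarrow> emeasure (multiple_on r C M) U"
      using U by (subst em) (auto intro!: ennreal_tendsto_cmult K(4))
    ultimately show "inner_approx (multiple_on r C M) U"
      using K(1) sub by (intro exI[of _ K] exI[of _ "\<lambda>n. ennreal r * q n"] conjI allI) simp_all
  qed
qed

lemma radon_null_measure: "radon (null_measure borel :: 'a::t2_space measure)"
proof (rule radonI)
  show "outer_approx (null_measure borel) B" for B :: "'a set"
    by (intro exI[of _ "\<lambda>_. UNIV"] exI[of _ "\<lambda>_. 0"]) simp
  show "inner_approx (null_measure borel) U" for U :: "'a set"
    by (intro exI[of _ "\<lambda>_. {}"] exI[of _ "\<lambda>_. 0"]) simp
qed simp_all

definition combination :: "real \<Rightarrow> 'a::topological_space measure \<Rightarrow> real \<Rightarrow> 'a measure \<Rightarrow> 'a measure" where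
  "combination s M t N =
     measure_of UNIV (sets borel) (\<lambda>B. ennreal s * emeasure M B + ennreal t * emeasure N B)"

lemma sets_combination: "sets (combination s M t N) = sets borel"
  unfolding combination_def using sets.sigma_sets_eq[of borel] by (subst sets_measure_of) auto

lemma space_combination: "space (combination s M t N) = UNIV"
  using sets_eq_imp_space_eq[OF sets_combination] by simp

lemma emeasure_combination:
  assumes M: "sets M = sets borel" and N: "sets N = sets borel" and B: "B \<in> sets borel"
  shows "emeasure (combination s M t N) B = ennreal s * emeasure M B + ennreal t * emeasure N B"
  unfolding combination_def
proof (rule emeasure_measure_of_sigma[OF _ _ _ B])
  show "sigma_algebra UNIV (sets borel :: 'a set set)"
    using sets.sigma_algebra_axioms[of "borel :: 'a measure"] by simp
  show "positive (sets borel) (\<lambda>B. ennreal s * emeasure M B + ennreal t * emeasure N B)"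
    by (simp add: positive_def)
  show "countably_additive (sets borel) (\<lambda>B. ennreal s * emeasure M B + ennreal t * emeasure N B)"
  proof (rule countably_additiveI)
    fix B :: "nat \<Rightarrow> 'a set" assume B: "range B \<subseteq> sets borel" "disjoint_family B"
    then have "(\<Sum>n. emeasure M (B n)) = emeasure M (\<Union>n. B n)" "(\<Sum>n. emeasure N (B n)) = emeasure N (\<Union>n. B n)"
      using M N by (intro suminf_emeasure; simp)+
    then show "(\<Sum>n. ennreal s * emeasure M (B n) + ennreal t * emeasure N (B n))
        = ennreal s * emeasure M (\<Union>n. B n) + ennreal t * emeasure N (\<Union>n. B n)"
      by (subst suminf_add[symmetric]) (simp_all add: ennreal_suminf_cmult)
  qed
qed

lemma nn_integral_combination:
  assumes M: "sets M = sets borel" and N: "sets N = sets borel" and h: "h \<in> borel_measurable borel"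
  shows "(\<integral>\<^sup>+x. h x \<partial>combination s M t N) = ennreal s * (\<integral>\<^sup>+x. h x \<partial>M) + ennreal t * (\<integral>\<^sup>+x. h x \<partial>N)"
proof -
  have [measurable_cong]: "sets (combination s M t N) = sets borel" "sets M = sets borel" "sets N = sets borel"
    by (simp_all add: M N sets_combination)
  have sp: "space M = UNIV" "space N = UNIV"
    using sets_eq_imp_space_eq[OF M] sets_eq_imp_space_eq[OF N] by simp_all
  show ?thesis
    using h
  proof (induct h rule: borel_measurable_induct)
    case (cong f g)
    then show ?case by (simp add: space_combination sp cong: nn_integral_cong)
  next
    case (set B)
    then show ?case by (simp add: emeasure_combination M N)
  next
    case (mult u c)
    then show ?case by (simp add: nn_integral_cmult algebra_simps)
  next
    case (add u v)
    then show ?case by (simp add: nn_integral_add algebra_simps)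
  next
    case (seq U)
    note [measurable] = seq(1)
    have lim: "(\<integral>\<^sup>+x. (SUP i. U i x) \<partial>Q) = (SUP i. \<integral>\<^sup>+x. U i x \<partial>Q)" if "sets Q = sets borel" for Q
      using seq(4) that by (intro nn_integral_monotone_convergence_SUP) (auto cong: measurable_cong_sets)
    have inc: "incseq (\<lambda>i. ennreal c * (\<integral>\<^sup>+x. U i x \<partial>Q))" for c Q
      using seq(4) by (auto simp: incseq_def le_fun_def intro!: mult_left_mono nn_integral_mono)
    have "(SUP i. U i) = (\<lambda>x. SUP i. U i x)" by (simp add: fun_eq_iff image_image)
    then show ?case
      by (simp add: lim M N sets_combination seq(3) SUP_mult_left_ennreal ennreal_SUP_add[OF inc inc])
  qed
qed

lemma radon_combination:
  fixes M N :: "'a::t2_space measure"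
  assumes M: "radon M" and N: "radon N" and "0 < s" "0 < t"
  shows "radon (combination s M t N)"
proof -
  note sM = radonD(1)[OF M] and sN = radonD(1)[OF N]
  note em = emeasure_combination[OF sM sN]
  show ?thesis
  proof (rule radonI)
    show "sets (combination s M t N) = sets borel" by (rule sets_combination)
    show "emeasure (combination s M t N) K < \<infinity>" if "compact K" for K
      using radonD(3)[OF M that] radonD(3)[OF N that] that
      by (subst em) (auto simp: compact_imp_closed ennreal_mult_less_top)
  next
    fix B :: "'a set" assume B: "B \<in> sets borel"
    obtain U where U: "\<And>n::nat. open (U n)" "\<And>n. B \<subseteq> U n" "(\<lambda>n. emeasure M (U n)) \<longlonglongrightarrow> emeasure M B"
      using radon_outer_sequence[OF M B] by metis
    obtain V where V: "\<And>n::nat. open (V n)" "\<And>n. B \<subseteq> V n" "(\<lambda>n. emeasure N (V n)) \<longlonglongrightarrow> emeasure N B"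
      using radon_outer_sequence[OF N B] by metis
    let ?r = "\<lambda>n. ennreal s * emeasure M (U n) + ennreal t * emeasure N (V n)"
    have "emeasure (combination s M t N) (U n \<inter> V n) \<le> ?r n" for n
      using U(1)[of n] V(1)[of n] sM sN
      by (subst em) (auto intro!: add_mono mult_left_mono emeasure_mono)
    moreover have "?r \<longlonglongrightarrow> emeasure (combination s M t N) B"
      unfolding em[OF B] by (intro tendsto_add ennreal_tendsto_cmult U(3) V(3)) simp_all
    ultimately show "outer_approx (combination s M t N) B"
      using U(1,2) V(1,2) by (intro exI[of _ "\<lambda>n. U n \<inter> V n"] exI[of _ ?r] conjI allI) (simp_all add: open_Int)
  next
    fix W :: "'a set" assume W: "open W"
    obtain K where K: "\<And>n::nat. compact (K n)" "\<And>n. K n \<subseteq> W" "(\<lambda>n. emeasure M (K n)) \<longlonglongrightarrow> emeasure M W"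
      using radon_inner_sequence[OF M W] by metis
    obtain L where L: "\<And>n::nat. compact (L n)" "\<And>n. L n \<subseteq> W" "(\<lambda>n. emeasure N (L n)) \<longlonglongrightarrow> emeasure N W"
      using radon_inner_sequence[OF N W] by metis
    let ?r = "\<lambda>n. ennreal s * emeasure M (K n) + ennreal t * emeasure N (L n)"
    have bor: "K n \<in> sets borel" "L n \<in> sets borel" for n using K(1) L(1) by (simp_all add: compact_imp_closed)
    have "?r n \<le> emeasure (combination s M t N) (K n \<union> L n)" for n
      using bor sM sN by (subst em) (auto intro!: add_mono mult_left_mono emeasure_mono)
    moreover have "?r \<longlonglongrightarrow> emeasure (combination s M t N) W"
      using W by (subst em) (auto intro!: tendsto_add ennreal_tendsto_cmult K(3) L(3))
    moreover have "compact (K n \<union> L n)" "K n \<union> L n \<subseteq> W" for n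
      using K(1,2) L(1,2) by (auto intro: compact_Un)
    ultimately show "inner_approx (combination s M t N) W"
      by (intro exI[of _ "\<lambda>n. K n \<union> L n"] exI[of _ ?r] conjI allI) simp_all
  qed
qed

lemma AE_combination:
  assumes M: "sets M = sets borel" and N: "sets N = sets borel"
    and "AE x in M. P x" "AE x in N. P x"
  shows "AE x in combination s M t N. P x"
proof -
  have sp: "space M = UNIV" "space N = UNIV"
    using sets_eq_imp_space_eq[OF M] sets_eq_imp_space_eq[OF N] by simp_all
  obtain A where A: "{x. \<not> P x} \<subseteq> A" "A \<in> sets borel" "emeasure M A = 0"
    by (rule AE_E[OF assms(3)]) (use M sp in simp)
  obtain B where B: "{x. \<not> P x} \<subseteq> B" "B \<in> sets borel" "emeasure N B = 0"
    by (rule AE_E[OF assms(4)]) (use N sp in simp)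
  have "emeasure M (A \<inter> B) = 0" "emeasure N (A \<inter> B) = 0"
    using A(2,3) B(2,3) M N by (auto intro: emeasure_eq_0[of A] emeasure_eq_0[of B])
  then show ?thesis
    using A B M N by (intro AE_I[of _ _ "A \<inter> B"]) (auto simp: emeasure_combination sets_combination space_combination)
qed

lemma enn2real_linear:
  assumes "0 \<le> s" "0 \<le> t" "x < \<infinity>" "y < \<infinity>"
  shows "enn2real (ennreal s * x + ennreal t * y) = s * enn2real x + t * enn2real y"
  using assms
  by (cases x; cases y) (auto simp: ennreal_mult[symmetric] ennreal_plus[symmetric] simp del: ennreal_plus)

lemma
  fixes h :: "'a::topological_space \<Rightarrow> real"
  assumes M: "sets M = sets borel" and N: "sets N = sets borel" and "0 \<le> s" "0 \<le> t"
    and hM: "integrable M h" and hN: "integrable N h"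
  shows integrable_combination: "integrable (combination s M t N) h"
    and integral_combination: "integral\<^sup>L (combination s M t N) h = s * integral\<^sup>L M h + t * integral\<^sup>L N h"
proof -
  have h: "h \<in> borel_measurable borel" using hM M by (auto cong: measurable_cong_sets)
  have eq: "(\<integral>\<^sup>+x. ennreal (u x) \<partial>combination s M t N)
      = ennreal s * (\<integral>\<^sup>+x. ennreal (u x) \<partial>M) + ennreal t * (\<integral>\<^sup>+x. ennreal (u x) \<partial>N)"
    if "u \<in> borel_measurable borel" for u :: "'a \<Rightarrow> real"
    using that by (intro nn_integral_combination M N) simp
  have p: "(\<lambda>x. - h x) \<in> borel_measurable borel" using h by simp
  have finM: "(\<integral>\<^sup>+x. ennreal (h x) \<partial>M) < \<infinity>" "(\<integral>\<^sup>+x. ennreal (- h x) \<partial>M) < \<infinity>"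
    and finN: "(\<integral>\<^sup>+x. ennreal (h x) \<partial>N) < \<infinity>" "(\<integral>\<^sup>+x. ennreal (- h x) \<partial>N) < \<infinity>"
    using hM hN by (auto simp: real_integrable_def less_top)
  show int: "integrable (combination s M t N) h"
    using h finM finN unfolding real_integrable_def
    by (auto simp: eq[OF h] eq[OF p] sets_combination ennreal_mult_eq_top_iff cong: measurable_cong_sets)
  show "integral\<^sup>L (combination s M t N) h = s * integral\<^sup>L M h + t * integral\<^sup>L N h"
    unfolding real_lebesgue_integral_def[OF int] real_lebesgue_integral_def[OF hM] real_lebesgue_integral_def[OF hN]
      eq[OF h] eq[OF p] enn2real_linear[OF assms(3,4) finM(1) finN(1)]
      enn2real_linear[OF assms(3,4) finM(2) finN(2)]
    by (simp add: algebra_simps)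
qed

section \<open>Finite integrals of partially defined functions\<close>

abbreviation totalize :: "('a \<rightharpoonup> ereal) \<Rightarrow> 'a \<Rightarrow> ereal" where
  "totalize u \<equiv> \<lambda>x. case u x of None \<Rightarrow> 0 | Some r \<Rightarrow> r"

lemma pint_SomeI:
  assumes v: "totalize u \<in> borel_measurable M"
    and ae: "AE x in M. u x = Some (ereal (h x))" and int: "integrable M h"
  shows "pint M u = Some (ereal (integral\<^sup>L M h))"
proof -
  have pos: "(\<integral>\<^sup>+x. e2ennreal (totalize u x) \<partial>M) = (\<integral>\<^sup>+x. ennreal (h x) \<partial>M)"
    by (rule nn_integral_cong_AE, rule AE_mp[OF ae]) (auto simp: e2ennreal_ereal intro!: AE_I2)
  have neg: "(\<integral>\<^sup>+x. e2ennreal (- totalize u x) \<partial>M) = (\<integral>\<^sup>+x. ennreal (- h x) \<partial>M)"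
    by (rule nn_integral_cong_AE, rule AE_mp[OF ae]) (auto simp: e2ennreal_ereal intro!: AE_I2)
  have "AE x in M. u x \<noteq> None" using ae by eventually_elim simp
  moreover have "(\<integral>\<^sup>+x. ennreal (h x) \<partial>M) \<noteq> \<infinity>" "(\<integral>\<^sup>+x. ennreal (- h x) \<partial>M) \<noteq> \<infinity>"
    using int by (auto simp: real_integrable_def)
  ultimately show ?thesis
    unfolding pint_def Let_def pos neg real_lebesgue_integral_def[OF int] using v
    by (cases "\<integral>\<^sup>+x. ennreal (h x) \<partial>M"; cases "\<integral>\<^sup>+x. ennreal (- h x) \<partial>M") (auto simp: pdiff_def)
qed

text \<open>
  The integrand is given by a formula that does not mention the measure, so that the integrals of \<open>u\<close> with
  respect to different measures can be compared.
\<close>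

lemma pint_SomeD:
  fixes u :: "'a \<rightharpoonup> ereal"
  defines "h \<equiv> \<lambda>x. real_of_ereal (totalize u x)"
  assumes "pint M u = Some (ereal r)"
  shows "totalize u \<in> borel_measurable M" "AE x in M. u x = Some (ereal (h x))" "integrable M h"
    and "r = integral\<^sup>L M h"
proof -
  define P N where "P = (\<integral>\<^sup>+x. e2ennreal (totalize u x) \<partial>M)" and "N = (\<integral>\<^sup>+x. e2ennreal (- totalize u x) \<partial>M)"
  have def: "AE x in M. u x \<noteq> None" and v [measurable]: "totalize u \<in> borel_measurable M"
    and pd: "pdiff (enn2ereal P) (enn2ereal N) = Some (ereal r)"
    using assms(2) unfolding pint_def Let_def P_def N_def by (auto split: if_splits)
  have fin: "P \<noteq> \<infinity>" "N \<noteq> \<infinity>"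
    using pd by (cases P; cases N; simp add: pdiff_def)+
  have "AE x in M. e2ennreal (totalize u x) \<noteq> \<infinity>" "AE x in M. e2ennreal (- totalize u x) \<noteq> \<infinity>"
    using fin unfolding P_def N_def by (intro nn_integral_noteq_infinite; simp)+
  then have ae: "AE x in M. totalize u x = ereal (h x)"
  proof eventually_elim
    case (elim x)
    then show ?case by (cases "totalize u x") (simp_all add: h_def)
  qed
  have "AE x in M. e2ennreal (totalize u x) = ennreal (h x)" "AE x in M. e2ennreal (- totalize u x) = ennreal (- h x)"
    using ae by (eventually_elim, metis e2ennreal_ereal uminus_ereal.simps(1))+
  then have pos: "P = (\<integral>\<^sup>+x. ennreal (h x) \<partial>M)" and neg: "N = (\<integral>\<^sup>+x. ennreal (- h x) \<partial>M)"
    unfolding P_def N_def by (auto intro: nn_integral_cong_AE)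
  show "totalize u \<in> borel_measurable M" by (rule v)
  show "AE x in M. u x = Some (ereal (h x))"
    using ae def by eventually_elim (auto split: option.splits)
  have "h \<in> borel_measurable M" unfolding h_def by measurable
  then show int: "integrable M h"
    unfolding real_integrable_def pos[symmetric] neg[symmetric] using fin by simp
  show "r = integral\<^sup>L M h"
    unfolding real_lebesgue_integral_def[OF int] pos[symmetric] neg[symmetric]
    using fin pd by (cases P; cases N) (auto simp: pdiff_def)
qed

lemma pint_combination:
  fixes u :: "'a::topological_space \<rightharpoonup> ereal"
  assumes M: "sets M = sets borel" and N: "sets N = sets borel" and st: "0 \<le> s" "0 \<le> t"
    and uM: "pint M u = Some (ereal x)" and uN: "pint N u = Some (ereal y)"
  shows "pint (combination s M t N) u = Some (ereal (s * x + t * y))"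
proof -
  note dM = pint_SomeD[OF uM] and dN = pint_SomeD[OF uN]
  have "totalize u \<in> borel_measurable (combination s M t N)"
    using dM(1) by (simp add: sets_combination M cong: measurable_cong_sets)
  from pint_SomeI[OF this AE_combination[OF M N dM(2) dN(2)] integrable_combination[OF M N st dM(3) dN(3)]]
  show ?thesis unfolding integral_combination[OF M N st dM(3) dN(3)] dM(4)[symmetric] dN(4)[symmetric] .
qed

lemma psum_SomeI:
  assumes "\<And>j. j \<in> J \<Longrightarrow> u j = Some (ereal (h j))" "integrable (count_space J) h"
  shows "psum J u = Some (ereal (\<integral>j. h j \<partial>count_space J))"
  unfolding psum_def using assms by (intro pint_SomeI) (auto simp: AE_count_space)

lemma psum_SomeD:
  assumes "psum J u = Some (ereal r)"
  obtains h where "\<And>j. j \<in> J \<Longrightarrow> u j = Some (ereal (h j))" "integrable (count_space J) h"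
    "r = (\<integral>j. h j \<partial>count_space J)"
proof -
  note d = pint_SomeD[OF assms[unfolded psum_def]]
  show thesis by (rule that[OF _ d(3,4)]) (use d(2) in \<open>simp add: AE_count_space\<close>)
qed

lemma pdiff_eq: "pdiff x y = (if x = \<infinity> \<and> y = \<infinity> \<or> x = -\<infinity> \<and> y = -\<infinity> then None else Some (x - y))"
  by (cases x; cases y) (auto simp: pdiff_def)

lemma borel_measurable_padd_pdiff:
  assumes [measurable]: "a \<in> borel_measurable M" "b \<in> borel_measurable M"
    "d \<in> borel_measurable M" "e \<in> borel_measurable M"
  shows "totalize (\<lambda>x. padd (pdiff (a x) (b x)) (pdiff (d x) (e x))) \<in> borel_measurable M"
proof -
  have "(case padd (pdiff p q) (pdiff r s) of None \<Rightarrow> 0 | Some r \<Rightarrow> r) =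
     (if (p = \<infinity> \<and> q = \<infinity> \<or> p = -\<infinity> \<and> q = -\<infinity>) \<or> (r = \<infinity> \<and> s = \<infinity> \<or> r = -\<infinity> \<and> s = -\<infinity>)
        \<or> (p - q = \<infinity> \<and> r - s = -\<infinity> \<or> p - q = -\<infinity> \<and> r - s = \<infinity>) then 0 else (p - q) + (r - s))" for p q r s :: ereal
    by (simp add: pdiff_eq)
  then show ?thesis by (simp only:) measurable
qed

lemma
  fixes h :: "'i \<Rightarrow> real"
  assumes "S \<subseteq> B"
  shows integrable_count_space_extend:
      "integrable (count_space B) (\<lambda>j. if j \<in> S then h j else 0) \<longleftrightarrow> integrable (count_space S) h"
    and integral_count_space_extend:
      "(\<integral>j. (if j \<in> S then h j else 0) \<partial>count_space B) = (\<integral>j. h j \<partial>count_space S)"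
proof -
  have eq: "count_space S = restrict_space (count_space B) S"
    using assms by (simp add: restrict_count_space inf_absorb1)
  have f: "(\<lambda>j. if j \<in> S then h j else 0) = (\<lambda>j. indicator S j *\<^sub>R h j)" by (auto simp: indicator_def)
  show "integrable (count_space B) (\<lambda>j. if j \<in> S then h j else 0) \<longleftrightarrow> integrable (count_space S) h"
    unfolding eq f by (subst integrable_restrict_space) auto
  show "(\<integral>j. (if j \<in> S then h j else 0) \<partial>count_space B) = (\<integral>j. h j \<partial>count_space S)"
    unfolding eq f by (subst integral_restrict_space) auto
qed

lemma
  fixes d :: "'i \<Rightarrow> real"
  assumes b: "bij_betw p I S" and "S \<subseteq> B" and inv: "\<And>k. k \<in> I \<Longrightarrow> p' (p k) = k"
    and int: "integrable (count_space I) d"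
  shows integrable_count_space_embed: "integrable (count_space B) (\<lambda>z. if z \<in> S then d (p' z) else 0)"
    and integral_count_space_embed:
      "(\<integral>z. (if z \<in> S then d (p' z) else 0) \<partial>count_space B) = (\<integral>k. d k \<partial>count_space I)"
proof -
  have eq: "integrable (count_space I) (\<lambda>k. d (p' (p k))) \<longleftrightarrow> integrable (count_space I) d"
    "(\<integral>k. d (p' (p k)) \<partial>count_space I) = (\<integral>k. d k \<partial>count_space I)"
    by (intro Bochner_Integration.integrable_cong Bochner_Integration.integral_cong; simp add: inv)+
  show "integrable (count_space B) (\<lambda>z. if z \<in> S then d (p' z) else 0)"
    unfolding integrable_count_space_extend[OF \<open>S \<subseteq> B\<close>]
    using int eq(1) integrable_bij_count_space[OF b, of "\<lambda>z. d (p' z)"] by simp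
  show "(\<integral>z. (if z \<in> S then d (p' z) else 0) \<partial>count_space B) = (\<integral>k. d k \<partial>count_space I)"
    unfolding integral_count_space_extend[OF \<open>S \<subseteq> B\<close>]
    using eq(2) integral_bij_count_space[OF b, of "\<lambda>z. d (p' z)"] by simp
qed

section \<open>Functions of class \<open>\<Phi>\<close>\<close>

lemma Phi_lower_semicontinuous: "\<psi> \<in> Phi \<Longrightarrow> lower_semicontinuous \<psi>"
  by (simp add: Phi_def lower_semicontinuous_def)

lemma Phi_bounded_below:
  fixes \<psi> :: "'a::topological_space \<Rightarrow> ereal"
  assumes "\<psi> \<in> Phi"
  obtains c :: real where "0 \<le> c" "\<And>y. - ereal c \<le> \<psi> y" "c = 0 \<or> compact (UNIV :: 'a set)"
proof (cases "compact (UNIV :: 'a set)")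
  case True
  have op: "open {y. t < \<psi> y}" and fin: "\<psi> y \<noteq> -\<infinity>" for t y using assms by (auto simp: Phi_def)
  have "UNIV \<subseteq> (\<Union>n\<in>UNIV. {y. - ereal (real n) < \<psi> y})"
  proof
    fix y
    have "\<exists>n. - ereal (real n) < \<psi> y"
    proof (cases "\<psi> y")
      case (real r)
      obtain n where "- r < real n" using reals_Archimedean2 by blast
      with real show ?thesis by (intro exI[of _ n]) simp
    qed (use fin[of y] in auto)
    then show "y \<in> (\<Union>n\<in>UNIV. {y. - ereal (real n) < \<psi> y})" by auto
  qed
  then obtain D where D: "finite D" "UNIV \<subseteq> (\<Union>n\<in>D. {y. - ereal (real n) < \<psi> y})"
    using compactE_image[OF True, of UNIV "\<lambda>n. {y. - ereal (real n) < \<psi> y}"] op by metis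
  have "- ereal (real (Max (insert 0 D))) \<le> \<psi> y" for y
  proof -
    obtain n where n: "n \<in> D" "- ereal (real n) < \<psi> y" using D(2) by auto
    then have "real n \<le> real (Max (insert 0 D))" using D(1) by simp
    then have "- ereal (real (Max (insert 0 D))) \<le> - ereal (real n)" by simp
    then show ?thesis using n(2) by (meson less_imp_le order_trans)
  qed
  then show thesis using True by (intro that[of "real (Max (insert 0 D))"]) auto
next
  case False
  then show thesis using assms by (intro that[of 0]) (auto simp: Phi_def zero_ereal_def[symmetric])
qed

text \<open>Adding a constant replaces a function that is bounded below by a nonnegative one.\<close>

lemma eint_shift:
  fixes c :: real
  assumes [measurable]: "u \<in> borel_measurable M" and c: "0 \<le> c" "\<And>x. - ereal c \<le> u x"
    and fin: "c = 0 \<or> emeasure M (space M) < \<infinity>"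
  shows "eint M u = enn2ereal (\<integral>\<^sup>+x. e2ennreal (u x + ereal c) \<partial>M) - ereal (c * measure M (space M))"
proof -
  define P N Q where "P = (\<integral>\<^sup>+x. e2ennreal (u x) \<partial>M)" and "N = (\<integral>\<^sup>+x. e2ennreal (- u x) \<partial>M)"
    and "Q = (\<integral>\<^sup>+x. e2ennreal (u x + ereal c) \<partial>M)"
  define C where "C = ennreal c * emeasure M (space M)"
  have pw: "e2ennreal (u x + ereal c) + e2ennreal (- u x) = e2ennreal (u x) + ennreal c" for x
  proof (cases "u x")
    case (real r)
    then have "- c \<le> r" using c(2)[of x] by simp
    with real c(1) show ?thesis
      by (cases "0 \<le> r") (auto simp: e2ennreal_ereal ennreal_plus[symmetric] ennreal_neg simp del: ennreal_plus)
  qed (use c(2)[of x] in \<open>auto simp: e2ennreal_ereal\<close>)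
  have "Q + N = P + C"
  proof -
    have "Q + N = (\<integral>\<^sup>+x. e2ennreal (u x + ereal c) + e2ennreal (- u x) \<partial>M)"
      unfolding Q_def N_def by (rule nn_integral_add[symmetric]) simp_all
    also have "\<dots> = P + C"
      unfolding P_def C_def pw by (subst nn_integral_add) simp_all
    finally show ?thesis .
  qed
  moreover have "N \<le> C"
  proof -
    have "e2ennreal (- u x) \<le> ennreal c" for x
    proof -
      have "- u x \<le> ereal c" using c(2)[of x] by (metis ereal_minus_le_minus ereal_uminus_uminus)
      then show ?thesis using e2ennreal_mono e2ennreal_ereal by metis
    qed
    then have "N \<le> (\<integral>\<^sup>+x. ennreal c \<partial>M)" unfolding N_def by (intro nn_integral_mono)
    then show ?thesis by (simp add: C_def)
  qed
  moreover have C: "C = ennreal (c * measure M (space M))"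
    using fin c(1) by (auto simp: C_def emeasure_eq_ennreal_measure ennreal_mult less_top)
  ultimately show ?thesis
    unfolding eint_def P_def[symmetric] N_def[symmetric] Q_def[symmetric] using c(1)
    by (cases P; cases N; cases Q)
      (auto simp: ennreal_plus[symmetric] top_unique simp del: ennreal_plus)
qed

section \<open>Energies and potentials\<close>

text \<open>
  The constant \<open>c\<close> makes \<open>\<kappa> + c\<close> nonnegative. It is \<open>0\<close> unless the space is compact, and then all Radon measures are
  finite; so passing from \<open>\<kappa>\<close> to \<open>\<kappa> + c\<close> always changes potentials and energies by finite amounts.
\<close>

locale positive_definite_kernel =
  fixes \<kappa> :: "'a::t2_space \<times> 'a \<Rightarrow> ereal" and c :: real
  assumes lc: "locally_compact_type TYPE('a)"
    and kernel: "\<kappa> \<in> Phi"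
    and pos_def: "positive_definite \<kappa>"
    and c_nonneg: "0 \<le> c"
    and lower_bound: "\<And>z. - ereal c \<le> \<kappa> z"
    and c_zero_or_compact: "c = 0 \<or> compact (UNIV :: 'a set)"
begin

definition shifted :: "'a \<times> 'a \<Rightarrow> ennreal" where
  "shifted z = e2ennreal (\<kappa> z + ereal c)"

definition pot :: "'a measure \<Rightarrow> 'a \<Rightarrow> ennreal" where
  "pot \<mu> x = (\<integral>\<^sup>+y. shifted (x, y) \<partial>\<mu>)"

definition shifted_energy :: "'a measure \<Rightarrow> 'a measure \<Rightarrow> ennreal" where
  "shifted_energy \<mu> \<nu> = (\<integral>\<^sup>+x. pot \<nu> x \<partial>\<mu>)"

text \<open>The mutual energy as a real number; meaningful if \<^const>\<open>shifted_energy\<close> is finite.\<close>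

definition energy :: "'a measure \<Rightarrow> 'a measure \<Rightarrow> real" where
  "energy \<mu> \<nu> = enn2real (shifted_energy \<mu> \<nu>) - c * measure \<mu> UNIV * measure \<nu> UNIV"

lemma shifted_lower_semicontinuous: "lower_semicontinuous shifted"
  unfolding lower_semicontinuous_def
proof
  fix t
  have "t < shifted z \<longleftrightarrow> enn2ereal t - ereal c < \<kappa> z" for z
  proof -
    have "0 \<le> \<kappa> z + ereal c" using lower_bound[of z] by (cases "\<kappa> z") auto
    then have "t < shifted z \<longleftrightarrow> enn2ereal t < \<kappa> z + ereal c"
      by (simp add: shifted_def less_ennreal.rep_eq enn2ereal_e2ennreal)
    also have "\<dots> \<longleftrightarrow> enn2ereal t - ereal c < \<kappa> z" by (simp add: ereal_minus_less)
    finally show ?thesis .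
  qed
  then show "open {z. t < shifted z}" using kernel by (simp add: Phi_def)
qed

lemma shifted_sym: "shifted (x, y) = shifted (y, x)"
  using pos_def by (simp add: positive_definite_def shifted_def)

lemma pot_borel: "radon \<mu> \<Longrightarrow> pot \<mu> \<in> borel_measurable borel"
  unfolding pot_def by (rule borel_measurable_section_integral[OF lc lc _ _ shifted_lower_semicontinuous])

lemma pot_measurable [measurable]: "radon \<mu> \<Longrightarrow> sets M = sets borel \<Longrightarrow> pot \<mu> \<in> borel_measurable M"
  using pot_borel by (simp cong: measurable_cong_sets)

lemma shifted_energy_commute:
  assumes "radon \<mu>" "radon \<nu>"
  shows "shifted_energy \<mu> \<nu> = shifted_energy \<nu> \<mu>"
proof -
  have "shifted_energy \<mu> \<nu> = (\<integral>\<^sup>+y. (\<integral>\<^sup>+x. shifted (x, y) \<partial>\<mu>) \<partial>\<nu>)"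
    unfolding shifted_energy_def pot_def
    by (rule nn_integral_radon_swap[OF lc lc assms shifted_lower_semicontinuous])
  also have "\<dots> = shifted_energy \<nu> \<mu>"
    unfolding shifted_energy_def pot_def by (intro nn_integral_cong shifted_sym)
  finally show ?thesis .
qed

lemma c_zero_or_finite: "radon (\<mu> :: 'a measure) \<Longrightarrow> c = 0 \<or> emeasure \<mu> UNIV < \<infinity>"
  using c_zero_or_compact radonD(3)[of \<mu> UNIV] by auto

lemma potential_eq:
  assumes "radon \<nu>"
  shows "potential \<kappa> \<nu> x = enn2ereal (pot \<nu> x) - ereal (c * measure \<nu> UNIV)"
proof -
  have "(\<lambda>y. \<kappa> (x, y)) \<in> borel_measurable borel"
    using kernel by (intro lower_semicontinuous_borel lower_semicontinuous_section Phi_lower_semicontinuous)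
  then have "(\<lambda>y. \<kappa> (x, y)) \<in> borel_measurable \<nu>"
    using radonD(1)[OF assms] by (simp cong: measurable_cong_sets)
  from eint_shift[OF this c_nonneg lower_bound] show ?thesis
    using c_zero_or_finite[OF assms] by (simp add: potential_def pot_def shifted_def radonD(2)[OF assms])
qed

lemma mutual_energy_eq:
  assumes "radon \<mu>" "radon \<nu>"
  shows "mutual_energy \<kappa> \<mu> \<nu> = enn2ereal (shifted_energy \<mu> \<nu>) - ereal (c * measure \<mu> UNIV * measure \<nu> UNIV)"
proof -
  let ?\<pi> = "radon_prod \<mu> \<nu>"
  note r = radon_radon_prod[OF lc lc assms]
  have "\<kappa> \<in> borel_measurable ?\<pi>"
    using lower_semicontinuous_borel[OF Phi_lower_semicontinuous[OF kernel]] radonD(1)[OF r]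
    by (simp cong: measurable_cong_sets)
  moreover have mass: "emeasure ?\<pi> UNIV = emeasure \<mu> UNIV * emeasure \<nu> UNIV" if "compact (UNIV :: 'a set)"
    using emeasure_radon_prod_rectangle[OF lc lc assms that that] by simp
  then have "c = 0 \<or> emeasure ?\<pi> (space ?\<pi>) < \<infinity>"
    using c_zero_or_compact radonD(3)[OF assms(1)] radonD(3)[OF assms(2)]
    by (auto simp: radonD(2)[OF r] ennreal_mult_less_top)
  moreover have eqm: "c * measure ?\<pi> UNIV = c * measure \<mu> UNIV * measure \<nu> UNIV"
    using c_zero_or_compact mass by (auto simp: measure_def enn2real_mult)
  ultimately show ?thesis
    unfolding eqm[symmetric] using eint_shift[of \<kappa> ?\<pi> c] c_nonneg lower_bound
      nn_integral_radon_prod[OF lc lc assms shifted_lower_semicontinuous]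
    by (simp add: mutual_energy_def shifted_energy_def pot_def shifted_def radonD(2)[OF r])
qed

lemma mutual_energy_finite:
  assumes "radon \<mu>" "radon \<nu>" "shifted_energy \<mu> \<nu> < \<infinity>"
  shows "mutual_energy \<kappa> \<mu> \<nu> = ereal (energy \<mu> \<nu>)"
  using assms(3) unfolding mutual_energy_eq[OF assms(1,2)] energy_def
  by (cases "shifted_energy \<mu> \<nu>") auto

lemma shifted_energy_finite_iff:
  assumes "radon \<mu>" "radon \<nu>"
  shows "shifted_energy \<mu> \<nu> < \<infinity> \<longleftrightarrow> mutual_energy \<kappa> \<mu> \<nu> < \<infinity>"
  unfolding mutual_energy_eq[OF assms] by (cases "shifted_energy \<mu> \<nu>") auto

lemma mutual_energy_infinite:
  assumes "radon \<mu>" "radon \<nu>" "\<not> shifted_energy \<mu> \<nu> < \<infinity>"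
  shows "mutual_energy \<kappa> \<mu> \<nu> = \<infinity>"
  using assms shifted_energy_finite_iff by auto

lemma energy_pos_iff: "\<nu> \<in> energy_pos \<kappa> \<longleftrightarrow> radon \<nu> \<and> shifted_energy \<nu> \<nu> < \<infinity>"
proof (cases "radon \<nu>")
  case True
  then show ?thesis
    using shifted_energy_finite_iff[OF True True] mutual_energy_finite[OF True True]
    by (auto simp: energy_pos_def)
qed (simp add: energy_pos_def)

lemma energy_commute: "radon \<mu> \<Longrightarrow> radon \<nu> \<Longrightarrow> energy \<mu> \<nu> = energy \<nu> \<mu>"
  using shifted_energy_commute by (simp add: energy_def)

lemma shifted_energy_combination:
  assumes "radon M" "radon N" "radon \<sigma>"
  shows "shifted_energy (combination s M t N) \<sigma> = ennreal s * shifted_energy M \<sigma> + ennreal t * shifted_energy N \<sigma>"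
  unfolding shifted_energy_def using assms
  by (intro nn_integral_combination pot_borel radonD(1))

lemma energy_combination:
  assumes "radon M" "radon N" "radon \<sigma>" "0 \<le> s" "0 \<le> t"
    and fin: "shifted_energy M \<sigma> < \<infinity>" "shifted_energy N \<sigma> < \<infinity>"
  shows "energy (combination s M t N) \<sigma> = s * energy M \<sigma> + t * energy N \<sigma>"
proof -
  have "c * measure (combination s M t N) UNIV = c * (s * measure M UNIV + t * measure N UNIV)"
    using c_zero_or_finite[OF assms(1)] c_zero_or_finite[OF assms(2)]
    by (auto simp: measure_def emeasure_combination radonD(1)[OF assms(1)] radonD(1)[OF assms(2)]
        enn2real_linear[OF assms(4,5)])
  then have "c * measure (combination s M t N) UNIV * measure \<sigma> UNIV
      = s * (c * measure M UNIV * measure \<sigma> UNIV) + t * (c * measure N UNIV * measure \<sigma> UNIV)"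
    by (simp add: algebra_simps)
  then show ?thesis
    unfolding energy_def shifted_energy_combination[OF assms(1-3)] enn2real_linear[OF assms(4,5) fin]
    by (simp add: algebra_simps)
qed

lemma shifted_energy_restricted:
  assumes "radon \<nu>" "radon \<sigma>" "compact C"
  shows "shifted_energy (multiple_on r C \<nu>) \<sigma> = ennreal r * (\<integral>\<^sup>+x. pot \<sigma> x * indicator C x \<partial>\<nu>)"
  unfolding shifted_energy_def using assms
  by (subst nn_integral_multiple_on) (auto simp: radonD(1) compact_imp_closed)

lemma shifted_energy_restricted_le:
  assumes "radon \<nu>" "radon \<sigma>" "compact C"
  shows "shifted_energy (multiple_on r C \<nu>) \<sigma> \<le> ennreal r * shifted_energy \<nu> \<sigma>"
  unfolding shifted_energy_restricted[OF assms] unfolding shifted_energy_def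
  by (intro mult_left_mono nn_integral_mono) (auto split: split_indicator)

lemma shifted_energy_restricted_finite:
  assumes \<nu>: "radon \<nu>" and "compact C" and fin: "shifted_energy \<nu> \<nu> < \<infinity>"
  shows "shifted_energy (multiple_on r C \<nu>) (multiple_on r C \<nu>) < \<infinity>"
proof -
  note r = radon_multiple_on[OF \<nu> \<open>compact C\<close>, of r]
  have "shifted_energy (multiple_on r C \<nu>) (multiple_on r C \<nu>)
      \<le> ennreal r * shifted_energy (multiple_on r C \<nu>) \<nu>"
    using shifted_energy_restricted_le[OF \<nu> r \<open>compact C\<close>, of r] by (simp add: shifted_energy_commute[OF \<nu> r])
  also have "\<dots> \<le> ennreal r * (ennreal r * shifted_energy \<nu> \<nu>)"
    by (intro mult_left_mono shifted_energy_restricted_le \<nu> \<open>compact C\<close>) simp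
  also have "\<dots> < \<infinity>" using fin by (simp add: ennreal_mult_less_top)
  finally show ?thesis .
qed

text \<open>
  Mutual singularity makes \<open>(\<nu>, \<Lambda>)\<close> the Jordan decomposition of \<open>\<nu> - \<Lambda>\<close>, whose energy cannot be negative. An
  infinite mutual energy would make it \<open>-\<infinity>\<close>.
\<close>

lemma singular_mutual_energy_le:
  assumes \<nu>: "radon \<nu>" and \<Lambda>: "radon \<Lambda>" and sing: "signed_radon (\<nu>, \<Lambda>)"
    and fin: "shifted_energy \<nu> \<nu> < \<infinity>" "shifted_energy \<Lambda> \<Lambda> < \<infinity>"
  shows "shifted_energy \<nu> \<Lambda> < \<infinity>" and "2 * energy \<nu> \<Lambda> \<le> energy \<nu> \<nu> + energy \<Lambda> \<Lambda>"
proof -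
  let ?x = "mutual_energy \<kappa> \<nu> \<Lambda>"
  have sym: "mutual_energy \<kappa> \<Lambda> \<nu> = ?x"
    unfolding mutual_energy_eq[OF \<nu> \<Lambda>] mutual_energy_eq[OF \<Lambda> \<nu>] by (simp add: shifted_energy_commute[OF \<nu> \<Lambda>] mult_ac)
  have eq: "signed_mutual_energy \<kappa> (\<nu>, \<Lambda>) (\<nu>, \<Lambda>) = pdiff (ereal (energy \<nu> \<nu> + energy \<Lambda> \<Lambda>)) (?x + ?x)"
    by (simp add: signed_mutual_energy_def sym mutual_energy_finite[OF \<nu> \<nu> fin(1)] mutual_energy_finite[OF \<Lambda> \<Lambda> fin(2)])
  have pd: "0 \<le> r" if "pdiff (ereal (energy \<nu> \<nu> + energy \<Lambda> \<Lambda>)) (?x + ?x) = Some r" for r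
  proof -
    have "signed_mutual_energy \<kappa> (\<nu>, \<Lambda>) (\<nu>, \<Lambda>) = Some r" using that eq by simp
    then show ?thesis using pos_def sing by (simp add: positive_definite_def)
  qed
  show f: "shifted_energy \<nu> \<Lambda> < \<infinity>"
  proof (rule ccontr)
    assume "\<not> ?thesis"
    then have "?x = \<infinity>" by (rule mutual_energy_infinite[OF \<nu> \<Lambda>])
    then show False using pd[of "-\<infinity>"] by (simp add: pdiff_def)
  qed
  show "2 * energy \<nu> \<Lambda> \<le> energy \<nu> \<nu> + energy \<Lambda> \<Lambda>"
    using pd[of "ereal (energy \<nu> \<nu> + energy \<Lambda> \<Lambda> - 2 * energy \<nu> \<Lambda>)"]
    by (simp add: mutual_energy_finite[OF \<nu> \<Lambda> f] pdiff_def)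
qed

lemma energy_nonneg:
  assumes \<nu>: "radon \<nu>" and fin: "shifted_energy \<nu> \<nu> < \<infinity>"
  shows "0 \<le> energy \<nu> \<nu>"
proof -
  let ?Z = "null_measure borel :: 'a measure"
  have Z: "radon ?Z" by (rule radon_null_measure)
  have "signed_radon (\<nu>, ?Z)"
    unfolding signed_radon_def using \<nu> Z by (auto intro!: bexI[of _ "{}"])
  moreover have "shifted_energy ?Z ?Z = 0" "shifted_energy \<nu> ?Z = 0"
    by (simp_all add: shifted_energy_def pot_def)
  ultimately show ?thesis
    using singular_mutual_energy_le(2)[OF \<nu> Z _ fin] by (simp add: energy_def)
qed

lemma nearly_everywhereI:
  assumes "\<And>\<nu>. radon \<nu> \<Longrightarrow> shifted_energy \<nu> \<nu> < \<infinity> \<Longrightarrow> emeasure \<nu> UNIV = 1 \<Longrightarrow> compact (msupport \<nu>)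
      \<Longrightarrow> msupport \<nu> \<subseteq> {x \<in> E. \<not> P x} \<Longrightarrow> False"
  shows "nearly_everywhere \<kappa> E P"
proof -
  have "{\<nu> \<in> energy_pos \<kappa>. emeasure \<nu> UNIV = 1 \<and> compact (msupport \<nu>) \<and> msupport \<nu> \<subseteq> {x \<in> E. \<not> P x}} = {}"
  proof (rule equals0I, elim CollectE conjE)
    fix \<nu> assume "\<nu> \<in> energy_pos \<kappa>" "emeasure \<nu> UNIV = 1" "compact (msupport \<nu>)"
      "msupport \<nu> \<subseteq> {x \<in> E. \<not> P x}"
    then show False using assms[of \<nu>] by (simp add: energy_pos_iff)
  qed
  then show ?thesis
    unfolding nearly_everywhere_def interior_capacity_def
    by (simp only: image_empty Inf_empty) (simp add: top_ereal_def)
qed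

text \<open>
  Otherwise the restriction of \<open>\<nu>\<close> to \<open>C\<close>, normalized, would have finite energy and so give the exceptional set
  positive capacity.
\<close>

lemma nearly_everywhere_null:
  assumes ne: "nearly_everywhere \<kappa> E P" and \<nu>: "radon \<nu>" and fin: "shifted_energy \<nu> \<nu> < \<infinity>"
    and C: "compact C" "C \<subseteq> {x \<in> E. \<not> P x}"
  shows "emeasure \<nu> C = 0"
proof (rule ccontr)
  assume "emeasure \<nu> C \<noteq> 0"
  have Cb: "C \<in> sets \<nu>" "closed C" using C(1) radonD(1)[OF \<nu>] by (auto simp: compact_imp_closed)
  define m where "m = measure \<nu> C"
  have em: "emeasure \<nu> C = ennreal m" and "0 < m"
    using radonD(3)[OF \<nu> C(1)] \<open>emeasure \<nu> C \<noteq> 0\<close> unfolding m_def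
    by (auto simp: emeasure_eq_ennreal_measure less_top zero_less_measure_iff)
  define \<tau> where "\<tau> = multiple_on (1 / m) C \<nu>"
  have \<tau>: "radon \<tau>" unfolding \<tau>_def by (rule radon_multiple_on[OF \<nu> C(1)])
  have tot: "emeasure \<tau> UNIV = 1"
    unfolding \<tau>_def using \<open>0 < m\<close> sets.top[of \<nu>] radonD(2)[OF \<nu>]
    by (subst emeasure_multiple_on[OF Cb(1)]) (auto simp: em ennreal_mult[symmetric])
  have "emeasure \<tau> (- C) = 0"
    unfolding \<tau>_def using Cb radonD(1)[OF \<nu>] by (subst emeasure_multiple_on[OF Cb(1)]) auto
  then have "msupport \<tau> \<subseteq> C" using \<tau> radon_on_closed_iff[OF Cb(2), of \<tau>] by (auto simp: radon_on_def)
  then have "msupport \<tau> \<subseteq> {x \<in> E. \<not> P x}" "compact (msupport \<tau>)"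
    using C(2) compact_Int_closed[OF C(1) closed_msupport[of \<tau>]] by (auto simp: inf_absorb2)
  moreover have e\<tau>: "shifted_energy \<tau> \<tau> < \<infinity>"
    unfolding \<tau>_def by (rule shifted_energy_restricted_finite[OF \<nu> C(1) fin])
  ultimately have mem: "\<tau> \<in> {\<nu> \<in> energy_pos \<kappa>. emeasure \<nu> UNIV = 1 \<and> compact (msupport \<nu>) \<and> msupport \<nu> \<subseteq> {x \<in> E. \<not> P x}}"
    (is "_ \<in> ?S") using \<tau> tot by (simp add: energy_pos_iff)
  define I where "I = (INF \<nu>\<in>?S. mutual_energy \<kappa> \<nu> \<nu>)"
  have "0 \<le> I"
    unfolding I_def using energy_nonneg by (intro INF_greatest) (auto simp: energy_pos_iff mutual_energy_finite)
  moreover have "I \<le> ereal (energy \<tau> \<tau>)"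
    unfolding I_def using mem mutual_energy_finite[OF \<tau> \<tau> e\<tau>] by (intro INF_lower2[OF mem]) simp
  moreover have "1 / I = 0" using ne unfolding nearly_everywhere_def interior_capacity_def I_def .
  ultimately show False
    by (cases I) (auto simp: one_ereal_def split: if_splits)
qed

end

section \<open>Finiteness of potentials\<close>

lemma null_if_AE_not_in:
  assumes "AE x in M. x \<notin> C" "C \<in> sets M"
  shows "emeasure M C = 0"
  using emeasure_eq_0_AE[OF assms(1)] sets.sets_into_space[OF assms(2)]
  by (simp add: Collect_conj_eq Int_absorb1)

context positive_definite_kernel
begin

primrec partial_sums :: "(nat \<Rightarrow> 'a measure) \<Rightarrow> nat \<Rightarrow> 'a measure" where
  "partial_sums \<sigma> 0 = null_measure borel"
| "partial_sums \<sigma> (Suc n) = combination 1 (partial_sums \<sigma> n) 1 (\<sigma> n)"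

lemma radon_partial_sums: "(\<And>j. radon (\<sigma> j)) \<Longrightarrow> radon (partial_sums \<sigma> n)"
  by (induction n) (auto intro: radon_null_measure radon_combination)

lemma emeasure_partial_sums:
  assumes "\<And>j. radon (\<sigma> j)" "B \<in> sets borel"
  shows "emeasure (partial_sums \<sigma> n) B = (\<Sum>j<n. emeasure (\<sigma> j) B)"
  using assms(2) radon_partial_sums[of \<sigma>] assms(1)
  by (induction n) (simp_all add: emeasure_combination radonD(1) del: radonD(2))

lemma shifted_energy_partial_sums:
  assumes "\<And>j. radon (\<sigma> j)" "radon \<tau>"
  shows "shifted_energy (partial_sums \<sigma> n) \<tau> = (\<Sum>j<n. shifted_energy (\<sigma> j) \<tau>)"
proof (induction n)
  case 0
  then show ?case by (simp add: shifted_energy_def)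
next
  case (Suc n)
  then show ?case
    using assms radon_partial_sums[of \<sigma> n] by (simp add: shifted_energy_combination)
qed

text \<open>
  If the potential of \<open>\<Sigma>\<^sub>j \<sigma>\<^sub>j\<close> is infinite on \<open>C\<close> then every \<open>\<sigma>\<^sub>j\<close> vanishes on \<open>C\<close>, because
  the potential is integrable with respect to \<open>\<sigma>\<^sub>j\<close>. Hence the restriction \<open>\<nu>'\<close> of \<open>\<nu>\<close> to \<open>C\<close> and the partial
  sums \<open>\<Lambda>\<close> are mutually singular, and up to constants \<open>2 \<kappa>(\<nu>', \<Lambda>) \<le> \<kappa>(\<nu>', \<nu>') + \<kappa>(\<Lambda>, \<Lambda>)\<close> is bounded. So the potential
  is \<open>\<nu>'\<close>-integrable, and \<open>\<nu>'\<close> vanishes as well.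
\<close>

lemma infinite_potential_null:
  fixes \<sigma> :: "nat \<Rightarrow> 'a measure"
  assumes \<sigma>: "\<And>j. radon (\<sigma> j)"
    and fin: "(\<Sum>j. \<Sum>k. shifted_energy (\<sigma> j) (\<sigma> k)) < \<infinity>"
    and mass: "(\<Sum>j. ennreal c * emeasure (\<sigma> j) UNIV) < \<infinity>"
    and \<nu>: "radon \<nu>" "shifted_energy \<nu> \<nu> < \<infinity>"
    and C: "compact C" "\<And>x. x \<in> C \<Longrightarrow> (\<Sum>j. pot (\<sigma> j) x) = \<infinity>"
  shows "emeasure \<nu> C = 0"
proof -
  define T where "T x = (\<Sum>j. pot (\<sigma> j) x)" for x
  have Cb: "C \<in> sets borel" using C(1) by (simp add: compact_imp_closed)
  have T_int: "(\<integral>\<^sup>+x. T x \<partial>\<rho>) = (\<Sum>j. shifted_energy \<rho> (\<sigma> j))" if "radon \<rho>" for \<rho>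
    unfolding T_def shifted_energy_def
    by (rule nn_integral_suminf) (intro pot_measurable \<sigma> radonD(1)[OF that])
  have T_meas: "T \<in> borel_measurable \<rho>" if "radon \<rho>" for \<rho>
    unfolding T_def using pot_measurable[OF \<sigma> radonD(1)[OF that]] by measurable
  have null: "emeasure \<rho> C = 0" if \<rho>: "radon \<rho>" "(\<integral>\<^sup>+x. T x \<partial>\<rho>) < \<infinity>" for \<rho>
  proof (rule null_if_AE_not_in)
    have "AE x in \<rho>. T x \<noteq> \<infinity>"
      using \<rho> T_meas[OF \<rho>(1)] by (intro nn_integral_noteq_infinite) auto
    then show "AE x in \<rho>. x \<notin> C" by eventually_elim (use C(2) T_def in auto)
    show "C \<in> sets \<rho>" using Cb radonD(1)[OF \<rho>(1)] by simp
  qed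
  define S where "S = (\<Sum>j. \<Sum>k. shifted_energy (\<sigma> j) (\<sigma> k))"
  have row: "(\<Sum>k. shifted_energy (\<sigma> j) (\<sigma> k)) \<le> S" for j
    unfolding S_def using sum_le_suminf[of "\<lambda>j. \<Sum>k. shifted_energy (\<sigma> j) (\<sigma> k)" "{j}"] by simp
  have \<sigma>C: "emeasure (\<sigma> j) C = 0" for j
    using row[of j] fin by (intro null \<sigma>) (simp add: T_int[OF \<sigma>] S_def order_le_less_trans)
  define N where "N = multiple_on 1 C \<nu>"
  have rN: "radon N" unfolding N_def by (rule radon_multiple_on[OF \<nu>(1) C(1)])
  have C\<nu>: "C \<in> sets \<nu>" using Cb radonD(1)[OF \<nu>(1)] by simp
  have N: "emeasure N B = emeasure \<nu> (B \<inter> C)" if "B \<in> sets borel" for B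
    using that emeasure_multiple_on[OF C\<nu>, of B 1] radonD(1)[OF \<nu>(1)] by (simp add: N_def)
  have qN: "shifted_energy N N < \<infinity>"
    unfolding N_def by (rule shifted_energy_restricted_finite[OF \<nu>(1) C(1) \<nu>(2)])
  define \<Lambda> where "\<Lambda> = partial_sums \<sigma>"
  have r\<Lambda>: "radon (\<Lambda> n)" for n unfolding \<Lambda>_def by (rule radon_partial_sums[OF \<sigma>])
  have q\<Lambda>: "shifted_energy (\<Lambda> n) (\<Lambda> n) \<le> S" for n
  proof -
    have "shifted_energy (\<Lambda> n) (\<Lambda> n) = (\<Sum>j<n. shifted_energy (\<Lambda> n) (\<sigma> j))"
      unfolding \<Lambda>_def shifted_energy_partial_sums[OF \<sigma> r\<Lambda>[unfolded \<Lambda>_def]]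
      by (intro sum.cong refl shifted_energy_commute \<sigma> r\<Lambda>[unfolded \<Lambda>_def])
    also have "\<dots> = (\<Sum>j<n. \<Sum>k<n. shifted_energy (\<sigma> j) (\<sigma> k))"
      unfolding \<Lambda>_def by (intro sum.cong refl) (simp add: shifted_energy_partial_sums \<sigma> shifted_energy_commute)
    also have "\<dots> \<le> (\<Sum>j<n. \<Sum>k. shifted_energy (\<sigma> j) (\<sigma> k))"
      by (intro sum_mono sum_le_suminf) auto
    also have "\<dots> \<le> S" unfolding S_def by (intro sum_le_suminf) auto
    finally show ?thesis .
  qed
  have m\<Lambda>: "c * measure (\<Lambda> n) UNIV \<le> enn2real (\<Sum>j. ennreal c * emeasure (\<sigma> j) UNIV)" for n
  proof -
    have "ennreal c * emeasure (\<Lambda> n) UNIV = (\<Sum>j<n. ennreal c * emeasure (\<sigma> j) UNIV)"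
      unfolding \<Lambda>_def by (simp add: emeasure_partial_sums \<sigma> sum_distrib_left)
    also have "\<dots> \<le> (\<Sum>j. ennreal c * emeasure (\<sigma> j) UNIV)" by (intro sum_le_suminf) auto
    finally have "enn2real (ennreal c * emeasure (\<Lambda> n) UNIV) \<le> enn2real (\<Sum>j. ennreal c * emeasure (\<sigma> j) UNIV)"
      using mass by (intro enn2real_mono) auto
    then show ?thesis using c_nonneg by (simp add: enn2real_mult measure_def)
  qed
  have sing: "signed_radon (N, \<Lambda> n)" for n
    unfolding signed_radon_def fst_conv snd_conv
  proof (intro conjI allI impI rN r\<Lambda>)
    fix K :: "'a set" assume "compact K"
    then have Kb: "K \<in> sets borel" by (simp add: compact_imp_closed)
    have "K - - C \<subseteq> C" by auto
    moreover have "emeasure (\<Lambda> n) C = 0"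
      using Cb by (simp add: \<Lambda>_def emeasure_partial_sums \<sigma> \<sigma>C)
    moreover have "C \<in> sets (\<Lambda> n)" using Cb radonD(1)[OF r\<Lambda>] by simp
    ultimately have "emeasure (\<Lambda> n) (K - - C) = 0" by (metis emeasure_eq_0)
    moreover have "emeasure N (K \<inter> - C) = 0" using Kb Cb by (subst N) (auto simp: Int_assoc)
    ultimately show "\<exists>B\<in>sets borel. emeasure N (K \<inter> B) = 0 \<and> emeasure (\<Lambda> n) (K - B) = 0"
      using Cb by (intro bexI[of _ "- C"] conjI) simp_all
  qed
  \<comment> \<open>The second summand bounds the shift between \<open>energy\<close> and \<open>shifted_energy\<close>, uniformly in \<open>n\<close>.\<close>
  define b where "b = (enn2real (shifted_energy N N) + enn2real S) / 2
      + enn2real (\<Sum>j. ennreal c * emeasure (\<sigma> j) UNIV) * measure N UNIV"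
  have bound: "(\<Sum>j<n. shifted_energy N (\<sigma> j)) \<le> ennreal b" for n
  proof -
    have f\<Lambda>: "shifted_energy (\<Lambda> n) (\<Lambda> n) < \<infinity>" using q\<Lambda>[of n] fin by (simp add: S_def order_le_less_trans)
    note s = singular_mutual_energy_le[OF rN r\<Lambda> sing qN f\<Lambda>]
    have "energy N N \<le> enn2real (shifted_energy N N)" "energy (\<Lambda> n) (\<Lambda> n) \<le> enn2real (shifted_energy (\<Lambda> n) (\<Lambda> n))"
      using c_nonneg by (simp_all add: energy_def)
    moreover have "enn2real (shifted_energy (\<Lambda> n) (\<Lambda> n)) \<le> enn2real S"
      using q\<Lambda> fin by (intro enn2real_mono) (auto simp: S_def)
    moreover have "c * measure N UNIV * measure (\<Lambda> n) UNIV
        \<le> enn2real (\<Sum>j. ennreal c * emeasure (\<sigma> j) UNIV) * measure N UNIV"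
      using mult_right_mono[OF m\<Lambda>[of n], of "measure N UNIV"] by (simp add: mult_ac)
    ultimately have "enn2real (shifted_energy N (\<Lambda> n)) \<le> b"
      using s(2) unfolding energy_def[of N "\<Lambda> n"] b_def by (simp add: field_simps)
    then have "shifted_energy N (\<Lambda> n) \<le> ennreal b"
      using s(1) by (metis ennreal_enn2real ennreal_leI infinity_ennreal_def)
    moreover have "shifted_energy N (\<Lambda> n) = (\<Sum>j<n. shifted_energy N (\<sigma> j))"
      unfolding shifted_energy_commute[OF rN r\<Lambda>] unfolding \<Lambda>_def
      by (simp add: shifted_energy_partial_sums \<sigma> rN shifted_energy_commute)
    ultimately show ?thesis by simp
  qed
  have "(\<integral>\<^sup>+x. T x \<partial>N) \<le> ennreal b"
    unfolding T_int[OF rN] suminf_eq_SUP by (intro SUP_least bound)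
  then have "emeasure N C = 0" by (intro null rN) (simp add: order_le_less_trans)
  then show ?thesis using N[OF Cb] by simp
qed

end

section \<open>The equilibrium problem\<close>

locale equilibrium_problem = positive_definite_kernel \<kappa> c
  for \<kappa> :: "'a::t2_space \<times> 'a \<Rightarrow> ereal" and c :: real +
  fixes Ipos Ineg :: "nat set" and A :: "nat \<Rightarrow> 'a set" and f :: "nat \<Rightarrow> 'a \<rightharpoonup> ereal"
    and a :: "nat \<Rightarrow> real" and g :: "nat \<Rightarrow> 'a \<Rightarrow> real" and l :: "nat \<Rightarrow> 'a measure" and i :: nat
  assumes condenser: "condenser Ipos Ineg A"
    and field: "external_field \<kappa> Ipos Ineg f"
    and a_pos: "\<And>j. j \<in> Ipos \<union> Ineg \<Longrightarrow> 0 < a j"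
    and g_cont: "\<And>j. j \<in> Ipos \<union> Ineg \<Longrightarrow> continuous_on (A j) (g j)"
    and g_pos: "\<And>j x. j \<in> Ipos \<union> Ineg \<Longrightarrow> x \<in> A j \<Longrightarrow> 0 < g j x"
    and equilibrium: "l \<in> equilibrium \<kappa> Ipos Ineg f A a g"
    and i: "i \<in> Ipos \<union> Ineg"
begin

abbreviation J :: "nat set" where "J \<equiv> Ipos \<union> Ineg"

definition sg :: "nat \<Rightarrow> real" where "sg j = (if j \<in> Ipos then 1 else - 1)"

lemma sign_eq: "sign Ipos j = ereal (sg j)"
  by (simp add: sign_def sg_def one_ereal_def)

lemma sg_abs: "\<bar>sg j\<bar> = 1" and sg_square: "sg j * sg j = 1" and sg_cases: "sg j = 1 \<or> sg j = - 1"
  by (auto simp: sg_def)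

lemma closed_A: "j \<in> J \<Longrightarrow> closed (A j)"
  using condenser by (simp add: condenser_def)

lemma l_admissible: "l \<in> admissible \<kappa> Ipos Ineg f A a g"
  using equilibrium by (simp add: equilibrium_def)

lemma l_radon_on: "j \<in> J \<Longrightarrow> l j \<in> radon_on (A j)"
  using l_admissible by (simp add: admissible_def energy_vectors_def vector_measures_def)

lemma l_radon: "j \<in> J \<Longrightarrow> radon (l j)"
  using l_radon_on by (simp add: radon_on_def)

lemma l_field:
  obtains h where "\<And>j. j \<in> J \<Longrightarrow> pint (l j) (f j) = Some (ereal (h j))" "integrable (count_space J) h"
proof -
  obtain r where r: "psum J (\<lambda>j. pint (l j) (f j)) = Some (ereal r)"
    using l_admissible by (auto simp: admissible_def pfinite_def field_integral_def)
  show thesis by (rule psum_SomeD[OF r], rule that)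
qed

lemma
  shows l_energy_finite: "\<And>j k. j \<in> J \<Longrightarrow> k \<in> J \<Longrightarrow> shifted_energy (l j) (l k) < \<infinity>"
    and l_energy_integrable: "integrable (count_space (J \<times> J)) (\<lambda>(j, k). sg j * sg k * energy (l j) (l k))"
    and l_vector_energy: "vector_mutual_energy \<kappa> Ipos Ineg l l =
      Some (ereal (\<integral>(j, k). sg j * sg k * energy (l j) (l k) \<partial>count_space (J \<times> J)))"
proof -
  obtain r where r: "vector_mutual_energy \<kappa> Ipos Ineg l l = Some (ereal r)"
    using l_admissible by (auto simp: admissible_def energy_vectors_def pfinite_def)
  obtain h where h: "\<And>p. p \<in> J \<times> J \<Longrightarrow>
      (case p of (j, k) \<Rightarrow> Some (sign Ipos j * sign Ipos k * mutual_energy \<kappa> (l j) (l k))) = Some (ereal (h p))"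
    and int: "integrable (count_space (J \<times> J)) h" and rh: "r = (\<integral>p. h p \<partial>count_space (J \<times> J))"
    by (rule psum_SomeD[OF r[unfolded vector_mutual_energy_def]], rule that)
  show fin: "shifted_energy (l j) (l k) < \<infinity>" if jk: "j \<in> J" "k \<in> J" for j k
  proof (rule ccontr)
    assume "\<not> ?thesis"
    then have "mutual_energy \<kappa> (l j) (l k) = \<infinity>" by (intro mutual_energy_infinite l_radon jk)
    then show False using h[of "(j, k)"] jk sg_cases[of j] sg_cases[of k] by (auto simp: sign_eq)
  qed
  have eq: "h p = (\<lambda>(j, k). sg j * sg k * energy (l j) (l k)) p" if p: "p \<in> J \<times> J" for p
  proof -
    obtain j k where jk: "p = (j, k)" "j \<in> J" "k \<in> J" using p by blast
    have "mutual_energy \<kappa> (l j) (l k) = ereal (energy (l j) (l k))"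
      using jk l_radon fin by (intro mutual_energy_finite)
    then show ?thesis using h[OF p] by (simp add: jk sign_eq)
  qed
  show "integrable (count_space (J \<times> J)) (\<lambda>(j, k). sg j * sg k * energy (l j) (l k))"
    using int by (rule Bochner_Integration.integrable_cong[THEN iffD1, rotated 2]) (simp_all add: eq)
  have "r = (\<integral>(j, k). sg j * sg k * energy (l j) (l k) \<partial>count_space (J \<times> J))"
    unfolding rh by (rule Bochner_Integration.integral_cong) (simp_all add: eq)
  with r show "vector_mutual_energy \<kappa> Ipos Ineg l l =
      Some (ereal (\<integral>(j, k). sg j * sg k * energy (l j) (l k) \<partial>count_space (J \<times> J)))" by simp
qed

text \<open>With the extension by zero, sums over \<^term>\<open>J\<close> of nonnegative terms become series over all natural numbers.\<close>

definition ext :: "nat \<Rightarrow> 'a measure" where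
  "ext j = (if j \<in> J then l j else null_measure borel)"

definition total_pot :: "'a \<Rightarrow> ennreal" where
  "total_pot x = (\<Sum>j. pot (ext j) x)"

lemma ext_radon: "radon (ext j)"
  by (simp add: ext_def l_radon radon_null_measure)

lemma shifted_energy_null [simp]:
  "shifted_energy (null_measure borel) \<mu> = 0" "shifted_energy \<mu> (null_measure borel) = 0"
  by (simp_all add: shifted_energy_def pot_def)

text \<open>If the whole space is compact then it meets only finitely many of the nonempty sets \<open>A j\<close>.\<close>

lemma finite_J: "c \<noteq> 0 \<Longrightarrow> finite J"
proof -
  assume "c \<noteq> 0"
  then have "compact (UNIV :: 'a set)" using c_zero_or_compact by simp
  moreover have "\<forall>K. compact K \<longrightarrow> finite {j \<in> J. K \<inter> A j \<noteq> {}}"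
    using condenser unfolding condenser_def by (elim conjE)
  ultimately have "finite {j \<in> J. UNIV \<inter> A j \<noteq> {}}" by (elim allE impE)
  moreover have "{j \<in> J. UNIV \<inter> A j \<noteq> {}} = J" using condenser by (auto simp: condenser_def)
  ultimately show ?thesis by metis
qed

lemma total_mass_finite: "(\<Sum>j. ennreal c * emeasure (ext j) UNIV) < \<infinity>"
proof (cases "c = 0")
  case False
  have "(\<Sum>j. ennreal c * emeasure (ext j) UNIV) = (\<Sum>j\<in>J. ennreal c * emeasure (ext j) UNIV)"
    by (rule suminf_finite[OF finite_J[OF False]]) (simp add: ext_def)
  also have "\<dots> < \<infinity>"
    using finite_J[OF False] c_zero_or_finite[OF ext_radon] False
    by (simp add: ennreal_mult_less_top less_top)
  finally show ?thesis .
qed simp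

text \<open>
  For \<open>c \<noteq> 0\<close> the index set is finite. For \<open>c = 0\<close> the mutual energies are nonnegative, and the finiteness of the
  vector energy means that they are summable regardless of signs.
\<close>

lemma total_energy_finite: "(\<Sum>j. \<Sum>k. shifted_energy (ext j) (ext k)) < \<infinity>"
proof (cases "c = 0")
  case False
  note fJ = finite_J[OF False]
  have "(\<Sum>j. \<Sum>k. shifted_energy (ext j) (ext k)) = (\<Sum>j\<in>J. \<Sum>k. shifted_energy (ext j) (ext k))"
    by (rule suminf_finite[OF fJ]) (simp add: ext_def)
  also have "\<dots> = (\<Sum>j\<in>J. \<Sum>k\<in>J. shifted_energy (ext j) (ext k))"
    by (rule sum.cong[OF refl], rule suminf_finite[OF fJ]) (simp add: ext_def)
  also have "\<dots> < \<infinity>"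
    using fJ l_energy_finite by (simp add: ext_def)
  finally show ?thesis .
next
  case True
  then have z: "c * x = 0" for x by simp
  have en: "energy \<mu> \<nu> = enn2real (shifted_energy \<mu> \<nu>)" for \<mu> \<nu>
    unfolding energy_def z by simp
  let ?h = "\<lambda>(j, k). sg j * sg k * energy (l j) (l k)"
  have "(\<Sum>j. \<Sum>k. shifted_energy (ext j) (ext k))
      = (\<integral>\<^sup>+j. \<integral>\<^sup>+k. shifted_energy (ext j) (ext k) \<partial>count_space UNIV \<partial>count_space UNIV)"
    by (simp add: nn_integral_count_space_nat)
  also have "\<dots> = (\<integral>\<^sup>+p. shifted_energy (ext (fst p)) (ext (snd p)) \<partial>count_space UNIV)"
    using nn_integral_fst_count_space[of "\<lambda>p. shifted_energy (ext (fst p)) (ext (snd p))"] by simp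
  also have "\<dots> \<le> (\<integral>\<^sup>+p. ennreal (norm (?h p)) * indicator (J \<times> J) p \<partial>count_space UNIV)"
  proof (intro nn_integral_mono)
    fix p :: "nat \<times> nat"
    show "shifted_energy (ext (fst p)) (ext (snd p)) \<le> ennreal (norm (?h p)) * indicator (J \<times> J) p"
    proof (cases "p \<in> J \<times> J")
      case p: True
      then obtain j k where jk: "p = (j, k)" "j \<in> J" "k \<in> J" by blast
      have "norm (?h p) = enn2real (shifted_energy (l j) (l k))"
        by (simp add: jk abs_mult sg_abs en)
      then show ?thesis
        using l_energy_finite[OF jk(2,3)] p by (simp add: jk ext_def less_top)
    next
      case False
      then have "fst p \<notin> J \<or> snd p \<notin> J" by (simp add: mem_Times_iff)
      then show ?thesis by (auto simp: ext_def)
    qed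
  qed
  also have "\<dots> = (\<integral>\<^sup>+p. ennreal (norm (?h p)) \<partial>count_space (J \<times> J))"
    by (rule nn_integral_count_space_indicator[symmetric]) simp
  also have "\<dots> < \<infinity>" using l_energy_integrable by (simp add: integrable_iff_bounded)
  finally show ?thesis .
qed

lemma total_pot_borel: "total_pot \<in> borel_measurable borel"
  unfolding total_pot_def using pot_borel[OF ext_radon] by measurable

lemma nn_integral_total_pot:
  assumes "radon \<rho>"
  shows "(\<integral>\<^sup>+x. total_pot x \<partial>\<rho>) = (\<Sum>j. shifted_energy \<rho> (ext j))"
  unfolding total_pot_def shifted_energy_def
  by (rule nn_integral_suminf) (intro pot_measurable ext_radon radonD(1)[OF assms])

lemma pot_le_total: "pot (ext j) x \<le> total_pot x"
  unfolding total_pot_def using sum_le_suminf[of "\<lambda>j. pot (ext j) x" "{j}"] by simp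

lemma shifted_energy_le_total: "radon \<rho> \<Longrightarrow> shifted_energy \<rho> (ext j) \<le> (\<integral>\<^sup>+x. total_pot x \<partial>\<rho>)"
  unfolding shifted_energy_def by (intro nn_integral_mono pot_le_total)

lemma total_pot_l_integrable: "j \<in> J \<Longrightarrow> (\<integral>\<^sup>+x. total_pot x \<partial>l j) < \<infinity>"
proof -
  assume j: "j \<in> J"
  have "(\<Sum>k. shifted_energy (ext j) (ext k)) \<le> (\<Sum>j. \<Sum>k. shifted_energy (ext j) (ext k))"
    using sum_le_suminf[of "\<lambda>j. \<Sum>k. shifted_energy (ext j) (ext k)" "{j}"] by simp
  also have "\<dots> < \<infinity>" by (rule total_energy_finite)
  finally show ?thesis using j nn_integral_total_pot[OF l_radon[OF j]] by (simp add: ext_def)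
qed

text \<open>The \<open>j\<close>-th term of the \<open>i\<close>-th component of the vector potential of \<open>l\<close>, where it is finite.\<close>

definition component :: "nat \<Rightarrow> 'a \<Rightarrow> real" where
  "component j x = (if j \<in> J then sg i * sg j * (enn2real (pot (l j) x) - c * measure (l j) UNIV) else 0)"

lemma component_bound: "ennreal \<bar>component j x\<bar> \<le> pot (ext j) x + ennreal c * emeasure (ext j) UNIV"
proof (cases "j \<in> J")
  case True
  have "\<bar>component j x\<bar> \<le> enn2real (pot (l j) x) + c * measure (l j) UNIV"
    using True c_nonneg by (simp add: component_def abs_mult sg_abs abs_le_iff)
  then have "ennreal \<bar>component j x\<bar> \<le> ennreal (enn2real (pot (l j) x)) + ennreal (c * measure (l j) UNIV)"
    using c_nonneg by (simp add: ennreal_plus[symmetric] ennreal_leI del: ennreal_plus)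
  also have "ennreal (c * measure (l j) UNIV) = ennreal c * emeasure (l j) UNIV"
    using c_zero_or_finite[OF l_radon[OF True]] c_nonneg
    by (auto simp: emeasure_eq_ennreal_measure ennreal_mult less_top)
  also have "ennreal (enn2real (pot (l j) x)) + ennreal c * emeasure (l j) UNIV
      \<le> pot (l j) x + ennreal c * emeasure (l j) UNIV"
    by (intro add_right_mono) (cases "pot (l j) x"; simp)
  finally show ?thesis using True by (simp add: ext_def)
qed (simp add: component_def)

lemma suminf_component_bound:
  "(\<Sum>j. pot (ext j) x + ennreal c * emeasure (ext j) UNIV)
    = total_pot x + (\<Sum>j. ennreal c * emeasure (ext j) UNIV)"
  unfolding total_pot_def by (rule suminf_add[symmetric]) auto

lemma summable_component:
  assumes "total_pot x < \<infinity>"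
  shows "summable (\<lambda>j. norm (component j x))"
proof (rule summable_suminf_not_top)
  have "(\<Sum>j. ennreal (norm (component j x))) \<le> (\<Sum>j. pot (ext j) x + ennreal c * emeasure (ext j) UNIV)"
    by (intro suminf_le) (simp_all add: component_bound)
  also have "\<dots> < \<infinity>" unfolding suminf_component_bound using assms total_mass_finite by simp
  finally show "(\<Sum>j. ennreal (norm (component j x))) \<noteq> top" by simp
qed simp

lemma vector_potential_eq:
  assumes "total_pot x < \<infinity>"
  shows "vector_potential \<kappa> Ipos Ineg l i x = Some (ereal (\<Sum>j. component j x))"
proof -
  let ?h = "\<lambda>j. sg i * sg j * (enn2real (pot (l j) x) - c * measure (l j) UNIV)"
  have c: "component j x = (if j \<in> J then ?h j else 0)" for j by (simp add: component_def)
  have int: "integrable (count_space UNIV) (\<lambda>j. component j x)"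
    using summable_component[OF assms] by (simp add: integrable_count_space_nat_iff)
  have "psum J (\<lambda>j. Some (sign Ipos i * sign Ipos j * potential \<kappa> (l j) x)) = Some (ereal (\<integral>j. ?h j \<partial>count_space J))"
  proof (rule psum_SomeI)
    fix j assume j: "j \<in> J"
    have "pot (l j) x < \<infinity>" using pot_le_total[of j x] assms j by (simp add: ext_def order_le_less_trans)
    then show "Some (sign Ipos i * sign Ipos j * potential \<kappa> (l j) x) = Some (ereal (?h j))"
      unfolding potential_eq[OF l_radon[OF j]] by (cases "pot (l j) x") (auto simp: sign_eq)
  next
    show "integrable (count_space J) ?h"
      using int unfolding c by (subst (asm) integrable_count_space_extend) auto
  qed
  also have "(\<integral>j. ?h j \<partial>count_space J) = (\<integral>j. component j x \<partial>count_space UNIV)"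
    unfolding c by (rule integral_count_space_extend[symmetric]) simp
  also have "\<dots> = (\<Sum>j. component j x)" by (rule integral_count_space_nat[OF int])
  finally show ?thesis by (simp add: vector_potential_def)
qed

text \<open>The integral of the \<open>i\<close>-th component of the vector potential of \<open>l\<close> with respect to \<open>\<rho>\<close>.\<close>

definition mutual_sum :: "'a measure \<Rightarrow> real" where
  "mutual_sum \<rho> = (\<integral>j. sg i * sg j * energy \<rho> (l j) \<partial>count_space J)"

lemma
  assumes \<rho>: "radon \<rho>" and fin: "(\<integral>\<^sup>+x. total_pot x \<partial>\<rho>) < \<infinity>"
  shows integrable_component_sum: "integrable \<rho> (\<lambda>x. \<Sum>j. component j x)"
    and integral_component_sum: "(\<integral>x. (\<Sum>j. component j x) \<partial>\<rho>) = mutual_sum \<rho>"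
    and integrable_mutual_sum: "integrable (count_space J) (\<lambda>j. sg i * sg j * energy \<rho> (l j))"
    and total_pot_finite_AE: "AE x in \<rho>. total_pot x < \<infinity>"
proof -
  note s\<rho> = radonD(1)[OF \<rho>]
  let ?D = "\<Sum>j. ennreal c * emeasure (ext j) UNIV"
  have pm: "pot (ext j) \<in> borel_measurable \<rho>" for j by (rule pot_measurable[OF ext_radon s\<rho>])
  have tm: "total_pot \<in> borel_measurable \<rho>" using total_pot_borel s\<rho> by (simp cong: measurable_cong_sets)
  have pl: "pot (l j) \<in> borel_measurable \<rho>" if "j \<in> J" for j using pm[of j] that by (simp add: ext_def)
  have cm: "component j \<in> borel_measurable \<rho>" for j
    unfolding component_def using pl[of j] by (cases "j \<in> J") simp_all
  show ae: "AE x in \<rho>. total_pot x < \<infinity>"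
    using nn_integral_noteq_infinite[OF tm] fin by (simp add: less_top)
  have mass: "?D * emeasure \<rho> UNIV < \<infinity>"
  proof (cases "c = 0")
    case False
    then show ?thesis using c_zero_or_finite[OF \<rho>] total_mass_finite by (simp add: ennreal_mult_less_top)
  qed simp
  have "(\<Sum>j. \<integral>\<^sup>+x. pot (ext j) x + ennreal c * emeasure (ext j) UNIV \<partial>\<rho>)
      = (\<integral>\<^sup>+x. total_pot x + ?D \<partial>\<rho>)"
    unfolding suminf_component_bound[symmetric] using pm by (intro nn_integral_suminf[symmetric]) simp
  also have "\<dots> = (\<integral>\<^sup>+x. total_pot x \<partial>\<rho>) + ?D * emeasure \<rho> UNIV"
    using tm by (subst nn_integral_add) (simp_all add: radonD(2)[OF \<rho>])
  finally have tot: "(\<Sum>j. \<integral>\<^sup>+x. pot (ext j) x + ennreal c * emeasure (ext j) UNIV \<partial>\<rho>) < \<infinity>"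
    using fin mass by simp
  have le: "(\<integral>\<^sup>+x. ennreal (norm (component j x)) \<partial>\<rho>)
      \<le> (\<integral>\<^sup>+x. pot (ext j) x + ennreal c * emeasure (ext j) UNIV \<partial>\<rho>)" for j
    using component_bound by (intro nn_integral_mono) simp
  have sum_fin: "(\<Sum>j. \<integral>\<^sup>+x. ennreal (norm (component j x)) \<partial>\<rho>) < \<infinity>"
    by (rule order_le_less_trans[OF suminf_le[OF le] tot]) auto
  have int: "integrable \<rho> (component j)" for j
    unfolding integrable_iff_bounded
  proof (intro conjI cm)
    have "(\<integral>\<^sup>+x. ennreal (norm (component j x)) \<partial>\<rho>) \<le> (\<Sum>j. \<integral>\<^sup>+x. ennreal (norm (component j x)) \<partial>\<rho>)"
      using sum_le_suminf[of "\<lambda>j. \<integral>\<^sup>+x. ennreal (norm (component j x)) \<partial>\<rho>" "{j}"] by simp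
    then show "(\<integral>\<^sup>+x. ennreal (norm (component j x)) \<partial>\<rho>) < \<infinity>"
      using sum_fin by (rule order_le_less_trans)
  qed
  have sumI: "summable (\<lambda>j. \<integral>x. norm (component j x) \<partial>\<rho>)"
  proof (rule summable_suminf_not_top)
    have "ennreal (\<integral>x. norm (component j x) \<partial>\<rho>) = (\<integral>\<^sup>+x. ennreal (norm (component j x)) \<partial>\<rho>)" for j
      by (rule nn_integral_eq_integral[OF integrable_norm[OF int], symmetric]) simp
    then show "(\<Sum>j. ennreal (\<integral>x. norm (component j x) \<partial>\<rho>)) \<noteq> top"
      using sum_fin by simp
  qed simp
  have ae2: "AE x in \<rho>. summable (\<lambda>j. norm (component j x))"
    using ae by eventually_elim (rule summable_component)
  show "integrable \<rho> (\<lambda>x. \<Sum>j. component j x)"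
    by (rule integrable_suminf[OF int ae2 sumI])
  have comp: "(\<integral>x. component j x \<partial>\<rho>) = (if j \<in> J then sg i * sg j * energy \<rho> (l j) else 0)" for j
  proof (cases "j \<in> J")
    case True
    have q: "shifted_energy \<rho> (l j) < \<infinity>"
      using shifted_energy_le_total[OF \<rho>, of j] fin True by (simp add: ext_def order_le_less_trans)
    have aeq: "AE x in \<rho>. pot (l j) x \<noteq> \<infinity>"
      using q pl[OF True] unfolding shifted_energy_def by (intro nn_integral_noteq_infinite) auto
    have nn: "(\<integral>\<^sup>+x. ennreal (enn2real (pot (l j) x)) \<partial>\<rho>) = shifted_energy \<rho> (l j)"
      unfolding shifted_energy_def
    proof (rule nn_integral_cong_AE)
      show "AE x in \<rho>. ennreal (enn2real (pot (l j) x)) = pot (l j) x"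
        using aeq by eventually_elim (simp add: less_top)
    qed
    have ip: "integrable \<rho> (\<lambda>x. enn2real (pot (l j) x))"
      using q pl[OF True] by (intro integrableI_nonneg) (simp_all add: nn)
    have vp: "(\<integral>x. enn2real (pot (l j) x) \<partial>\<rho>) = enn2real (shifted_energy \<rho> (l j))"
      using pl[OF True] by (subst integral_eq_nn_integral) (simp_all add: nn)
    have ic: "integrable \<rho> (\<lambda>x. c * measure (l j) UNIV)"
    proof (cases "c = 0")
      case False
      then have "emeasure \<rho> (space \<rho>) < \<infinity>"
        using c_zero_or_finite[OF \<rho>] by (simp add: radonD(2)[OF \<rho>])
      then show ?thesis by (intro finite_measure.integrable_const finite_measureI) simp
    qed simp
    have "(\<integral>x. component j x \<partial>\<rho>) = sg i * sg j * (enn2real (shifted_energy \<rho> (l j)) - c * measure (l j) UNIV * measure \<rho> UNIV)"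
      using True ip ic vp by (simp add: component_def radonD(2)[OF \<rho>])
    then show ?thesis using True by (simp add: energy_def mult_ac)
  qed (simp add: component_def)
  have "summable (\<lambda>j. norm (\<integral>x. component j x \<partial>\<rho>))"
    by (rule summable_comparison_test'[OF sumI, of 0]) (simp add: integral_norm_bound[of \<rho>, simplified])
  then have int2: "integrable (count_space UNIV) (\<lambda>j. \<integral>x. component j x \<partial>\<rho>)"
    by (simp add: integrable_count_space_nat_iff)
  show "integrable (count_space J) (\<lambda>j. sg i * sg j * energy \<rho> (l j))"
    using int2 unfolding comp by (subst (asm) integrable_count_space_extend) auto
  have "(\<integral>x. (\<Sum>j. component j x) \<partial>\<rho>) = (\<Sum>j. \<integral>x. component j x \<partial>\<rho>)"
    by (rule integral_suminf[OF int ae2 sumI])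
  also have "\<dots> = (\<integral>j. (\<integral>x. component j x \<partial>\<rho>) \<partial>count_space UNIV)"
    by (rule integral_count_space_nat[OF int2, symmetric])
  also have "\<dots> = mutual_sum \<rho>"
    unfolding comp mutual_sum_def by (rule integral_count_space_extend) simp
  finally show "(\<integral>x. (\<Sum>j. component j x) \<partial>\<rho>) = mutual_sum \<rho>" .
qed

abbreviation W :: "'a \<rightharpoonup> ereal" where
  "W \<equiv> weighted_potential \<kappa> Ipos Ineg f l i"

lemma field_parts:
  obtains f1 f2 where "f1 \<in> Phi" "f2 \<in> Phi" "nearly_everywhere \<kappa> UNIV (\<lambda>x. f2 x \<noteq> \<infinity>)"
    "\<And>x. f i x = pdiff (f1 x) (f2 x)"
  using bspec[OF field[unfolded external_field_def] i] that by metis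

lemma W_borel: "totalize W \<in> borel_measurable borel"
proof -
  obtain f1 f2 where f12: "f1 \<in> Phi" "f2 \<in> Phi" "\<And>x. f i x = pdiff (f1 x) (f2 x)"
    using field_parts by metis
  have [measurable]: "f1 \<in> borel_measurable borel" "f2 \<in> borel_measurable borel"
    using f12 by (simp_all add: Phi_lower_semicontinuous lower_semicontinuous_borel)
  define u where "u j x = sign Ipos i * sign Ipos j * potential \<kappa> (l j) x" for j x
  have u: "u j \<in> borel_measurable borel" if "j \<in> J" for j
  proof -
    have [measurable]: "pot (l j) \<in> borel_measurable borel" by (rule pot_borel[OF l_radon[OF that]])
    show ?thesis unfolding u_def potential_eq[OF l_radon[OF that]] by measurable
  qed
  have pm: "(\<lambda>x. \<integral>\<^sup>+j. e2ennreal (s * u j x) \<partial>count_space J) \<in> borel_measurable borel" for s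
  proof -
    have [measurable]: "(\<lambda>x. e2ennreal (s * u j x) * indicator J j) \<in> borel_measurable borel" for j
      using u[of j] by (cases "j \<in> J") simp_all
    have "(\<integral>\<^sup>+j. e2ennreal (s * u j x) \<partial>count_space J) = (\<Sum>j. e2ennreal (s * u j x) * indicator J j)" for x
      by (subst nn_integral_count_space_indicator) (simp_all add: nn_integral_count_space_nat)
    then show ?thesis by simp
  qed
  have "W x = padd (pdiff (enn2ereal (\<integral>\<^sup>+j. e2ennreal (1 * u j x) \<partial>count_space J))
      (enn2ereal (\<integral>\<^sup>+j. e2ennreal (- 1 * u j x) \<partial>count_space J))) (pdiff (f1 x) (f2 x))" for x
    unfolding weighted_potential_def vector_potential_def f12(3) psum_def pint_def Let_def u_def[symmetric] by simp
  then show ?thesis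
    using borel_measurable_padd_pdiff[of
        "\<lambda>x. enn2ereal (\<integral>\<^sup>+j. e2ennreal (1 * u j x) \<partial>count_space J)" borel
        "\<lambda>x. enn2ereal (\<integral>\<^sup>+j. e2ennreal (- 1 * u j x) \<partial>count_space J)" f1 f2]
      measurable_compose[OF pm measurable_enn2ereal] \<open>f1 \<in> borel_measurable borel\<close> \<open>f2 \<in> borel_measurable borel\<close>
    by (simp only:)
qed

text \<open>
  Dominated by the potential of the total mass, the series for the vector potential may be integrated term by term.
\<close>

lemma pint_W:
  assumes \<rho>: "radon \<rho>" and fin: "(\<integral>\<^sup>+x. total_pot x \<partial>\<rho>) < \<infinity>" and \<phi>: "pint \<rho> (f i) = Some (ereal \<phi>)"
  shows "pint \<rho> W = Some (ereal (mutual_sum \<rho> + \<phi>))"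
proof -
  define h where "h = (\<lambda>x. real_of_ereal (totalize (f i) x))"
  have h: "AE x in \<rho>. f i x = Some (ereal (h x))" "integrable \<rho> h" "\<phi> = integral\<^sup>L \<rho> h"
    unfolding h_def by (rule pint_SomeD(2-4)[OF \<phi>])+
  have "pint \<rho> W = Some (ereal (\<integral>x. (\<Sum>j. component j x) + h x \<partial>\<rho>))"
  proof (rule pint_SomeI)
    show "totalize W \<in> borel_measurable \<rho>"
      using W_borel radonD(1)[OF \<rho>] by (simp cong: measurable_cong_sets)
    show "AE x in \<rho>. W x = Some (ereal ((\<Sum>j. component j x) + h x))"
      using total_pot_finite_AE[OF \<rho> fin] h(1)
      by eventually_elim (simp add: weighted_potential_def vector_potential_eq)
    show "integrable \<rho> (\<lambda>x. (\<Sum>j. component j x) + h x)"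
      using integrable_component_sum[OF \<rho> fin] h(2) by simp
  qed
  then show ?thesis
    using integrable_component_sum[OF \<rho> fin] h(2) integral_component_sum[OF \<rho> fin] by (simp add: h(3))
qed

end

section \<open>The first variation\<close>

context equilibrium_problem
begin

text \<open>
  Replacing the component \<open>l i\<close> by \<open>(1 - t) l i + t \<tau>\<close> changes the matrix of mutual energies in row \<open>i\<close> and
  column \<open>i\<close>, each by \<open>t\<close> times the same differences, and by a multiple of \<open>t\<^sup>2\<close> at their
  intersection. Hence the weighted energy is quadratic in \<open>t\<close>, and its derivative at \<open>0\<close> cannot be negative.
\<close>

lemma first_variation:
  assumes \<tau>: "\<tau> \<in> radon_on (A i)"
    and \<tau>_energy: "shifted_energy \<tau> \<tau> < \<infinity>" and \<tau>_pot: "(\<integral>\<^sup>+x. total_pot x \<partial>\<tau>) < \<infinity>"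
    and \<tau>_g: "pint \<tau> ((\<lambda>x. Some (ereal (g i x))) |` A i) = Some (ereal (a i))"
    and \<tau>_f: "pint \<tau> (f i) = Some (ereal \<phi>)"
    and l_f: "pint (l i) (f i) = Some (ereal \<psi>)"
  shows "mutual_sum (l i) + \<psi> \<le> mutual_sum \<tau> + \<phi>"
proof -
  let ?S = "count_space (J \<times> J)"
  have r\<tau>: "radon \<tau>" using \<tau> by (simp add: radon_on_def)
  note li = l_radon[OF i]
  have q\<tau>: "shifted_energy \<tau> (l k) < \<infinity>" if "k \<in> J" for k
    using shifted_energy_le_total[OF r\<tau>, of k] \<tau>_pot that by (simp add: ext_def order_le_less_trans)
  define \<delta> where "\<delta> k = energy \<tau> (l k) - energy (l i) (l k)" for k
  define q where "q = energy \<tau> \<tau> - 2 * energy \<tau> (l i) + energy (l i) (l i)"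
  define E where "E = (\<integral>(j, k). sg j * sg k * energy (l j) (l k) \<partial>?S)"
  have lE: "vector_mutual_energy \<kappa> Ipos Ineg l l = Some (ereal E)"
    unfolding E_def by (rule l_vector_energy)
  define D where "D = mutual_sum \<tau> - mutual_sum (l i)"
  note int\<tau> = integrable_mutual_sum[OF r\<tau> \<tau>_pot]
  note intl = integrable_mutual_sum[OF li total_pot_l_integrable[OF i]]
  have int\<delta>: "integrable (count_space J) (\<lambda>k. sg i * sg k * \<delta> k)"
    using Bochner_Integration.integrable_diff[OF int\<tau> intl] by (simp add: \<delta>_def algebra_simps)
  have D: "(\<integral>k. sg i * sg k * \<delta> k \<partial>count_space J) = D"
    using Bochner_Integration.integral_diff[OF int\<tau> intl] by (simp add: \<delta>_def D_def mutual_sum_def algebra_simps)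
  obtain h where h: "\<And>j. j \<in> J \<Longrightarrow> pint (l j) (f j) = Some (ereal (h j))" "integrable (count_space J) h"
    by (rule l_field, rule that)
  have hi: "h i = \<psi>" using h(1)[OF i] l_f by simp
  have fl: "field_integral Ipos Ineg f l = Some (ereal (\<integral>j. h j \<partial>count_space J))"
    unfolding field_integral_def by (rule psum_SomeI[OF h])
  have quad: "0 \<le> 2 * t * (D + (\<phi> - \<psi>)) + t\<^sup>2 * q" if t: "0 < t" "t < 1" for t
  proof -
    define \<rho> where "\<rho> = combination (1 - t) (l i) t \<tau>"
    define \<mu> where "\<mu> = l(i := \<rho>)"
    have \<rho>: "radon \<rho>" unfolding \<rho>_def using t by (intro radon_combination li r\<tau>) auto
    have r\<mu>: "radon (\<mu> j)" if "j \<in> J" for j using that l_radon \<rho> by (simp add: \<mu>_def)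
    have sl: "sets (l i) = sets borel" "sets \<tau> = sets borel" using radonD(1) li r\<tau> by auto
    have \<rho>_left: "shifted_energy \<rho> \<sigma> < \<infinity>" "energy \<rho> \<sigma> = (1 - t) * energy (l i) \<sigma> + t * energy \<tau> \<sigma>"
      if "radon \<sigma>" "shifted_energy (l i) \<sigma> < \<infinity>" "shifted_energy \<tau> \<sigma> < \<infinity>" for \<sigma>
    proof -
      show "shifted_energy \<rho> \<sigma> < \<infinity>"
        unfolding \<rho>_def shifted_energy_combination[OF li r\<tau> that(1)]
        using that by (simp add: ennreal_mult_less_top)
      show "energy \<rho> \<sigma> = (1 - t) * energy (l i) \<sigma> + t * energy \<tau> \<sigma>"
        unfolding \<rho>_def using t by (intro energy_combination li r\<tau> that) auto
    qed
    have row: "shifted_energy \<rho> (l k) < \<infinity>" "energy \<rho> (l k) = energy (l i) (l k) + t * \<delta> k" if "k \<in> J" for k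
      using \<rho>_left[OF l_radon[OF that] l_energy_finite[OF i that] q\<tau>[OF that]]
      by (simp_all add: \<delta>_def algebra_simps)
    have column: "shifted_energy (l k) \<rho> < \<infinity>" "energy (l k) \<rho> = energy (l k) (l i) + t * \<delta> k" if "k \<in> J" for k
      using row[OF that] by (simp_all add: shifted_energy_commute[OF l_radon[OF that] \<rho>]
        energy_commute[OF l_radon[OF that] \<rho>] energy_commute[OF l_radon[OF that] li])
    have \<tau>\<rho>: "shifted_energy \<tau> \<rho> < \<infinity>" "energy \<tau> \<rho> = (1 - t) * energy \<tau> (l i) + t * energy \<tau> \<tau>"
      using \<rho>_left[OF r\<tau> _ \<tau>_energy] q\<tau>[OF i]
      by (simp_all add: shifted_energy_commute[OF r\<tau> \<rho>] energy_commute[OF r\<tau> \<rho>]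
        shifted_energy_commute[OF li r\<tau>] energy_commute[OF li r\<tau>])
    have corner: "shifted_energy \<rho> \<rho> < \<infinity>" "energy \<rho> \<rho> = energy (l i) (l i) + 2 * t * \<delta> i + t\<^sup>2 * q"
    proof -
      note c = \<rho>_left[OF \<rho> column(1)[OF i] \<tau>\<rho>(1)]
      show "shifted_energy \<rho> \<rho> < \<infinity>" by (rule c(1))
      show "energy \<rho> \<rho> = energy (l i) (l i) + 2 * t * \<delta> i + t\<^sup>2 * q"
        unfolding c(2) column(2)[OF i] \<tau>\<rho>(2) \<delta>_def q_def by (simp add: power2_eq_square algebra_simps)
    qed
    have fin\<mu>: "shifted_energy (\<mu> j) (\<mu> k) < \<infinity>" if "j \<in> J" "k \<in> J" for j k
      using that row(1) column(1) corner(1) l_energy_finite by (cases "j = i"; cases "k = i") (simp_all add: \<mu>_def)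
    \<comment> \<open>The old energy matrix, the row and the column of differences, and the corner.\<close>
    define H where "H = (\<lambda>(j, k). sg j * sg k * energy (l j) (l k))"
    define R where "R p = (if p \<in> {i} \<times> J then sg i * sg (snd p) * \<delta> (snd p) else 0)" for p
    define R' where "R' p = (if p \<in> J \<times> {i} then sg i * sg (fst p) * \<delta> (fst p) else 0)" for p
    define Q where "Q = (\<lambda>p. if p \<in> {(i, i)} then q else 0)"
    have b: "bij_betw (\<lambda>k. (i, k)) J ({i} \<times> J)" "bij_betw (\<lambda>k. (k, i)) J (J \<times> {i})"
      by (auto simp: bij_betw_def inj_on_def)
    have sub: "{i} \<times> J \<subseteq> J \<times> J" "J \<times> {i} \<subseteq> J \<times> J" using i by auto
    have iR: "integrable ?S R" "(\<integral>p. R p \<partial>?S) = D"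
      unfolding R_def D[symmetric]
      by (rule integrable_count_space_embed[OF b(1) sub(1) snd_conv int\<delta>]
        integral_count_space_embed[OF b(1) sub(1) snd_conv int\<delta>])+
    have iR': "integrable ?S R'" "(\<integral>p. R' p \<partial>?S) = D"
      unfolding R'_def D[symmetric]
      by (rule integrable_count_space_embed[OF b(2) sub(2) fst_conv int\<delta>]
        integral_count_space_embed[OF b(2) sub(2) fst_conv int\<delta>])+
    have s: "{(i, i)} \<subseteq> J \<times> J" using i by auto
    have iQ: "integrable ?S Q" "(\<integral>p. Q p \<partial>?S) = q"
      unfolding Q_def integrable_count_space_extend[OF s] integral_count_space_extend[OF s]
      by (simp_all add: lebesgue_integral_count_space_finite integrable_count_space)
    have iH: "integrable ?S H" "(\<integral>p. H p \<partial>?S) = E"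
      unfolding H_def E_def using l_energy_integrable by simp_all
    have eq: "(case p of (j, k) \<Rightarrow> sg j * sg k * energy (\<mu> j) (\<mu> k)) = H p + t * R p + t * R' p + t\<^sup>2 * Q p"
      if p: "p \<in> J \<times> J" for p
    proof -
      obtain j k where jk: "p = (j, k)" "j \<in> J" "k \<in> J" using p by blast
      have "R p = (if j = i then sg i * sg k * \<delta> k else 0)" "R' p = (if k = i then sg i * sg j * \<delta> j else 0)"
        using jk by (auto simp: R_def R'_def)
      then show ?thesis
        using row(2)[OF jk(3)] column(2)[OF jk(2)] corner(2) sg_square[of i]
        unfolding jk(1) H_def Q_def \<mu>_def
        by (cases "j = i"; cases "k = i") (simp_all add: algebra_simps)
    qed
    have int\<mu>: "integrable ?S (\<lambda>(j, k). sg j * sg k * energy (\<mu> j) (\<mu> k))"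
      by (subst Bochner_Integration.integrable_cong[OF refl eq])
        (auto intro!: Bochner_Integration.integrable_add integrable_mult_right iH iR iR' iQ)
    have val\<mu>: "(\<integral>(j, k). sg j * sg k * energy (\<mu> j) (\<mu> k) \<partial>?S) = E + 2 * t * D + t\<^sup>2 * q"
    proof -
      have "(\<integral>(j, k). sg j * sg k * energy (\<mu> j) (\<mu> k) \<partial>?S)
          = (\<integral>p. H p + t * R p + t * R' p + t\<^sup>2 * Q p \<partial>?S)"
        by (rule Bochner_Integration.integral_cong[OF refl]) (simp add: eq)
      also have "\<dots> = E + 2 * t * D + t\<^sup>2 * q"
        using iH iR iR' iQ by simp
      finally show ?thesis .
    qed
    have e\<mu>: "vector_mutual_energy \<kappa> Ipos Ineg \<mu> \<mu> = Some (ereal (E + 2 * t * D + t\<^sup>2 * q))"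
      unfolding vector_mutual_energy_def val\<mu>[symmetric]
    proof (rule psum_SomeI[OF _ int\<mu>])
      fix p assume "p \<in> J \<times> J"
      then obtain j k where jk: "p = (j, k)" "j \<in> J" "k \<in> J" by blast
      then show "(case p of (j, k) \<Rightarrow> Some (sign Ipos j * sign Ipos k * mutual_energy \<kappa> (\<mu> j) (\<mu> k)))
          = Some (ereal (case p of (j, k) \<Rightarrow> sg j * sg k * energy (\<mu> j) (\<mu> k)))"
        by (simp add: mutual_energy_finite[OF r\<mu> r\<mu> fin\<mu>] sign_eq)
    qed
    have f\<mu>: "field_integral Ipos Ineg f \<mu> = Some (ereal ((\<integral>j. h j \<partial>count_space J) + t * (\<phi> - \<psi>)))"
    proof -
      let ?h = "\<lambda>j. h j + t * (if j \<in> {i} then \<phi> - \<psi> else 0)"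
      have s: "{i} \<subseteq> J" using i by simp
      have ii: "integrable (count_space J) (\<lambda>j. if j \<in> {i} then \<phi> - \<psi> else 0)"
        "(\<integral>j. (if j \<in> {i} then \<phi> - \<psi> else 0) \<partial>count_space J) = \<phi> - \<psi>"
        unfolding integrable_count_space_extend[OF s] integral_count_space_extend[OF s]
        by (simp_all add: lebesgue_integral_count_space_finite integrable_count_space)
      have "field_integral Ipos Ineg f \<mu> = Some (ereal (\<integral>j. ?h j \<partial>count_space J))"
        unfolding field_integral_def
      proof (rule psum_SomeI)
        fix j assume j: "j \<in> J"
        show "pint (\<mu> j) (f j) = Some (ereal (?h j))"
        proof (cases "j = i")
          case True
          have "pint \<rho> (f i) = Some (ereal ((1 - t) * \<psi> + t * \<phi>))"
            unfolding \<rho>_def using t by (intro pint_combination sl l_f \<tau>_f) auto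
          then show ?thesis using True by (simp add: \<mu>_def hi algebra_simps)
        qed (simp add: \<mu>_def h(1)[OF j])
      next
        show "integrable (count_space J) ?h"
          by (intro Bochner_Integration.integrable_add integrable_mult_right h(2) ii(1))
      qed
      also have "(\<integral>j. ?h j \<partial>count_space J) = (\<integral>j. h j \<partial>count_space J) + t * (\<phi> - \<psi>)"
        by (subst Bochner_Integration.integral_add[OF h(2) integrable_mult_right[OF ii(1)]])
          (simp only: integral_mult_right_zero ii(2))
      finally show ?thesis .
    qed
    have adm: "\<mu> \<in> admissible \<kappa> Ipos Ineg f A a g"
      unfolding admissible_def energy_vectors_def vector_measures_def mem_Collect_eq
    proof (intro conjI ballI)
      fix j assume j: "j \<in> J"
      show "\<mu> j \<in> radon_on (A j)"
      proof (cases "j = i")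
        case True
        have "emeasure (l i) (- A i) = 0" "emeasure \<tau> (- A i) = 0"
          using l_radon_on[OF i] \<tau> radon_on_closed_iff[OF closed_A[OF i]] by blast+
        then have "emeasure \<rho> (- A i) = 0"
          unfolding \<rho>_def using closed_A[OF i] by (subst emeasure_combination[OF sl]) auto
        then show ?thesis using True \<rho> radon_on_closed_iff[OF closed_A[OF i]] by (simp add: \<mu>_def)
      qed (simp add: \<mu>_def l_radon_on[OF j])
      have lg: "pint (l j) ((\<lambda>x. Some (ereal (g j x))) |` A j) = Some (ereal (a j))"
        using l_admissible j by (simp add: admissible_def)
      show "pint (\<mu> j) ((\<lambda>x. Some (ereal (g j x))) |` A j) = Some (ereal (a j))"
      proof (cases "j = i")
        case True
        have "pint \<rho> ((\<lambda>x. Some (ereal (g i x))) |` A i) = Some (ereal ((1 - t) * a i + t * a i))"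
          unfolding \<rho>_def using t lg True by (intro pint_combination sl \<tau>_g) auto
        then show ?thesis using True by (simp add: \<mu>_def algebra_simps)
      qed (simp add: \<mu>_def lg)
    qed (simp_all add: e\<mu> f\<mu> pfinite_def)
    have "weighted_energy \<kappa> Ipos Ineg f l \<le> weighted_energy \<kappa> Ipos Ineg f \<mu>"
      using equilibrium adm by (auto simp: equilibrium_def intro: INF_lower)
    then show ?thesis
      by (simp add: weighted_energy_def lE e\<mu> fl f\<mu> algebra_simps)
  qed
  \<comment> \<open>Divide by \<open>t\<close> and let \<open>t\<close> tend to \<open>0\<close>.\<close>
  have "0 \<le> D + (\<phi> - \<psi>)"
  proof (rule ccontr)
    assume neg: "\<not> ?thesis"
    have lim: "((\<lambda>t. 2 * (D + (\<phi> - \<psi>)) + t * q) \<longlongrightarrow> 2 * (D + (\<phi> - \<psi>)) + 0 * q) (at_right 0)"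
      by (intro tendsto_intros)
    have "eventually (\<lambda>t. 0 \<le> 2 * (D + (\<phi> - \<psi>)) + t * q) (at_right 0)"
      using eventually_at_right_less[of "0::real"] eventually_at_right_real[of 0 "1::real", simplified]
    proof eventually_elim
      case (elim t)
      then have "0 \<le> t * (2 * (D + (\<phi> - \<psi>)) + t * q)"
        using quad[of t] by (simp add: power2_eq_square algebra_simps)
      then show ?case using elim by (simp add: zero_le_mult_iff)
    qed
    then have "0 \<le> 2 * (D + (\<phi> - \<psi>)) + 0 * q"
      using lim by (intro tendsto_lowerbound[OF lim]) auto
    with neg show False by simp
  qed
  then show ?thesis by (simp add: D_def)
qed

text \<open>
  If the inequality failed on a set of positive capacity, a compact part of it of positive measure, on which the
  potentials and the two parts of the field are bounded, would carry a competitor \<open>\<tau>\<close> for the first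
  variation with \<open>\<langle>W, \<tau>\<rangle> < \<langle>W, l i\<rangle>\<close>.
\<close>

lemma weighted_potential_lower_bound:
  obtains w where "pint (l i) W = Some (ereal w)"
    "nearly_everywhere \<kappa> (A i) (\<lambda>x. \<exists>u. W x = Some u \<and> ereal (a i) * u \<ge> ereal w * ereal (g i x))"
proof -
  obtain h where "\<And>j. j \<in> J \<Longrightarrow> pint (l j) (f j) = Some (ereal (h j))"
    by (rule l_field, rule that)
  then have l_f: "pint (l i) (f i) = Some (ereal (h i))" using i by blast
  define w where "w = mutual_sum (l i) + h i"
  have W_l: "pint (l i) W = Some (ereal w)"
    unfolding w_def by (rule pint_W[OF l_radon[OF i] total_pot_l_integrable[OF i] l_f])
  define P where "P x \<longleftrightarrow> (\<exists>u. W x = Some u \<and> ereal (a i) * u \<ge> ereal w * ereal (g i x))" for x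
  obtain f1 f2 where f12: "f1 \<in> Phi" "f2 \<in> Phi" and f2_ne: "nearly_everywhere \<kappa> UNIV (\<lambda>x. f2 x \<noteq> \<infinity>)"
    and f_eq: "\<And>x. f i x = pdiff (f1 x) (f2 x)"
    using field_parts by metis
  have fb [measurable]: "f1 \<in> borel_measurable borel" "f2 \<in> borel_measurable borel"
    using f12 by (simp_all add: Phi_lower_semicontinuous lower_semicontinuous_borel)
  note [measurable] = total_pot_borel
  have "nearly_everywhere \<kappa> (A i) P"
  proof (rule nearly_everywhereI)
    fix \<nu> assume \<nu>: "radon \<nu>" "shifted_energy \<nu> \<nu> < \<infinity>" "emeasure \<nu> UNIV = 1" "compact (msupport \<nu>)"
      "msupport \<nu> \<subseteq> {x \<in> A i. \<not> P x}"
    define K where "K = msupport \<nu>"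
    note s\<nu> = radonD(1)[OF \<nu>(1)]
    have K: "compact K" "K \<subseteq> A i" and KP: "\<And>x. x \<in> K \<Longrightarrow> \<not> P x" using \<nu>(4,5) by (auto simp: K_def)
    have Kb [measurable]: "K \<in> sets borel" using K(1) by (simp add: compact_imp_closed)
    \<comment> \<open>By inner regularity in \<open>K\<close>, it suffices that the compact subsets of an exceptional set are null.\<close>
    have null: "emeasure \<nu> (K \<inter> B) = 0" if B: "B \<in> sets borel"
      and n: "\<And>C. compact C \<Longrightarrow> C \<subseteq> B \<Longrightarrow> emeasure \<nu> C = 0" for B
    proof (rule ccontr)
      assume "emeasure \<nu> (K \<inter> B) \<noteq> 0"
      then have pos: "0 < emeasure \<nu> (K \<inter> B)" by (simp add: zero_less_iff_neq_zero)
      have b: "K \<inter> B \<in> sets borel" using Kb B by auto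
      obtain C where "compact C" "C \<subseteq> K \<inter> B" "0 < emeasure \<nu> C"
        by (rule radon_positive_compact_subset[OF \<nu>(1) K(1) b Int_lower1 pos])
      with n[of C] show False by simp
    qed
    define exceptional where "exceptional = K \<inter> {x. f2 x = \<infinity>} \<union> K \<inter> {x. total_pot x = \<infinity>} \<union> - K"
    have "emeasure \<nu> (K \<inter> {x. f2 x = \<infinity>}) = 0"
      by (intro null nearly_everywhere_null[OF f2_ne \<nu>(1,2)]) auto
    moreover have "emeasure \<nu> (K \<inter> {x. total_pot x = \<infinity>}) = 0"
    proof (intro null)
      fix C assume C: "compact C" "C \<subseteq> {x. total_pot x = \<infinity>}"
      show "emeasure \<nu> C = 0"
        by (rule infinite_potential_null[OF ext_radon total_energy_finite total_mass_finite \<nu>(1,2) C(1)])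
          (use C(2) in \<open>auto simp: total_pot_def\<close>)
    qed measurable
    moreover have "emeasure \<nu> (- K) = 0"
      unfolding K_def by (rule radon_null_outside_support[OF \<nu>(1)])
    moreover have exc: "K \<inter> {x. f2 x = \<infinity>} \<in> sets \<nu>" "K \<inter> {x. total_pot x = \<infinity>} \<in> sets \<nu>" "- K \<in> sets \<nu>"
      unfolding s\<nu> by measurable
    ultimately have "exceptional \<in> null_sets \<nu>"
      unfolding exceptional_def by (intro null_sets.Un null_setsI)
    then have null3: "emeasure \<nu> (exceptional) = 0"
      and exc_sets: "exceptional \<in> sets \<nu>"
      by auto
    \<comment> \<open>Up to a null set, \<open>K\<close> is exhausted by parts on which the potentials and the field are bounded.\<close>
    define K' where "K' n = {x \<in> K. total_pot x \<le> of_nat n \<and> f1 x \<le> ereal (real n) \<and> f2 x \<le> ereal (real n)}" for n :: nat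
    have K'b: "K' n \<in> sets borel" for n unfolding K'_def by measurable
    have finite_on: "\<exists>n. x \<in> K' n" if x: "x \<in> K" "f2 x \<noteq> \<infinity>" "total_pot x \<noteq> \<infinity>" for x
    proof -
      have f2r: "f2 x \<noteq> -\<infinity>" using f12 by (simp add: Phi_def)
      \<comment> \<open>An infinite value of \<open>W\<close> would satisfy the inequality.\<close>
      have "f1 x \<noteq> \<infinity>"
      proof
        assume "f1 x = \<infinity>"
        then have "f i x = Some \<infinity>" using f_eq[of x] x(2) f2r by (cases "f2 x") (auto simp: pdiff_def)
        then have "W x = Some \<infinity>"
          using vector_potential_eq[of x] x(3) by (simp add: weighted_potential_def less_top)
        then have "P x" using a_pos[OF i] by (auto simp: P_def)
        then show False using KP[OF x(1)] by simp
      qed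
      then obtain n1 where n1: "f1 x \<le> ereal (real n1)"
        by (cases "f1 x") (auto intro: real_arch_simple[THEN exE])
      obtain n2 where n2: "f2 x \<le> ereal (real n2)"
        using x(2) by (cases "f2 x") (auto intro: real_arch_simple[THEN exE])
      obtain n3 where n3: "total_pot x \<le> of_nat n3"
      proof (cases "total_pot x")
        case (real r)
        obtain n where "r \<le> real n" using real_arch_simple by blast
        with real show thesis
          by (intro that[of n]) (simp add: ennreal_of_nat_eq_real_of_nat ennreal_leI)
      qed (use x(3) in simp)
      let ?n = "max n1 (max n2 n3)"
      have "f1 x \<le> ereal (real ?n)" by (rule order_trans[OF n1]) simp
      moreover have "f2 x \<le> ereal (real ?n)" by (rule order_trans[OF n2]) simp
      moreover have "total_pot x \<le> of_nat ?n" by (rule order_trans[OF n3 of_nat_mono]) simp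
      ultimately show ?thesis using x(1) by (intro exI[of _ ?n]) (simp add: K'_def)
    qed
    have "\<exists>n. 0 < emeasure \<nu> (K' n)"
    proof (rule ccontr)
      assume "\<not> ?thesis"
      then have z: "emeasure \<nu> (K' n) = 0" for n by (simp add: not_less)
      have u0: "emeasure \<nu> (\<Union>n. K' n) = 0"
        using z K'b s\<nu> by (intro emeasure_UN_eq_0) auto
      have "UNIV \<subseteq> (\<Union>n. K' n) \<union> (exceptional)"
        using finite_on by (auto simp: exceptional_def)
      then have "emeasure \<nu> UNIV \<le> emeasure \<nu> ((\<Union>n. K' n) \<union> (exceptional))"
        using K'b exc_sets s\<nu> by (intro emeasure_mono sets.Un) auto
      also have "\<dots> \<le> emeasure \<nu> (\<Union>n. K' n) + emeasure \<nu> (exceptional)"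
        using K'b exc_sets s\<nu> by (intro emeasure_subadditive) auto
      finally show False using \<nu>(3) null3 u0 by simp
    qed
    then obtain n where n: "0 < emeasure \<nu> (K' n)" by blast
    have "K' n \<subseteq> K" by (auto simp: K'_def)
    obtain C where C: "compact C" "C \<subseteq> K' n" "0 < emeasure \<nu> C"
      by (rule radon_positive_compact_subset[OF \<nu>(1) K(1) K'b \<open>K' n \<subseteq> K\<close> n])
    have Cb: "C \<in> sets \<nu>" "C \<in> sets borel" using C(1) s\<nu> by (simp_all add: compact_imp_closed)
    have Cfin: "emeasure \<nu> C < \<infinity>" by (rule radonD(3)[OF \<nu>(1) C(1)])
    have onC: "x \<in> A i" "\<not> P x" "total_pot x \<le> of_nat n" "f1 x \<le> ereal (real n)" "f2 x \<le> ereal (real n)" if "x \<in> C" for x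
      using that C(2) K(2) KP by (auto simp: K'_def)
    have bounded_int: "integrable \<nu> (\<lambda>x. indicator C x * u x)"
      if u: "u \<in> borel_measurable borel" and b: "\<And>x. x \<in> C \<Longrightarrow> \<bar>u x\<bar> \<le> b" for u :: "'a \<Rightarrow> real" and b
    proof (rule Bochner_Integration.integrable_bound)
      show "integrable \<nu> (\<lambda>x. b * indicator C x :: real)"
        using Cb(1) Cfin by simp
      show "(\<lambda>x. indicator C x * u x) \<in> borel_measurable \<nu>"
        using u Cb s\<nu> by (intro borel_measurable_times) (simp_all cong: measurable_cong_sets)
      show "AE x in \<nu>. norm (indicator C x * u x) \<le> norm (b * indicator C x :: real)"
        using b by (intro AE_I2) (auto simp: indicator_def intro: order_trans[OF _ abs_ge_self])
    qed
    define gr where "gr x = (if x \<in> A i then g i x else 0)" for x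
    have gr: "gr \<in> borel_measurable borel"
      unfolding gr_def using g_cont[OF i] closed_A[OF i]
      by (intro borel_measurable_continuous_on_if) auto
    obtain b where b: "\<And>x. x \<in> C \<Longrightarrow> \<bar>gr x\<bar> \<le> b"
    proof -
      have "compact (g i ` C)"
        using onC(1) by (intro compact_continuous_image continuous_on_subset[OF g_cont[OF i]] C(1)) auto
      then obtain b where "\<forall>y\<in>g i ` C. norm y \<le> b" using compact_imp_bounded bounded_iff by metis
      then show thesis using onC(1) by (intro that[of b]) (auto simp: gr_def)
    qed
    define R where "R r = multiple_on r C \<nu>" for r
    have AE_C: "AE x in R r. x \<in> C" for r
    proof (rule AE_I[of _ _ "- C"])
      show "emeasure (R r) (- C) = 0"
        unfolding R_def using Cb s\<nu> by (subst emeasure_multiple_on[OF Cb(1)]) auto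
      show "- C \<in> sets (R r)"
        using Cb s\<nu> sets_multiple_on[OF Cb(1), of r] by (simp add: R_def)
    qed auto
    have mass: "finite_measure (R r)"
      "emeasure (R r) (space (R r)) \<noteq> 0" if "0 < r" for r
    proof -
      have "space (R r) = UNIV"
        using sets_eq_imp_space_eq[OF sets_multiple_on[OF Cb(1), of r]] radonD(2)[OF \<nu>(1)] by (simp add: R_def)
      then have "emeasure (R r) (space (R r)) = ennreal r * emeasure \<nu> C"
        using s\<nu> by (simp add: R_def emeasure_multiple_on[OF Cb(1)])
      moreover have "ennreal r * emeasure \<nu> C < \<infinity>" using Cfin by (simp add: ennreal_mult_less_top)
      moreover have "ennreal r * emeasure \<nu> C \<noteq> 0" using that C(3) by simp
      ultimately show "finite_measure (R r)"
        "emeasure (R r) (space (R r)) \<noteq> 0"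
        by (intro finite_measureI, simp_all)
    qed
    have meas\<nu>: "u \<in> borel_measurable \<nu>" if "u \<in> borel_measurable borel" for u :: "'a \<Rightarrow> real"
      using that s\<nu> by (simp cong: measurable_cong_sets)
    have int_gr: "integrable (R r) gr" if "0 \<le> r" for r
      unfolding R_def using integrable_multiple_on[OF Cb(1) that meas\<nu>[OF gr]] bounded_int[OF gr b] by blast
    define m where "m = (\<integral>x. indicator C x * gr x \<partial>\<nu>)"
    have "0 < m"
    proof -
      have "(\<integral>x. 0 \<partial>R 1) < (\<integral>x. gr x \<partial>R 1)"
      proof (rule finite_measure.integral_less_AE_space[OF mass(1)[OF zero_less_one]])
        show "AE x in R 1. 0 < gr x"
          using AE_C[of 1] by eventually_elim (auto simp: gr_def onC(1) g_pos[OF i])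
      qed (use int_gr[of 1] mass(2)[of 1] in auto)
      then show ?thesis by (simp add: R_def m_def integral_multiple_on[OF Cb(1) _ meas\<nu>[OF gr]])
    qed
    \<comment> \<open>This factor makes the integral of \<open>g i\<close> equal to \<open>a i\<close>.\<close>
    define r where "r = a i / m"
    have "0 < r" using \<open>0 < m\<close> a_pos[OF i] by (simp add: r_def)
    define \<tau> where "\<tau> = R r"
    have r\<tau>: "radon \<tau>" unfolding \<tau>_def R_def by (rule radon_multiple_on[OF \<nu>(1) C(1)])
    have s\<tau>: "sets \<tau> = sets borel" by (rule radonD(1)[OF r\<tau>])
    have \<tau>_on: "\<tau> \<in> radon_on (A i)"
    proof -
      have "- A i \<inter> C = {}" using onC(1) by auto
      then have "emeasure \<tau> (- A i) = 0"
        unfolding \<tau>_def R_def using closed_A[OF i] s\<nu> by (subst emeasure_multiple_on[OF Cb(1)]) auto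
      then show ?thesis using r\<tau> radon_on_closed_iff[OF closed_A[OF i]] by simp
    qed
    have \<tau>_energy: "shifted_energy \<tau> \<tau> < \<infinity>"
      unfolding \<tau>_def R_def by (rule shifted_energy_restricted_finite[OF \<nu>(1) C(1) \<nu>(2)])
    have \<tau>_pot: "(\<integral>\<^sup>+x. total_pot x \<partial>\<tau>) < \<infinity>"
    proof -
      have "(\<integral>\<^sup>+x. total_pot x \<partial>\<tau>) = ennreal r * (\<integral>\<^sup>+x. total_pot x * indicator C x \<partial>\<nu>)"
        unfolding \<tau>_def R_def using total_pot_borel s\<nu>
        by (intro nn_integral_multiple_on[OF Cb(1)]) (simp cong: measurable_cong_sets)
      also have "\<dots> \<le> ennreal r * (\<integral>\<^sup>+x. of_nat n * indicator C x \<partial>\<nu>)"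
        by (intro mult_left_mono nn_integral_mono) (auto simp: onC(3) split: split_indicator)
      also have "\<dots> < \<infinity>" using Cb Cfin by (simp add: nn_integral_cmult_indicator ennreal_mult_less_top of_nat_less_top)
      finally show ?thesis .
    qed
    have gr_int: "(\<integral>x. gr x \<partial>\<tau>) = a i"
      unfolding \<tau>_def R_def using \<open>0 < r\<close> \<open>0 < m\<close>
      by (simp add: integral_multiple_on[OF Cb(1) _ meas\<nu>[OF gr]] m_def[symmetric] r_def)
    have gr_integrable: "integrable \<tau> gr" unfolding \<tau>_def using \<open>0 < r\<close> by (intro int_gr) simp
    have \<tau>_g: "pint \<tau> ((\<lambda>x. Some (ereal (g i x))) |` A i) = Some (ereal (a i))"
      unfolding gr_int[symmetric]
    proof (rule pint_SomeI)
      have "totalize ((\<lambda>x. Some (ereal (g i x))) |` A i) = (\<lambda>x. ereal (gr x))"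
        by (auto simp: gr_def restrict_map_def fun_eq_iff)
      then show "totalize ((\<lambda>x. Some (ereal (g i x))) |` A i) \<in> borel_measurable \<tau>"
        using gr s\<tau> by (simp cong: measurable_cong_sets)
      show "AE x in \<tau>. ((\<lambda>x. Some (ereal (g i x))) |` A i) x = Some (ereal (gr x))"
        using AE_C[of r] unfolding \<tau>_def by eventually_elim (auto simp: gr_def onC(1))
    qed (rule gr_integrable)
    obtain c1 where c1: "0 \<le> c1" "\<And>x. - ereal c1 \<le> f1 x" by (rule Phi_bounded_below[OF f12(1)], rule that)
    obtain c2 where c2: "0 \<le> c2" "\<And>x. - ereal c2 \<le> f2 x" by (rule Phi_bounded_below[OF f12(2)], rule that)
    define fr where "fr x = real_of_ereal (f1 x) - real_of_ereal (f2 x)" for x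
    have fr: "fr \<in> borel_measurable borel" unfolding fr_def by measurable
    have fC: "f i x = Some (ereal (fr x)) \<and> \<bar>fr x\<bar> \<le> 2 * real n + c1 + c2" if "x \<in> C" for x
      using onC(4,5)[OF that] c1(1) c1(2)[of x] c2(1) c2(2)[of x] f_eq[of x]
      by (cases "f1 x"; cases "f2 x") (auto simp: pdiff_def fr_def)
    have \<tau>_f: "pint \<tau> (f i) = Some (ereal (\<integral>x. fr x \<partial>\<tau>))"
    proof (rule pint_SomeI)
      have "totalize (f i) = totalize (\<lambda>x. padd (pdiff 0 0) (pdiff (f1 x) (f2 x)))"
        unfolding f_eq by (auto simp: fun_eq_iff pdiff_eq)
      then show "totalize (f i) \<in> borel_measurable \<tau>"
        using s\<tau> borel_measurable_padd_pdiff[of "\<lambda>_. 0" borel "\<lambda>_. 0" f1 f2] fb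
        by (simp cong: measurable_cong_sets)
      show "AE x in \<tau>. f i x = Some (ereal (fr x))"
        using AE_C[of r] unfolding \<tau>_def by eventually_elim (use fC in blast)
      show "integrable \<tau> fr"
        unfolding \<tau>_def R_def using \<open>0 < r\<close> fC
        by (intro integrable_multiple_on[OF Cb(1) _ meas\<nu>[OF fr]] bounded_int[OF fr]) auto
    qed
    have le: "w \<le> mutual_sum \<tau> + (\<integral>x. fr x \<partial>\<tau>)"
      unfolding w_def by (rule first_variation[OF \<tau>_on \<tau>_energy \<tau>_pot \<tau>_g \<tau>_f l_f])
    define H where "H = (\<lambda>x. real_of_ereal (totalize W x))"
    have H: "AE x in \<tau>. W x = Some (ereal (H x))" "integrable \<tau> H"
      "mutual_sum \<tau> + (\<integral>x. fr x \<partial>\<tau>) = integral\<^sup>L \<tau> H"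
      unfolding H_def by (rule pint_SomeD(2-4)[OF pint_W[OF r\<tau> \<tau>_pot \<tau>_f]])+
    have "(\<integral>x. a i * H x \<partial>\<tau>) < (\<integral>x. w * gr x \<partial>\<tau>)"
    proof (rule finite_measure.integral_less_AE_space[OF mass(1)[OF \<open>0 < r\<close>, folded \<tau>_def]])
      show "AE x in \<tau>. a i * H x < w * gr x"
        using AE_C[of r, folded \<tau>_def] H(1)
      proof eventually_elim
        case (elim x)
        then show ?case using onC(1,2)[of x] by (auto simp: P_def gr_def not_le)
      qed
    qed (use H(2) gr_integrable mass(2)[OF \<open>0 < r\<close>] in \<open>auto simp: \<tau>_def[symmetric]\<close>)
    then have "a i * (mutual_sum \<tau> + (\<integral>x. fr x \<partial>\<tau>)) < w * a i"
      by (simp add: H(3) gr_int)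
    then show False using le a_pos[OF i] by (simp add: mult.commute)
  qed
  with W_l show thesis unfolding P_def by (rule that)
qed

end

theorem theorem7p1:
  fixes \<kappa> :: "'a::t2_space \<times> 'a \<Rightarrow> ereal"
    and Ipos Ineg :: "nat set"
    and A :: "nat \<Rightarrow> 'a set"
    and f :: "nat \<Rightarrow> 'a \<rightharpoonup> ereal"
    and a :: "nat \<Rightarrow> real"
    and g :: "nat \<Rightarrow> 'a \<Rightarrow> real"
    and l :: "nat \<Rightarrow> 'a measure"
  assumes "locally_compact_space (euclidean :: 'a topology)"
    and "\<kappa> \<in> Phi"
    and "positive_definite \<kappa>"
    and "condenser Ipos Ineg A"
    and "external_field \<kappa> Ipos Ineg f"
    and "\<And>i. i \<in> Ipos \<union> Ineg \<Longrightarrow> 0 < a i"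
    and "\<And>i. i \<in> Ipos \<union> Ineg \<Longrightarrow> continuous_on (A i) (g i)"
    and "\<And>i x. i \<in> Ipos \<union> Ineg \<Longrightarrow> x \<in> A i \<Longrightarrow> 0 < g i x"
    and "l \<in> equilibrium \<kappa> Ipos Ineg f A a g"
    and "i \<in> Ipos \<union> Ineg"
  shows "\<exists>c. pint (l i) (weighted_potential \<kappa> Ipos Ineg f l i) = Some c \<and>
           nearly_everywhere \<kappa> (A i)
             (\<lambda>x. \<exists>w. weighted_potential \<kappa> Ipos Ineg f l i x = Some w \<and>
                      ereal (a i) * w \<ge> c * ereal (g i x))"
proof -
  obtain c where c: "0 \<le> c" "\<And>z. - ereal c \<le> \<kappa> z" "c = 0 \<or> compact (UNIV :: ('a \<times> 'a) set)"
    by (rule Phi_bounded_below[OF assms(2)], rule that)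
  have "compact (UNIV :: 'a set)" if "compact (UNIV :: ('a \<times> 'a) set)"
  proof -
    have "compact (fst ` (UNIV :: ('a \<times> 'a) set))"
      by (intro compact_continuous_image that continuous_intros)
    then show ?thesis by simp
  qed
  with c(3) have c3: "c = 0 \<or> compact (UNIV :: 'a set)" by auto
  interpret equilibrium_problem \<kappa> c Ipos Ineg A f a g l i
    by unfold_locales (use assms c(1,2) c3 in auto)
  show ?thesis by (rule weighted_potential_lower_bound) blast
qed

end
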